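(* Suppose that $\phi:(A,d_A)\to(B,d_B)$ is a morphism of differential algebras of weight $\lambda$ and $\langle M,N,\psi\rangle$ is a differential $\phi$-bimodule. Let $\mathrm{H}^n_{\mathrm{mor}_\lambda}(\phi,\psi)$ be the cohomology group of $\phi$ with coefficients in $\langle M,N,\psi\rangle$, and let $\mathrm{H}^n_{\mathrm{DA}_\lambda}(\phi!,\psi!)$ be the cohomology group of the differential algebra $(\phi!,d_{\phi!})$ with coefficients in $(\psi!,d_{\psi!})$. Then $\mathrm{H}^n_{\mathrm{mor}_\lambda}(\phi,\psi)\cong\mathrm{H}^n_{\mathrm{DA}_\lambda}(\phi!,\psi!)$.
   Context: Work over a field $\mathbb{F}$ of characteristic $0$, with $\lambda\in\mathbb{F}$ fixed and $\lambda^0=1$. Differential algebras. A differential algebra of weight $\lambda$ is a pair $(A,d_A)$ with $A$ an associative $\mathbb{F}$-algebra and $d_A:A\to A$ linear with $d_A(uv)=d_A(u)v+u\,d_A(v)+\lambda d_A(u)d_A(v)$. A morphism $\phi:(A,d_A)\to(B,d_B)$ is an algebra morphism with $\phi d_A=d_B\phi$. A bimodule over $(A,d_A)$ is a pair $(M,d_M)$ with $M$ an $A$-bimodule and $d_M:M\to M$ linear with $d_M(ax)=d_A(a)x+a\,d_M(x)+\lambda d_A(a)d_M(x)$ and $d_M(xa)=x\,d_A(a)+d_M(x)a+\lambda d_M(x)d_A(a)$. Write ${}_\rhd M_\lhd$ for the bimodule over $(A,d_A)$ with the same space and the same $d_M$, but with actions $a\rhd m=(a+\lambda d_A(a))m$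 and $m\lhd a=m(a+\lambda d_A(a))$. Cohomology of a differential algebra. Let $\mathrm{C}^n_{\mathrm{Alg}}(A,M)=\mathrm{Hom}(A^{\otimes n},M)$ with Hochschild differential $\partial_{\mathrm{Alg}}^n(f)(a_1,\dots,a_{n+1})=a_1f(a_2,\dots,a_{n+1})+\sum_{i=1}^n(-1)^if(a_1,\dots,a_ia_{i+1},\dots,a_{n+1})+(-1)^{n+1}f(a_1,\dots,a_n)a_{n+1}$. Let $\mathrm{C}^\bullet_{\mathrm{DO}_\lambda}(A,M)$ be the complex $\mathrm{C}^\bullet_{\mathrm{Alg}}(A,{}_\rhd M_\lhd)$, with differential denoted $\partial_{\mathrm{DO}_\lambda}$. Define $\Phi^n_{A,M}=\Phi^n:\mathrm{C}^n_{\mathrm{Alg}}(A,M)\to\mathrm{C}^n_{\mathrm{DO}_\lambda}(A,M)$ by $\Phi^0(x)=-d_M(x)$ and, for $n\ge1$, $\Phi^n(f)(a_1,\dots,a_n)=\sum_{\emptyset\ne S\subseteq\{1,\dots,n\}}\lambda^{|S|-1}f(a_1^S,\dots,a_n^S)-d_M(f(a_1,\dots,a_n))$, where $a_i^S=d_A(a_i)$ if $i\in S$ and $a_i^S=a_i$ otherwise. The complex $\mathrm{C}^\bullet_{\mathrm{DA}_\lambda}(A,M)$ is the negative shift of the mapping cone of $\Phi^\bullet$: $\mathrm{C}^0_{\mathrm{DA}_\lambda}(A,M)=\mathrm{C}^0_{\mathrm{Alg}}(A,M)$, $\mathrm{C}^n_{\mathrm{DA}_\lambda}(A,M)=\mathrm{C}^n_{\mathrm{Alg}}(A,M)\oplus\mathrm{C}^{n-1}_{\mathrm{DO}_\lambda}(A,M)$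 for $n\ge1$, with differential $(f,g)\mapsto(\partial^n_{\mathrm{Alg}}f,\ -\partial^{n-1}_{\mathrm{DO}_\lambda}g-\Phi^n(f))$ (in degree $0$ there is no $g$). Its cohomology is $\mathrm{H}^\bullet_{\mathrm{DA}_\lambda}(A,M)$. Cohomology of a morphism. Given a morphism $\phi:(A,d_A)\to(B,d_B)$, view any $(B,d_B)$-bimodule as an $(A,d_A)$-bimodule through $\phi$. A differential $\phi$-bimodule $\langle M,N,\psi\rangle$ consists of an $(A,d_A)$-bimodule $(M,d_M)$, a $(B,d_B)$-bimodule $(N,d_N)$ and an $A$-bimodule morphism $\psi:M\to N$ with $\psi d_M=d_N\psi$. Let $\mathrm{C}^0(\phi,\psi)=\mathrm{C}^0_{\mathrm{Alg}}(A,M)\oplus\mathrm{C}^0_{\mathrm{Alg}}(B,N)=M\oplus N$ and, for $n\ge1$, $\mathrm{C}^n(\phi,\psi)=\mathrm{C}^n_{\mathrm{Alg}}(A,M)\oplus\mathrm{C}^n_{\mathrm{Alg}}(B,N)\oplus\mathrm{C}^{n-1}_{\mathrm{Alg}}(A,N)$, with differential $\delta^n(f,g,h)=(\partial_{\mathrm{Alg}}^nf,\ \partial_{\mathrm{Alg}}^ng,\ \psi\circ f-g\circ\phi^{\otimes n}-\partial_{\mathrm{Alg}}^{n-1}h)$ (for $n=0$ there is no $h$, and the third component is $\psi(m)-x$ on $(m,x)\in M\oplus N$). Then $\langle{}_\rhd M_\lhd,{}_\rhd N_\lhd,\psi\rangle$ is again a differential $\phi$-bimodule, written with ${}_\rhd\psi_\lhd$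 for $\psi$; its complex, with differential again written $\delta$, is $\mathrm{C}^\bullet(\phi,{}_\rhd\psi_\lhd)$. Let $\pi^n:\mathrm{C}^n(\phi,\psi)\to\mathrm{C}^n(\phi,{}_\rhd\psi_\lhd)$ be given by: $\pi^0$ is the identity map, and $\pi^n(f,g,h)=(\Phi^n_{A,M}(f),\Phi^n_{B,N}(g),\Phi^{n-1}_{A,N}(h))$ for $n\ge1$. The complex $\mathrm{C}^\bullet_{\mathrm{mor}_\lambda}(\phi,\psi)$ is the negative shift of the mapping cone of $\pi^\bullet$: $\mathrm{C}^0_{\mathrm{mor}_\lambda}(\phi,\psi)=\mathrm{C}^0(\phi,\psi)$, $\mathrm{C}^n_{\mathrm{mor}_\lambda}(\phi,\psi)=\mathrm{C}^n(\phi,\psi)\oplus\mathrm{C}^{n-1}(\phi,{}_\rhd\psi_\lhd)$ for $n\ge1$, with differential $\varrho^n(x,y)=(\delta^nx,\ \delta^{n-1}y+(-1)^n\pi^nx)$ for $n\ge1$ (and, by the same cone formula, $\varrho^0(x)=(\delta^0x,\pi^0x)$). Its cohomology is $\mathrm{H}^\bullet_{\mathrm{mor}_\lambda}(\phi,\psi)$. Mapping ring. $\phi!=A\oplus B\oplus B\phi$ (with $B\phi$ a copy of $B$, elements written $b\phi$), with product $(a+b_1+b_2\phi)(a'+b_1'+b_2'\phi)=aa'+b_1b_1'+(b_2\phi(a')+b_1b_2')\phi$ and unit $1_A+1_B$, and $d_{\phi!}(a+b_1+b_2\phi)=d_A(a)+d_B(b_1)+d_B(b_2)\phi$; $(\phi!,d_{\phi!})$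 is a differential algebra of weight $\lambda$. Also $\psi!=M\oplus N\oplus N\phi$ with actions $(a+b_1+b_2\phi)(m+n_1+n_2\phi)=am+b_1n_1+(b_2\psi(m)+b_1n_2)\phi$ and $(m+n_1+n_2\phi)(a+b_1+b_2\phi)=ma+n_1b_1+(n_2\phi(a)+n_1b_2)\phi$, and $d_{\psi!}(m+n_1+n_2\phi)=d_M(m)+d_N(n_1)+d_N(n_2)\phi$; $(\psi!,d_{\psi!})$ is a differential bimodule over $(\phi!,d_{\phi!})$.
   Formalization: Proved as stated for n≥2. Since π^0=id is not a cochain map (n=0 is false, H^1 undefined), for n=0,1 π^0 is replaced by (Φ^0,Φ^0), assuming M,N unital if n=0 and ▷M◁,▷N◁ unital if n=1. Algebras and φ are unital. *)

theory Defs
  imports Complex_Main "HOL-Library.Product_Plus" "HOL-Library.Function_Algebras"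
    "HOL-Library.Set_Algebras"
begin

section \<open>Vector spaces with a carrier, and cohomology of cochain sequences\<close>

record ('k, 'v) vspace =
  vcarrier :: "'v set"
  vadd :: "'v \<Rightarrow> 'v \<Rightarrow> 'v"
  vscale :: "'k \<Rightarrow> 'v \<Rightarrow> 'v"

definition lin_isomorphic :: "('k, 'v) vspace \<Rightarrow> ('k, 'w) vspace \<Rightarrow> bool" where
  "lin_isomorphic V W \<longleftrightarrow> (\<exists>\<Theta>. bij_betw \<Theta> (vcarrier V) (vcarrier W) \<and>
     (\<forall>x\<in>vcarrier V. \<forall>y\<in>vcarrier V. \<Theta> (vadd V x y) = vadd W (\<Theta> x) (\<Theta> y)) \<and>
     (\<forall>c. \<forall>x\<in>vcarrier V. \<Theta> (vscale V c x) = vscale W c (\<Theta> x)))"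

definition quotient_vspace :: "('k \<Rightarrow> 'v \<Rightarrow> 'v) \<Rightarrow> 'v set \<Rightarrow> 'v set \<Rightarrow> ('k, 'v::ab_group_add set) vspace"
  where
  "quotient_vspace s Z B = \<lparr>vcarrier = (\<lambda>z. z +o B) ` Z,
     vadd = (\<lambda>X Y. X + Y),
     vscale = (\<lambda>c X. \<Union>x\<in>X. s c x +o B)\<rparr>"

text \<open>The \<open>n\<close>-th space \<open>C n\<close> and the differential \<open>d n\<close> from \<open>C n\<close> to \<open>C (n + 1)\<close>; all
  degrees live in one ambient type.\<close>

definition cocycles :: "(nat \<Rightarrow> 'v::zero set) \<Rightarrow> (nat \<Rightarrow> 'v \<Rightarrow> 'v) \<Rightarrow> nat \<Rightarrow> 'v set" where
  "cocycles C d n = {x \<in> C n. d n x = 0}"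

definition coboundaries :: "(nat \<Rightarrow> 'v::zero set) \<Rightarrow> (nat \<Rightarrow> 'v \<Rightarrow> 'v) \<Rightarrow> nat \<Rightarrow> 'v set" where
  "coboundaries C d n = (if n = 0 then {0} else d (n - 1) ` C (n - 1))"

definition cohomology ::
  "('k \<Rightarrow> 'v \<Rightarrow> 'v) \<Rightarrow> (nat \<Rightarrow> 'v::ab_group_add set) \<Rightarrow> (nat \<Rightarrow> 'v \<Rightarrow> 'v) \<Rightarrow> nat \<Rightarrow> ('k, 'v set) vspace"
  where
  "cohomology s C d n = quotient_vspace s (cocycles C d n) (coboundaries C d n)"

definition fun_scale :: "('k \<Rightarrow> 'v \<Rightarrow> 'v) \<Rightarrow> 'k \<Rightarrow> ('x \<Rightarrow> 'v) \<Rightarrow> 'x \<Rightarrow> 'v" where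
  "fun_scale s c f = (\<lambda>x. s c (f x))"

definition prod_scale :: "('k \<Rightarrow> 'v \<Rightarrow> 'v) \<Rightarrow> ('k \<Rightarrow> 'w \<Rightarrow> 'w) \<Rightarrow> 'k \<Rightarrow> 'v \<times> 'w \<Rightarrow> 'v \<times> 'w" where
  "prod_scale s t c = (\<lambda>(x, y). (s c x, t c y))"


section \<open>Differential algebras and bimodules of weight \<open>lam\<close>\<close>

text \<open>The additive group of an algebra or bimodule is the one of its type; the remaining
  operations are record fields, since those of the mapping ring depend on the morphism.\<close>

record ('k, 'a) dalg =
  ascale :: "'k \<Rightarrow> 'a \<Rightarrow> 'a"
  amult :: "'a \<Rightarrow> 'a \<Rightarrow> 'a"
  aone :: "'a"
  ader :: "'a \<Rightarrow> 'a"

record ('k, 'a, 'm) dbimod =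
  mscale :: "'k \<Rightarrow> 'm \<Rightarrow> 'm"
  lact :: "'a \<Rightarrow> 'm \<Rightarrow> 'm"
  ract :: "'m \<Rightarrow> 'a \<Rightarrow> 'm"
  mder :: "'m \<Rightarrow> 'm"

definition diff_algebra :: "'k::field_char_0 \<Rightarrow> ('k, 'a::ab_group_add) dalg \<Rightarrow> bool" where
  "diff_algebra lam A \<longleftrightarrow>
     vector_space (ascale A) \<and>
     (\<forall>v. Vector_Spaces.linear (ascale A) (ascale A) (\<lambda>u. amult A u v)) \<and>
     (\<forall>u. Vector_Spaces.linear (ascale A) (ascale A) (\<lambda>v. amult A u v)) \<and>
     (\<forall>u v w. amult A (amult A u v) w = amult A u (amult A v w)) \<and>
     (\<forall>u. amult A (aone A) u = u \<and> amult A u (aone A) = u) \<and>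
     Vector_Spaces.linear (ascale A) (ascale A) (ader A) \<and>
     (\<forall>u v. ader A (amult A u v) = amult A (ader A u) v + amult A u (ader A v)
        + ascale A lam (amult A (ader A u) (ader A v)))"

definition diff_alg_morphism ::
  "('k::field_char_0, 'a::ab_group_add) dalg \<Rightarrow> ('k, 'b::ab_group_add) dalg \<Rightarrow> ('a \<Rightarrow> 'b) \<Rightarrow> bool" where
  "diff_alg_morphism A B \<phi> \<longleftrightarrow>
     Vector_Spaces.linear (ascale A) (ascale B) \<phi> \<and>
     (\<forall>u v. \<phi> (amult A u v) = amult B (\<phi> u) (\<phi> v)) \<and>
     \<phi> (aone A) = aone B \<and>
     (\<forall>u. \<phi> (ader A u) = ader B (\<phi> u))"

text \<open>The unit is not required to act as the identity: \<open>ader A (aone A)\<close> may be nonzero when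
  \<open>lam \<noteq> 0\<close>, and then \<open>twist\<close> below turns a unital bimodule into a non-unital one.\<close>

definition diff_bimodule ::
  "'k::field_char_0 \<Rightarrow> ('k, 'a::ab_group_add) dalg \<Rightarrow> ('k, 'a, 'm::ab_group_add) dbimod \<Rightarrow> bool" where
  "diff_bimodule lam A M \<longleftrightarrow>
     vector_space (mscale M) \<and>
     (\<forall>x. Vector_Spaces.linear (ascale A) (mscale M) (\<lambda>a. lact M a x)) \<and>
     (\<forall>a. Vector_Spaces.linear (mscale M) (mscale M) (\<lambda>x. lact M a x)) \<and>
     (\<forall>a. Vector_Spaces.linear (mscale M) (mscale M) (\<lambda>x. ract M x a)) \<and>
     (\<forall>x. Vector_Spaces.linear (ascale A) (mscale M) (\<lambda>a. ract M x a)) \<and>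
     (\<forall>a b x. lact M (amult A a b) x = lact M a (lact M b x)) \<and>
     (\<forall>a b x. ract M x (amult A a b) = ract M (ract M x a) b) \<and>
     (\<forall>a b x. ract M (lact M a x) b = lact M a (ract M x b)) \<and>
     Vector_Spaces.linear (mscale M) (mscale M) (mder M) \<and>
     (\<forall>a x. mder M (lact M a x) = lact M (ader A a) x + lact M a (mder M x)
        + mscale M lam (lact M (ader A a) (mder M x))) \<and>
     (\<forall>a x. mder M (ract M x a) = ract M x (ader A a) + ract M (mder M x) a
        + mscale M lam (ract M (mder M x) (ader A a)))"

definition unital_bimodule :: "('k, 'a) dalg \<Rightarrow> ('k, 'a, 'm) dbimod \<Rightarrow> bool" where
  "unital_bimodule A M \<longleftrightarrow> (\<forall>x. lact M (aone A) x = x \<and> ract M x (aone A) = x)"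

definition twist ::
  "'k \<Rightarrow> ('k, 'a::ab_group_add) dalg \<Rightarrow> ('k, 'a, 'm) dbimod \<Rightarrow> ('k, 'a, 'm) dbimod" where
  "twist lam A M = \<lparr>mscale = mscale M,
     lact = (\<lambda>a x. lact M (a + ascale A lam (ader A a)) x),
     ract = (\<lambda>x a. ract M x (a + ascale A lam (ader A a))),
     mder = mder M\<rparr>"

definition pullback :: "('a \<Rightarrow> 'b) \<Rightarrow> ('k, 'b, 'n) dbimod \<Rightarrow> ('k, 'a, 'n) dbimod" where
  "pullback \<phi> N = \<lparr>mscale = mscale N,
     lact = (\<lambda>a x. lact N (\<phi> a) x),
     ract = (\<lambda>x a. ract N x (\<phi> a)),
     mder = mder N\<rparr>"

definition diff_phi_bimodule ::
  "'k::field_char_0 \<Rightarrow> ('k, 'a::ab_group_add) dalg \<Rightarrow> ('k, 'b::ab_group_add) dalg \<Rightarrow> ('a \<Rightarrow> 'b) \<Rightarrow>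
   ('k, 'a, 'm::ab_group_add) dbimod \<Rightarrow> ('k, 'b, 'n::ab_group_add) dbimod \<Rightarrow> ('m \<Rightarrow> 'n) \<Rightarrow> bool" where
  "diff_phi_bimodule lam A B \<phi> M N \<psi> \<longleftrightarrow>
     diff_bimodule lam A M \<and> diff_bimodule lam B N \<and>
     Vector_Spaces.linear (mscale M) (mscale N) \<psi> \<and>
     (\<forall>a x. \<psi> (lact M a x) = lact (pullback \<phi> N) a (\<psi> x)) \<and>
     (\<forall>a x. \<psi> (ract M x a) = ract (pullback \<phi> N) (\<psi> x) a) \<and>
     (\<forall>x. \<psi> (mder M x) = mder N (\<psi> x))"


section \<open>Cohomology of a differential algebra\<close>

text \<open>An element of \<open>Hom(A\<^sup>\<otimes>\<^sup>n, M)\<close> is a function of lists that is multilinear on lists of length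
  \<open>n\<close> and zero on all other lists.\<close>

definition cochains ::
  "('k::field_char_0, 'a::ab_group_add) dalg \<Rightarrow> ('k, 'a, 'm::ab_group_add) dbimod \<Rightarrow> nat \<Rightarrow> ('a list \<Rightarrow> 'm) set"
  where
  "cochains A M n = {f. (\<forall>as. length as \<noteq> n \<longrightarrow> f as = 0) \<and>
     (\<forall>as i. length as = n \<and> i < n \<longrightarrow>
        Vector_Spaces.linear (ascale A) (mscale M) (\<lambda>a. f (as[i := a])))}"

text \<open>List positions count from \<open>0\<close>, so the argument \<open>a\<^sub>i\<close> is \<open>as ! (i - 1)\<close>.\<close>

definition hochschild ::
  "('k::field_char_0, 'a::ab_group_add) dalg \<Rightarrow> ('k, 'a, 'm::ab_group_add) dbimod \<Rightarrow> nat \<Rightarrow>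
   ('a list \<Rightarrow> 'm) \<Rightarrow> 'a list \<Rightarrow> 'm" where
  "hochschild A M n f = (\<lambda>as. if length as = n + 1 then
       lact M (hd as) (f (tl as))
       + (\<Sum>i = 1..n. mscale M ((-1) ^ i)
            (f (take (i - 1) as @ amult A (as ! (i - 1)) (as ! i) # drop (i + 1) as)))
       + mscale M ((-1) ^ (n + 1)) (ract M (f (butlast as)) (last as))
     else 0)"

definition Phi ::
  "'k::field_char_0 \<Rightarrow> ('k, 'a::ab_group_add) dalg \<Rightarrow> ('k, 'a, 'm::ab_group_add) dbimod \<Rightarrow> nat \<Rightarrow>
   ('a list \<Rightarrow> 'm) \<Rightarrow> 'a list \<Rightarrow> 'm" where
  "Phi lam A M n f = (\<lambda>as. if length as = n then
       (\<Sum>S | S \<subseteq> {..<n} \<and> S \<noteq> {}. mscale M (lam ^ (card S - 1))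
            (f (map (\<lambda>i. if i \<in> S then ader A (as ! i) else as ! i) [0..<n])))
       - mder M (f as)
     else 0)"

definition DA_cochains ::
  "'k::field_char_0 \<Rightarrow> ('k, 'a::ab_group_add) dalg \<Rightarrow> ('k, 'a, 'm::ab_group_add) dbimod \<Rightarrow> nat \<Rightarrow>
   (('a list \<Rightarrow> 'm) \<times> ('a list \<Rightarrow> 'm)) set" where
  "DA_cochains lam A M n =
     cochains A M n \<times> (if n = 0 then {0} else cochains A (twist lam A M) (n - 1))"

definition DA_diff ::
  "'k::field_char_0 \<Rightarrow> ('k, 'a::ab_group_add) dalg \<Rightarrow> ('k, 'a, 'm::ab_group_add) dbimod \<Rightarrow> nat \<Rightarrow>
   ('a list \<Rightarrow> 'm) \<times> ('a list \<Rightarrow> 'm) \<Rightarrow> ('a list \<Rightarrow> 'm) \<times> ('a list \<Rightarrow> 'm)" where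
  "DA_diff lam A M n = (\<lambda>(f, g). (hochschild A M n f,
     - (if n = 0 then 0 else hochschild A (twist lam A M) (n - 1) g) - Phi lam A M n f))"

definition H_DA ::
  "'k::field_char_0 \<Rightarrow> ('k, 'a::ab_group_add) dalg \<Rightarrow> ('k, 'a, 'm::ab_group_add) dbimod \<Rightarrow> nat \<Rightarrow>
   ('k, (('a list \<Rightarrow> 'm) \<times> ('a list \<Rightarrow> 'm)) set) vspace" where
  "H_DA lam A M = cohomology (prod_scale (fun_scale (mscale M)) (fun_scale (mscale M)))
     (DA_cochains lam A M) (DA_diff lam A M)"


section \<open>Cohomology of a morphism\<close>

type_synonym ('a, 'b, 'm, 'n) phi_cochain =
  "('a list \<Rightarrow> 'm) \<times> ('b list \<Rightarrow> 'n) \<times> ('a list \<Rightarrow> 'n)"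

definition phi_cochains ::
  "('k::field_char_0, 'a::ab_group_add) dalg \<Rightarrow> ('k, 'b::ab_group_add) dalg \<Rightarrow> ('a \<Rightarrow> 'b) \<Rightarrow>
   ('k, 'a, 'm::ab_group_add) dbimod \<Rightarrow> ('k, 'b, 'n::ab_group_add) dbimod \<Rightarrow> nat \<Rightarrow>
   ('a, 'b, 'm, 'n) phi_cochain set" where
  "phi_cochains A B \<phi> M N n =
     cochains A M n \<times> cochains B N n \<times> (if n = 0 then {0} else cochains A (pullback \<phi> N) (n - 1))"

definition phi_diff ::
  "('k::field_char_0, 'a::ab_group_add) dalg \<Rightarrow> ('k, 'b::ab_group_add) dalg \<Rightarrow> ('a \<Rightarrow> 'b) \<Rightarrow>
   ('k, 'a, 'm::ab_group_add) dbimod \<Rightarrow> ('k, 'b, 'n::ab_group_add) dbimod \<Rightarrow> ('m \<Rightarrow> 'n) \<Rightarrow> nat \<Rightarrow>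
   ('a, 'b, 'm, 'n) phi_cochain \<Rightarrow> ('a, 'b, 'm, 'n) phi_cochain" where
  "phi_diff A B \<phi> M N \<psi> n = (\<lambda>(f, g, h).
     (hochschild A M n f, hochschild B N n g,
      (\<lambda>as. \<psi> (f as) - g (map \<phi> as)) - (if n = 0 then 0 else hochschild A (pullback \<phi> N) (n - 1) h)))"

definition pi_map ::
  "'k::field_char_0 \<Rightarrow> ('k, 'a::ab_group_add) dalg \<Rightarrow> ('k, 'b::ab_group_add) dalg \<Rightarrow> ('a \<Rightarrow> 'b) \<Rightarrow>
   ('k, 'a, 'm::ab_group_add) dbimod \<Rightarrow> ('k, 'b, 'n::ab_group_add) dbimod \<Rightarrow> nat \<Rightarrow>
   ('a, 'b, 'm, 'n) phi_cochain \<Rightarrow> ('a, 'b, 'm, 'n) phi_cochain" where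
  "pi_map lam A B \<phi> M N n = (\<lambda>(f, g, h). if n = 0 then (f, g, h) else
     (Phi lam A M n f, Phi lam B N n g, Phi lam A (pullback \<phi> N) (n - 1) h))"

text \<open>\<open>pi_map\<close> does not commute with the differentials from degree \<open>0\<close> to degree \<open>1\<close>.
  The variant below agrees with it in positive degrees, uses \<open>Phi\<close> in degree \<open>0\<close> too, and
  is a cochain map.\<close>

definition pi_chain_map ::
  "'k::field_char_0 \<Rightarrow> ('k, 'a::ab_group_add) dalg \<Rightarrow> ('k, 'b::ab_group_add) dalg \<Rightarrow> ('a \<Rightarrow> 'b) \<Rightarrow>
   ('k, 'a, 'm::ab_group_add) dbimod \<Rightarrow> ('k, 'b, 'n::ab_group_add) dbimod \<Rightarrow> nat \<Rightarrow>
   ('a, 'b, 'm, 'n) phi_cochain \<Rightarrow> ('a, 'b, 'm, 'n) phi_cochain" where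
  "pi_chain_map lam A B \<phi> M N n = (\<lambda>(f, g, h). if n = 0 then (Phi lam A M 0 f, Phi lam B N 0 g, 0)
     else pi_map lam A B \<phi> M N n (f, g, h))"

definition mor_cochains ::
  "'k::field_char_0 \<Rightarrow> ('k, 'a::ab_group_add) dalg \<Rightarrow> ('k, 'b::ab_group_add) dalg \<Rightarrow> ('a \<Rightarrow> 'b) \<Rightarrow>
   ('k, 'a, 'm::ab_group_add) dbimod \<Rightarrow> ('k, 'b, 'n::ab_group_add) dbimod \<Rightarrow> nat \<Rightarrow>
   (('a, 'b, 'm, 'n) phi_cochain \<times> ('a, 'b, 'm, 'n) phi_cochain) set" where
  "mor_cochains lam A B \<phi> M N n = phi_cochains A B \<phi> M N n \<times>
     (if n = 0 then {0} else phi_cochains A B \<phi> (twist lam A M) (twist lam B N) (n - 1))"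

text \<open>The family \<open>p\<close> of maps whose cone is taken is a parameter.\<close>

definition mor_diff ::
  "(nat \<Rightarrow> ('a, 'b, 'm, 'n) phi_cochain \<Rightarrow> ('a, 'b, 'm, 'n) phi_cochain) \<Rightarrow>
   'k::field_char_0 \<Rightarrow> ('k, 'a::ab_group_add) dalg \<Rightarrow> ('k, 'b::ab_group_add) dalg \<Rightarrow> ('a \<Rightarrow> 'b) \<Rightarrow>
   ('k, 'a, 'm::ab_group_add) dbimod \<Rightarrow> ('k, 'b, 'n::ab_group_add) dbimod \<Rightarrow> ('m \<Rightarrow> 'n) \<Rightarrow> nat \<Rightarrow>
   ('a, 'b, 'm, 'n) phi_cochain \<times> ('a, 'b, 'm, 'n) phi_cochain \<Rightarrow>
   ('a, 'b, 'm, 'n) phi_cochain \<times> ('a, 'b, 'm, 'n) phi_cochain" where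
  "mor_diff p lam A B \<phi> M N \<psi> n = (\<lambda>(x, y). (phi_diff A B \<phi> M N \<psi> n x,
     (if n = 0 then 0 else phi_diff A B \<phi> (twist lam A M) (twist lam B N) \<psi> (n - 1) y)
     + (if even n then p n x else - p n x)))"

definition phi_scale ::
  "('k, 'a, 'm) dbimod \<Rightarrow> ('k, 'b, 'n) dbimod \<Rightarrow> 'k \<Rightarrow>
   ('a, 'b, 'm, 'n) phi_cochain \<Rightarrow> ('a, 'b, 'm, 'n) phi_cochain" where
  "phi_scale M N = prod_scale (fun_scale (mscale M))
     (prod_scale (fun_scale (mscale N)) (fun_scale (mscale N)))"

definition H_mor ::
  "'k::field_char_0 \<Rightarrow> ('k, 'a::ab_group_add) dalg \<Rightarrow> ('k, 'b::ab_group_add) dalg \<Rightarrow> ('a \<Rightarrow> 'b) \<Rightarrow>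
   ('k, 'a, 'm::ab_group_add) dbimod \<Rightarrow> ('k, 'b, 'n::ab_group_add) dbimod \<Rightarrow> ('m \<Rightarrow> 'n) \<Rightarrow> nat \<Rightarrow>
   ('k, (('a, 'b, 'm, 'n) phi_cochain \<times> ('a, 'b, 'm, 'n) phi_cochain) set) vspace" where
  "H_mor lam A B \<phi> M N \<psi> = cohomology (prod_scale (phi_scale M N) (phi_scale M N))
     (mor_cochains lam A B \<phi> M N) (mor_diff (pi_map lam A B \<phi> M N) lam A B \<phi> M N \<psi>)"

definition H_mor_chain ::
  "'k::field_char_0 \<Rightarrow> ('k, 'a::ab_group_add) dalg \<Rightarrow> ('k, 'b::ab_group_add) dalg \<Rightarrow> ('a \<Rightarrow> 'b) \<Rightarrow>
   ('k, 'a, 'm::ab_group_add) dbimod \<Rightarrow> ('k, 'b, 'n::ab_group_add) dbimod \<Rightarrow> ('m \<Rightarrow> 'n) \<Rightarrow> nat \<Rightarrow>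
   ('k, (('a, 'b, 'm, 'n) phi_cochain \<times> ('a, 'b, 'm, 'n) phi_cochain) set) vspace" where
  "H_mor_chain lam A B \<phi> M N \<psi> = cohomology (prod_scale (phi_scale M N) (phi_scale M N))
     (mor_cochains lam A B \<phi> M N) (mor_diff (pi_chain_map lam A B \<phi> M N) lam A B \<phi> M N \<psi>)"


section \<open>The mapping ring and its bimodule\<close>

text \<open>The triple \<open>(a, b\<^sub>1, b\<^sub>2)\<close> stands for \<open>a + b\<^sub>1 + b\<^sub>2\<phi>\<close>, and similarly for \<open>\<psi>!\<close>.\<close>

definition mapping_ring ::
  "('k, 'a) dalg \<Rightarrow> ('k, 'b::ab_group_add) dalg \<Rightarrow> ('a \<Rightarrow> 'b) \<Rightarrow> ('k, 'a \<times> 'b \<times> 'b) dalg" where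
  "mapping_ring A B \<phi> = \<lparr>
     ascale = prod_scale (ascale A) (prod_scale (ascale B) (ascale B)),
     amult = (\<lambda>(a, b1, b2) (a', b1', b2').
       (amult A a a', amult B b1 b1', amult B b2 (\<phi> a') + amult B b1 b2')),
     aone = (aone A, aone B, 0),
     ader = (\<lambda>(a, b1, b2). (ader A a, ader B b1, ader B b2))\<rparr>"

definition mapping_bimodule ::
  "('a \<Rightarrow> 'b) \<Rightarrow> ('k, 'a, 'm) dbimod \<Rightarrow> ('k, 'b, 'n::ab_group_add) dbimod \<Rightarrow> ('m \<Rightarrow> 'n) \<Rightarrow>
   ('k, 'a \<times> 'b \<times> 'b, 'm \<times> 'n \<times> 'n) dbimod" where
  "mapping_bimodule \<phi> M N \<psi> = \<lparr>
     mscale = prod_scale (mscale M) (prod_scale (mscale N) (mscale N)),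
     lact = (\<lambda>(a, b1, b2) (m, n1, n2).
       (lact M a m, lact N b1 n1, lact N b2 (\<psi> m) + lact N b1 n2)),
     ract = (\<lambda>(m, n1, n2) (a, b1, b2).
       (ract M m a, ract N n1 b1, ract N n2 (\<phi> a) + ract N n1 b2)),
     mder = (\<lambda>(m, n1, n2). (mder M m, mder N n1, mder N n2))\<rparr>"

end

(* Both complexes are cones, so by a five lemma it suffices to compare, for one pair of bimodules at a
   time, C(phi, psi) with the Hochschild complex of phi! with coefficients in psi!. The comparison map
   tau sends (f, g, h) to a cochain whose last component is the sum over i of
   g(b_1, ..., b_1, b_2, phi(a), ..., phi(a)), with b_2 at position i, plus b_2 h(a, ..., a). It uses no
   units and therefore commutes with Phi, although the twisted bimodules are not unital.

   That tau is bijective on cohomology in positive degrees comes from one kind of homotopy: if alpha and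
   beta are multiplicative maps and alpha(x) v = v beta(x), then the alternating sum over the ways to
   insert v, with alpha applied before it and beta after it, is a homotopy between F(beta, ..., beta)
   multiplied by v on the left and F(alpha, ..., alpha) multiplied by v on the right. Taking for v the
   units of A and B, the element 1 phi, and the column vector (1_B, 1 phi) gives a retraction rho of tau
   and reduces every cocycle to one in the image of tau. The part of the coefficients on which units act
   by zero has no cohomology in positive degrees. *)
theory Submission
  imports Defs
begin


section \<open>Linear maps between spaces with explicit scalar multiplication\<close>

text \<open>What shapes the proof is that a twisted bimodule is not unital: the unit acts on it by
  \<open>1 + lam d(1)\<close>. Up to coboundaries a cocycle can be given values of the form
  \<open>1 w 1\<close>, but only in positive degrees. In degree 0 an element n of N killed by B on
  both sides gives the cocycle \<open>(0, 0, n)\<close> of \<open>\<psi>!\<close>, which the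
  comparison map misses; hence the unit hypotheses. They return in degree 1 because the five lemma
  in degree n also involves degree n - 1 of the twisted complex. The sum in the comparison map is a
  matrix entry: sending \<open>a + b\<^sub>1 + b\<^sub>2\<phi>\<close> to the upper triangular
  matrix with diagonal \<open>b\<^sub>1, \<phi>(a)\<close> and corner \<open>b\<^sub>2\<close> is
  multiplicative, and the sum is the corner entry of g evaluated on such matrices. The column vector
  comes from the same matrices. The prescribed \<pi> is the identity in degree 0 and not a cochain
  map there; this affects only the differential out of degree 0, hence no cohomology in degree 2 or
  higher.\<close>

definition lin :: "('k::field \<Rightarrow> 'v::ab_group_add \<Rightarrow> 'v) \<Rightarrow> ('k \<Rightarrow> 'w::ab_group_add \<Rightarrow> 'w) \<Rightarrow> ('v \<Rightarrow> 'w) \<Rightarrow> bool"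
  where "lin s t f \<longleftrightarrow> (\<forall>x y. f (x + y) = f x + f y) \<and> (\<forall>c x. f (s c x) = t c (f x))"

lemma linear_iff_lin:
  "Vector_Spaces.linear s t f \<longleftrightarrow> vector_space s \<and> vector_space t \<and> lin s t f"
  by (auto simp: Vector_Spaces.linear_iff lin_def)

lemma linI: "(\<And>x y. f (x + y) = f x + f y) \<Longrightarrow> (\<And>c x. f (s c x) = t c (f x)) \<Longrightarrow> lin s t f"
  by (simp add: lin_def)

lemma lin_add: "lin s t f \<Longrightarrow> f (x + y) = f x + f y"
  and lin_scale: "lin s t f \<Longrightarrow> f (s c x) = t c (f x)"
  by (simp_all add: lin_def)

lemma lin_zero: "lin s t f \<Longrightarrow> f 0 = 0"
  using lin_add[of s t f 0 0] by simp

lemma lin_minus: "lin s t f \<Longrightarrow> f (- x) = - f x"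
  using lin_add[of s t f x "- x"] lin_zero[of s t f] by (simp add: eq_neg_iff_add_eq_0 add.commute)

lemma lin_diff: "lin s t f \<Longrightarrow> f (x - y) = f x - f y"
  using lin_add[of s t f x "- y"] lin_minus[of s t f] by simp

lemmas lin_simps = lin_add lin_zero lin_minus lin_diff lin_scale

lemma vs_simps:
  assumes "vector_space s"
  shows "s c (x + y) = s c x + s c y" "s c (x - y) = s c x - s c y" "s c (- x) = - s c x" "s c 0 = 0"
    "s 1 x = x" "s a (s b x) = s (a * b) x" "s (- c) x = - s c x" "s 0 x = 0" "s (a + b) x = s a x + s b x"
proof -
  interpret vector_space s by fact
  show "s c (x + y) = s c x + s c y" "s c (x - y) = s c x - s c y" "s c (- x) = - s c x" "s c 0 = 0"
    "s 1 x = x" "s a (s b x) = s (a * b) x" "s (- c) x = - s c x" "s 0 x = 0" "s (a + b) x = s a x + s b x"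
    by (simp_all add: algebra_simps)
qed

lemma lin_comp: "lin s t f \<Longrightarrow> lin t u g \<Longrightarrow> lin s u (\<lambda>x. g (f x))"
  by (simp add: lin_def)

lemma lin_const_zero: "vector_space t \<Longrightarrow> lin s t (\<lambda>x. 0)"
  by (simp add: lin_def vs_simps)

lemma lin_plus: "vector_space t \<Longrightarrow> lin s t f \<Longrightarrow> lin s t g \<Longrightarrow> lin s t (\<lambda>x. f x + g x)"
  by (simp add: lin_def vs_simps)

lemma lin_sub: "vector_space t \<Longrightarrow> lin s t f \<Longrightarrow> lin s t g \<Longrightarrow> lin s t (\<lambda>x. f x - g x)"
  by (simp add: lin_def vs_simps)

lemma lin_uminus: "vector_space t \<Longrightarrow> lin s t f \<Longrightarrow> lin s t (\<lambda>x. - f x)"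
  by (simp add: lin_def vs_simps)

lemma lin_scaled: "vector_space t \<Longrightarrow> lin s t f \<Longrightarrow> lin s t (\<lambda>x. t c (f x))"
  by (simp add: lin_def vs_simps mult.commute)

lemma lin_ident: "lin s s (\<lambda>x. x)"
  by (simp add: lin_def)

lemma vector_space_prod_scale:
  "vector_space s \<Longrightarrow> vector_space t \<Longrightarrow> vector_space (prod_scale s t)"
  unfolding vector_space_def prod_scale_def by (auto simp: algebra_simps)

lemma vector_space_fun_scale: "vector_space s \<Longrightarrow> vector_space (fun_scale s)"
  unfolding vector_space_def fun_scale_def by (auto simp: algebra_simps fun_eq_iff)


section \<open>Algebras, bimodules, and cochains\<close>

locale assoc_alg =
  fixes A :: "('k::field_char_0, 'a::ab_group_add) dalg"
  assumes vs_A: "vector_space (ascale A)"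
    and lin_mult_left: "lin (ascale A) (ascale A) (\<lambda>u. amult A u v)"
    and lin_mult_right: "lin (ascale A) (ascale A) (\<lambda>v. amult A u v)"
    and mult_assoc: "amult A (amult A u v) w = amult A u (amult A v w)"
    and mult_one_left [simp]: "amult A (aone A) u = u"
    and mult_one_right [simp]: "amult A u (aone A) = u"
begin

lemmas mult_left_simps [simp] = lin_simps[OF lin_mult_left]
lemmas mult_right_simps [simp] = lin_simps[OF lin_mult_right]

end

text \<open>No unit law for the actions and no derivation: this way twisted bimodules, and bimodules
  restricted along two different homomorphisms, are instances as well.\<close>

locale bimod = assoc_alg A for A :: "('k::field_char_0, 'a::ab_group_add) dalg" +
  fixes M :: "('k, 'a, 'm::ab_group_add) dbimod"
  assumes vs_M: "vector_space (mscale M)"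
    and lin_lact_alg: "lin (ascale A) (mscale M) (\<lambda>a. lact M a x)"
    and lin_lact_mod: "lin (mscale M) (mscale M) (\<lambda>x. lact M a x)"
    and lin_ract_mod: "lin (mscale M) (mscale M) (\<lambda>x. ract M x a)"
    and lin_ract_alg: "lin (ascale A) (mscale M) (\<lambda>a. ract M x a)"
    and lact_mult: "lact M (amult A a b) x = lact M a (lact M b x)"
    and ract_mult: "ract M x (amult A a b) = ract M (ract M x a) b"
    and lact_ract: "ract M (lact M a x) b = lact M a (ract M x b)"
begin

lemmas act_simps [simp] = lin_simps[OF lin_lact_alg] lin_simps[OF lin_lact_mod]
  lin_simps[OF lin_ract_mod] lin_simps[OF lin_ract_alg]
lemmas scale_simps [simp] = vs_simps[OF vs_M]

end

lemma cochains_0: "f \<in> cochains A M 0 \<longleftrightarrow> (\<forall>as. as \<noteq> [] \<longrightarrow> f as = 0)"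
  by (auto simp: cochains_def)

lemma cochains_length: "f \<in> cochains A M n \<Longrightarrow> length as \<noteq> n \<Longrightarrow> f as = 0"
  by (simp add: cochains_def)

text \<open>Currying, Hom(A^(n+1), M) = Hom(A, Hom(A^n, M)); this is the induction step for the
  recursive operators below. Linearity in the head can be asked for all tails, since a tail of the
  wrong length gives the zero map.\<close>

lemma cochains_Suc:
  assumes A: "vector_space (ascale A)" and M: "vector_space (mscale M)"
  shows "f \<in> cochains A M (Suc n) \<longleftrightarrow> f [] = 0 \<and> (\<forall>x. (\<lambda>l. f (x # l)) \<in> cochains A M n) \<and>
     (\<forall>as. lin (ascale A) (mscale M) (\<lambda>a. f (a # as)))" (is "?L \<longleftrightarrow> ?R")
proof
  assume L: ?L
  have "lin (ascale A) (mscale M) (\<lambda>a. f (a # as))" for as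
  proof (cases "length as = n")
    case True
    then have "length (0 # as) = Suc n" by simp
    then have "Vector_Spaces.linear (ascale A) (mscale M) (\<lambda>a. f ((0 # as)[0 := a]))"
      using L unfolding cochains_def by blast
    then show ?thesis by (simp add: linear_iff_lin)
  next
    case False
    then have "f (a # as) = 0" for a using L by (simp add: cochains_def)
    then show ?thesis using M by (simp add: lin_const_zero)
  qed
  moreover have "(\<lambda>l. f (x # l)) \<in> cochains A M n" for x
    unfolding cochains_def mem_Collect_eq
  proof (intro conjI allI impI)
    fix as :: "'b list" assume "length as \<noteq> n" then show "f (x # as) = 0" using L by (simp add: cochains_def)
  next
    fix as :: "'b list" and i assume "length as = n \<and> i < n"
    then have "length (x # as) = Suc n \<and> Suc i < Suc n" by simp
    then have "Vector_Spaces.linear (ascale A) (mscale M) (\<lambda>a. f ((x # as)[Suc i := a]))"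
      using L unfolding cochains_def by blast
    then show "Vector_Spaces.linear (ascale A) (mscale M) (\<lambda>a. f (x # as[i := a]))" by simp
  qed
  moreover have "f [] = 0" using L by (simp add: cochains_def)
  ultimately show ?R by blast
next
  assume R: ?R
  show ?L unfolding cochains_def mem_Collect_eq
  proof (intro conjI allI impI)
    fix as :: "'b list" assume "length as \<noteq> Suc n" then show "f as = 0"
      using R by (cases as) (auto simp: cochains_def)
  next
    fix as :: "'b list" and i assume *: "length as = Suc n \<and> i < Suc n"
    then obtain x xs where as: "as = x # xs" "length xs = n" by (cases as) auto
    show "Vector_Spaces.linear (ascale A) (mscale M) (\<lambda>a. f (as[i := a]))"
    proof (cases i)
      case 0 then show ?thesis using R A M as by (simp add: linear_iff_lin)
    next
      case (Suc j)
      then have "length xs = n \<and> j < n" using * as by simp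
      then show ?thesis using R Suc as by (simp add: cochains_def)
    qed
  qed
qed

lemma cochains_zero: "vector_space (ascale A) \<Longrightarrow> vector_space (mscale M) \<Longrightarrow> 0 \<in> cochains A M n"
  by (simp add: cochains_def linear_iff_lin lin_const_zero)

lemma cochains_zero': "vector_space (ascale A) \<Longrightarrow> vector_space (mscale M) \<Longrightarrow> (\<lambda>_. 0) \<in> cochains A M n"
  by (simp add: cochains_def linear_iff_lin lin_const_zero)

lemma cochains_add: "f \<in> cochains A M n \<Longrightarrow> g \<in> cochains A M n \<Longrightarrow> (\<lambda>l. f l + g l) \<in> cochains A M n"
  by (auto simp: cochains_def linear_iff_lin lin_plus)

lemma cochains_diff: "f \<in> cochains A M n \<Longrightarrow> g \<in> cochains A M n \<Longrightarrow> (\<lambda>l. f l - g l) \<in> cochains A M n"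
  by (auto simp: cochains_def linear_iff_lin lin_sub)

lemma cochains_uminus: "f \<in> cochains A M n \<Longrightarrow> (\<lambda>l. - f l) \<in> cochains A M n"
  by (auto simp: cochains_def linear_iff_lin lin_uminus)

lemma cochains_comp:
  "f \<in> cochains A M n \<Longrightarrow> lin (mscale M) (mscale M') \<theta> \<Longrightarrow> vector_space (mscale M') \<Longrightarrow>
   (\<lambda>l. \<theta> (f l)) \<in> cochains A M' n"
  unfolding cochains_def linear_iff_lin mem_Collect_eq using lin_comp lin_zero by metis

lemma cochains_scale:
  "vector_space (mscale M) \<Longrightarrow> f \<in> cochains A M n \<Longrightarrow> (\<lambda>l. mscale M c (f l)) \<in> cochains A M n"
  using cochains_comp[of f A M n M "mscale M c"] lin_scaled[OF _ lin_ident] by blast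

lemma cochains_map:
  fixes \<theta> :: "'c::ab_group_add \<Rightarrow> 'a::ab_group_add"
  assumes "f \<in> cochains A M n" "lin (ascale C) (ascale A) \<theta>" "vector_space (ascale C)"
    and "mscale M' = mscale M"
  shows "(\<lambda>l. f (map \<theta> l)) \<in> cochains C M' n"
  unfolding cochains_def linear_iff_lin mem_Collect_eq
proof (intro conjI allI impI)
  fix as :: "'c list" and i assume "length as = n \<and> i < n"
  then have "length (map \<theta> as) = n \<and> i < n" by simp
  then have "vector_space (mscale M) \<and> lin (ascale A) (mscale M) (\<lambda>a. f ((map \<theta> as)[i := a]))"
    using assms(1) unfolding cochains_def linear_iff_lin mem_Collect_eq by blast
  then show "vector_space (mscale M')" "lin (ascale C) (mscale M') (\<lambda>a. f (map \<theta> (as[i := a])))"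
    using lin_comp[OF assms(2), of _ "\<lambda>a. f ((map \<theta> as)[i := a])"] by (simp_all add: map_update assms(4))
qed (use assms in \<open>simp_all add: cochains_def\<close>)

lemma cochains_cong: "ascale A = ascale A' \<Longrightarrow> mscale M = mscale M' \<Longrightarrow> cochains A M n = cochains A' M' n"
  by (simp add: cochains_def)


section \<open>The Hochschild differential by recursion on lists\<close>

text \<open>All operations on cochains below recurse on the argument list with the cochain curried in its
  first argument: the signs come from the subtracted recursive call, and no degree occurs.\<close>

fun hoch_tail :: "('k, 'a) dalg \<Rightarrow> ('k, 'a, 'm::ab_group_add) dbimod \<Rightarrow> ('a list \<Rightarrow> 'm) \<Rightarrow> 'a list \<Rightarrow> 'm" where
  "hoch_tail A M F [] = 0"
| "hoch_tail A M F [z] = - ract M (F []) z"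
| "hoch_tail A M F (x # y # zs) = - F (amult A x y # zs) - hoch_tail A M (\<lambda>l. F (x # l)) (y # zs)"

text \<open>The left action is kept out of the recursion: after currying in x the next argument must
  not act on the left, so the recursive part is the differential for the zero left action.\<close>

definition hoch :: "('k, 'a) dalg \<Rightarrow> ('k, 'a, 'm::ab_group_add) dbimod \<Rightarrow> ('a list \<Rightarrow> 'm) \<Rightarrow> 'a list \<Rightarrow> 'm" where
  "hoch A M F xs = (case xs of [] \<Rightarrow> 0 | x # ys \<Rightarrow> lact M x (F ys) + hoch_tail A M F xs)"

lemma hoch_simps [simp]:
  "hoch A M F [] = 0"
  "hoch A M F (x # xs) = lact M x (F xs) + hoch_tail A M F (x # xs)"
  by (simp_all add: hoch_def)

section \<open>Naturality of the differential in the algebra and in the coefficients\<close>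

lemma hoch_tail_cong:
  "(\<And>l. Suc (length l) = length xs \<Longrightarrow> F l = G l) \<Longrightarrow> hoch_tail A M F xs = hoch_tail A M G xs"
proof (induction A M F xs arbitrary: G rule: hoch_tail.induct)
  case (3 A M F x y zs)
  have "hoch_tail A M (\<lambda>l. F (x # l)) (y # zs) = hoch_tail A M (\<lambda>l. G (x # l)) (y # zs)"
    by (rule "3.IH") (rule "3.prems", simp)
  with "3.prems" show ?case by simp
qed auto

lemma hoch_tail_map_args:
  assumes "\<And>x y. \<theta> (amult C x y) = amult A (\<theta> x) (\<theta> y)"
    and "\<And>m x. ract M' m x = ract M m (\<theta> x)"
  shows "hoch_tail C M' (\<lambda>l. F (map \<theta> l)) xs = hoch_tail A M F (map \<theta> xs)"
proof (induction xs arbitrary: F rule: induct_list012)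
  case (3 x y zs)
  then show ?case using "3.IH"(2)[of "\<lambda>l. F (\<theta> x # l)"] by (simp add: assms)
qed (simp_all add: assms)

lemma hoch_map_args:
  assumes "\<And>x y. \<theta> (amult C x y) = amult A (\<theta> x) (\<theta> y)"
    and "\<And>m x. ract M' m x = ract M m (\<theta> x)"
    and "\<And>m x. lact M' x m = lact M (\<theta> x) m"
  shows "hoch C M' (\<lambda>l. F (map \<theta> l)) xs = hoch A M F (map \<theta> xs)"
  using hoch_tail_map_args[of \<theta> C A M' M F xs] assms by (cases xs) simp_all

lemma hoch_tail_comp:
  assumes "\<And>x y. \<theta> (x + y) = \<theta> x + \<theta> y" and "\<And>m x. \<theta> (ract M m x) = ract M' (\<theta> m) x"
  shows "\<theta> (hoch_tail A M F xs) = hoch_tail A M' (\<lambda>l. \<theta> (F l)) xs"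
proof -
  have 0: "\<theta> 0 = 0" using assms(1)[of 0 0] by simp
  have m: "\<theta> (- x) = - \<theta> x" for x
    using assms(1)[of x "- x"] 0 by (simp add: eq_neg_iff_add_eq_0 add.commute)
  have d: "\<theta> (x - y) = \<theta> x - \<theta> y" for x y
    using assms(1)[of x "- y"] m by simp
  show ?thesis
    by (induction xs arbitrary: F rule: induct_list012) (simp_all add: 0 m d assms)
qed

lemma hoch_comp:
  assumes "\<And>x y. \<theta> (x + y) = \<theta> x + \<theta> y" and "\<And>m x. \<theta> (ract M m x) = ract M' (\<theta> m) x"
    and "\<And>m x. \<theta> (lact M x m) = lact M' x (\<theta> m)"
  shows "\<theta> (hoch A M F xs) = hoch A M' (\<lambda>l. \<theta> (F l)) xs"
proof -
  have "\<theta> 0 = 0" using assms(1)[of 0 0] by simp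
  then show ?thesis using hoch_tail_comp[of \<theta> M M' A F xs] assms by (cases xs) simp_all
qed

context bimod
begin

lemma hoch_tail_zero [simp]: "hoch_tail A M (\<lambda>_. 0) xs = 0"
  by (induction xs rule: induct_list012) simp_all

lemma hoch_tail_add: "hoch_tail A M (\<lambda>l. F l + G l) xs = hoch_tail A M F xs + hoch_tail A M G xs"
  by (induction xs arbitrary: F G rule: induct_list012) simp_all

lemma hoch_tail_scale: "hoch_tail A M (\<lambda>l. mscale M c (F l)) xs = mscale M c (hoch_tail A M F xs)"
  by (induction xs arbitrary: F rule: induct_list012) simp_all

lemma hoch_tail_uminus: "hoch_tail A M (\<lambda>l. - F l) xs = - hoch_tail A M F xs"
  by (induction xs arbitrary: F rule: induct_list012) simp_all

lemma hoch_tail_diff: "hoch_tail A M (\<lambda>l. F l - G l) xs = hoch_tail A M F xs - hoch_tail A M G xs"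
  by (induction xs arbitrary: F G rule: induct_list012) simp_all

lemma hoch_tail_lact: "hoch_tail A M (\<lambda>l. lact M a (F l)) xs = lact M a (hoch_tail A M F xs)"
  by (induction xs arbitrary: F rule: induct_list012) (simp_all add: lact_ract)

lemma hoch_zero: "hoch A M (\<lambda>_. 0) = (\<lambda>_. 0)"
  by (rule ext) (simp add: hoch_def split: list.splits)

lemma hoch_add: "hoch A M (\<lambda>l. F l + G l) xs = hoch A M F xs + hoch A M G xs"
  by (cases xs) (simp_all add: hoch_tail_add)

lemma hoch_diff: "hoch A M (\<lambda>l. F l - G l) xs = hoch A M F xs - hoch A M G xs"
  by (cases xs) (simp_all add: hoch_tail_diff)

lemma hoch_uminus: "hoch A M (\<lambda>l. - F l) xs = - hoch A M F xs"
  by (cases xs) (simp_all add: hoch_tail_uminus)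

lemma hoch_scale: "hoch A M (\<lambda>l. mscale M c (F l)) xs = mscale M c (hoch A M F xs)"
  by (cases xs) (simp_all add: hoch_tail_scale)

lemma hoch_tail_cochains: "F \<in> cochains A M n \<Longrightarrow> hoch_tail A M F \<in> cochains A M (Suc n)"
proof (induction n arbitrary: F)
  case 0
  have "hoch_tail A M F (x # y # zs) = 0" for x y zs
  proof -
    have "hoch_tail A M (\<lambda>l. F (x # l)) (y # zs) = hoch_tail A M (\<lambda>_. 0) (y # zs)"
      by (rule hoch_tail_cong) (use 0 in \<open>simp add: cochains_0\<close>)
    with 0 show ?thesis by (simp add: cochains_0)
  qed
  then have *: "hoch_tail A M F (x # l) = (if l = [] then - ract M (F []) x else 0)" for x l
    by (cases l) auto
  have "lin (ascale A) (mscale M) (\<lambda>a. hoch_tail A M F (a # as))" for as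
    by (rule linI) (simp_all add: *)
  then show ?case
    by (simp add: cochains_Suc vs_A vs_M cochains_0 *)
next
  case (Suc n)
  note S = Suc.prems[unfolded cochains_Suc[OF vs_A vs_M]]
  have lin1: "lin (ascale A) (mscale M) (\<lambda>a. F (a # as))" for as using S by blast
  \<comment> \<open>In positive degree \<open>F [] = 0\<close>, so the right action clause for a
    singleton list vanishes and one formula covers all lists.\<close>
  have eq: "hoch_tail A M F (x # l) = - (case l of [] \<Rightarrow> 0 | y # zs \<Rightarrow> F (amult A x y # zs))
     - hoch_tail A M (\<lambda>l. F (x # l)) l" for x l
    using S by (cases l) auto
  have "(\<lambda>l. hoch_tail A M F (x # l)) \<in> cochains A M (Suc n)" for x
    unfolding eq
  proof (intro cochains_diff cochains_uminus Suc.IH)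
    show "(\<lambda>l. F (x # l)) \<in> cochains A M n" using S by blast
    show "(\<lambda>l. case l of [] \<Rightarrow> 0 | y # zs \<Rightarrow> F (amult A x y # zs)) \<in> cochains A M (Suc n)"
      using S lin_comp[OF lin_mult_right lin1] by (simp add: cochains_Suc vs_A vs_M)
  qed
  moreover have "lin (ascale A) (mscale M) (\<lambda>a. hoch_tail A M F (a # as))" for as
  proof -
    have 1: "lin (ascale A) (mscale M) (\<lambda>a. case as of [] \<Rightarrow> 0 | y # zs \<Rightarrow> F (amult A a y # zs))"
      using lin_comp[OF lin_mult_left lin1] by (cases as) (simp_all add: vs_M lin_const_zero)
    have 2: "lin (ascale A) (mscale M) (\<lambda>a. hoch_tail A M (\<lambda>l. F (a # l)) as)"
      by (rule linI) (simp_all add: lin_simps[OF lin1] hoch_tail_add hoch_tail_scale)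
    show ?thesis unfolding eq by (intro lin_sub lin_uminus 1 2 vs_M)
  qed
  ultimately show ?case by (simp add: cochains_Suc[of A M _ "Suc n"] vs_A vs_M)
qed

lemma hoch_cochains: "F \<in> cochains A M n \<Longrightarrow> hoch A M F \<in> cochains A M (Suc n)"
proof -
  assume F: "F \<in> cochains A M n"
  have eq: "hoch A M F l = (case l of [] \<Rightarrow> 0 | x # xs \<Rightarrow> lact M x (F xs)) + hoch_tail A M F l" for l
    by (cases l) auto
  have "(\<lambda>l. case l of [] \<Rightarrow> 0 | x # xs \<Rightarrow> lact M x (F xs)) \<in> cochains A M (Suc n)"
    using F by (simp add: cochains_Suc vs_A vs_M lin_lact_alg cochains_comp[OF F lin_lact_mod])
  then have "(\<lambda>l. (case l of [] \<Rightarrow> 0 | x # xs \<Rightarrow> lact M x (F xs)) + hoch_tail A M F l) \<in> cochains A M (Suc n)"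
    using hoch_tail_cochains[OF F] by (rule cochains_add)
  then show ?thesis by (simp add: eq[abs_def])
qed

text \<open>\<open>hoch_tail\<close> is the Hochschild differential for the same right action and
  the zero left action, so it squares to zero by itself. The induction is on the length because the
  square reappears for the curried cochain on a shorter list.\<close>

lemma hoch_tail_hoch_tail: "hoch_tail A M (hoch_tail A M F) xs = 0"
proof (induction xs arbitrary: F rule: length_induct)
  case (1 xs)
  consider "xs = []" | x where "xs = [x]" | x y where "xs = [x, y]" | x y z ws where "xs = x # y # z # ws"
    by (metis neq_Nil_conv)
  then show ?case
  proof cases
    case (4 x y z ws)
    have "hoch_tail A M (\<lambda>l. hoch_tail A M F (x # l)) (y # z # ws) =
        hoch_tail A M (\<lambda>l. - (case l of [] \<Rightarrow> 0 | y # zs \<Rightarrow> F (amult A x y # zs))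
          - hoch_tail A M (\<lambda>l. F (x # l)) l) (y # z # ws)"
      by (rule hoch_tail_cong) (auto split: list.splits)
    also have "\<dots> = - hoch_tail A M (\<lambda>l. case l of [] \<Rightarrow> 0 | y # zs \<Rightarrow> F (amult A x y # zs)) (y # z # ws)"
      using 1 4 by (simp add: hoch_tail_diff hoch_tail_uminus del: hoch_tail.simps)
    finally show ?thesis using 4 by (simp add: mult_assoc)
  qed (simp_all add: ract_mult)
qed

lemma hoch_hoch: "hoch A M (hoch A M F) xs = 0"
proof -
  consider "xs = []" | x where "xs = [x]" | x y zs where "xs = x # y # zs"
    by (metis neq_Nil_conv)
  then show ?thesis
  proof cases
    case (3 x y zs)
    have eq: "hoch A M F l = (case l of [] \<Rightarrow> 0 | x # xs \<Rightarrow> lact M x (F xs)) + hoch_tail A M F l" for l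
      by (cases l) auto
    have "hoch_tail A M (hoch A M F) xs =
       hoch_tail A M (\<lambda>l. case l of [] \<Rightarrow> 0 | x # xs \<Rightarrow> lact M x (F xs)) xs"
      unfolding eq[abs_def] by (simp add: hoch_tail_add hoch_tail_hoch_tail)
    then show ?thesis using 3
      by (simp add: lact_mult hoch_tail_lact)
  qed simp_all
qed

text \<open>Every unfolding of the recursion negates all later terms, so the term merging positions
  i - 1 and i collects the sign (-1)^i.\<close>

lemma hoch_tail_sum:
  "length xs = Suc m \<Longrightarrow> hoch_tail A M F xs =
     (\<Sum>i = 1..m. mscale M ((-1) ^ i)
        (F (take (i - 1) xs @ amult A (xs ! (i - 1)) (xs ! i) # drop (i + 1) xs)))
     + mscale M ((-1) ^ (m + 1)) (ract M (F (butlast xs)) (last xs))"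
proof (induction xs arbitrary: F m rule: induct_list012)
  case (3 x y zs)
  then obtain k where k: "m = Suc k" "length (y # zs) = Suc k" by auto
  define t where "t xs i G = mscale M ((-1) ^ i)
        (G (take (i - 1) xs @ amult A (xs ! (i - 1)) (xs ! i) # drop (i + 1) xs))" for xs i G
  have "(\<Sum>i = 1..m. t (x # y # zs) i F) = t (x # y # zs) 1 F + (\<Sum>i = 1..k. t (x # y # zs) (Suc i) F)"
    unfolding k(1) by (subst sum.atLeast_Suc_atMost) (simp_all add: sum.shift_bounds_cl_Suc_ivl del: sum.cl_ivl_Suc)
  also have "(\<Sum>i = 1..k. t (x # y # zs) (Suc i) F) = (\<Sum>i = 1..k. - t (y # zs) i (\<lambda>l. F (x # l)))"
  proof (rule sum.cong[OF refl])
    fix i assume "i \<in> {1..k}"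
    then obtain j where "i = Suc j" by (cases i) auto
    then show "t (x # y # zs) (Suc i) F = - t (y # zs) i (\<lambda>l. F (x # l))"
      unfolding t_def by simp
  qed
  finally have sum_eq: "(\<Sum>i = 1..m. t (x # y # zs) i F) =
      - F (amult A x y # zs) - (\<Sum>i = 1..k. t (y # zs) i (\<lambda>l. F (x # l)))"
    by (simp add: t_def sum_negf)
  have "hoch_tail A M F (x # y # zs) = - F (amult A x y # zs)
      - ((\<Sum>i = 1..k. t (y # zs) i (\<lambda>l. F (x # l)))
        + mscale M ((-1) ^ (k + 1)) (ract M (F (x # butlast (y # zs))) (last (y # zs))))"
    using "3.IH"(2)[OF k(2), of "\<lambda>l. F (x # l)"] unfolding t_def by simp
  also have "\<dots> = (\<Sum>i = 1..m. t (x # y # zs) i F)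
     + mscale M ((-1) ^ (m + 1)) (ract M (F (butlast (x # y # zs))) (last (x # y # zs)))"
    using sum_eq k(1) by (simp del: sum.cl_ivl_Suc One_nat_def)
  finally show ?case unfolding t_def .
qed simp_all

text \<open>\<open>hochschild\<close> is cut off outside length n + 1, while \<open>hoch\<close>
  vanishes there because F vanishes outside length n.\<close>

lemma hochschild_eq_hoch:
  assumes "F \<in> cochains A M n"
  shows "hochschild A M n F = hoch A M F"
proof
  fix xs
  show "hochschild A M n F xs = hoch A M F xs"
  proof (cases "length xs = n + 1")
    case True
    then obtain x ys where "xs = x # ys" by (cases xs) auto
    with True hoch_tail_sum[of xs n F] show ?thesis by (simp add: hochschild_def add.assoc)
  next
    case False
    then show ?thesis
      using cochains_length[OF hoch_cochains[OF assms], of xs] by (simp add: hochschild_def)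
  qed
qed

end


section \<open>The map \<open>\<Phi>\<close> by recursion on lists\<close>

text \<open>The sum over nonempty S is sorted by the first position: it is not in S, it is all of S,
  or it is in S together with others. Only the last kind costs a factor \<open>lam\<close>.\<close>

primrec perturb :: "('k \<Rightarrow> 'm::ab_group_add \<Rightarrow> 'm) \<Rightarrow> 'k \<Rightarrow> ('a \<Rightarrow> 'a) \<Rightarrow> 'a list \<Rightarrow> ('a list \<Rightarrow> 'm) \<Rightarrow> 'm" where
  "perturb s lam d [] F = 0"
| "perturb s lam d (x # xs) F = perturb s lam d xs (\<lambda>l. F (x # l)) + F (d x # xs)
     + s lam (perturb s lam d xs (\<lambda>l. F (d x # l)))"

lemma perturb_sum:
  assumes s: "vector_space s"
  shows "perturb s lam d xs F = (\<Sum>S | S \<subseteq> {..<length xs} \<and> S \<noteq> {}. s (lam ^ (card S - 1))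
     (F (map (\<lambda>i. if i \<in> S then d (xs ! i) else xs ! i) [0..<length xs])))"
proof (induction xs arbitrary: F)
  case Nil
  then show ?case by simp
next
  case (Cons x xs)
  interpret vector_space s by fact
  define n where "n = length xs"
  define t where "t ys S G = s (lam ^ (card S - 1))
     (G (map (\<lambda>i. if i \<in> S then d (ys ! i) else ys ! i) [0..<length ys]))" for ys S G
  define P where "P = {S. S \<subseteq> {..<n} \<and> S \<noteq> {}}"
  have finP: "finite P" unfolding P_def by simp
  have Pfin: "finite S" "S \<noteq> {}" if "S \<in> P" for S
    using that finite_subset[of S "{..<n}"] unfolding P_def by auto
  have split: "{S. S \<subseteq> {..<Suc n} \<and> S \<noteq> {}} = (`) Suc ` P \<union> (insert {0} ((\<lambda>S. insert 0 (Suc ` S)) ` P))"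
    (is "?L = ?R")
  proof
    have "S \<in> ?R" if "S \<subseteq> {..<Suc n}" "S \<noteq> {}" for S
    proof -
      define S' where "S' = {i. Suc i \<in> S}"
      have "S' \<subseteq> {..<n}" using that unfolding S'_def by auto
      moreover have "S = (if 0 \<in> S then insert 0 (Suc ` S') else Suc ` S')"
      proof (rule set_eqI)
        fix i show "i \<in> S \<longleftrightarrow> i \<in> (if 0 \<in> S then insert 0 (Suc ` S') else Suc ` S')"
          unfolding S'_def by (cases i) auto
      qed
      ultimately have S': "S' \<subseteq> {..<n}" "S = (if 0 \<in> S then insert 0 (Suc ` S') else Suc ` S')"
        by blast+
      show ?thesis
      proof (cases "S' = {}")
        case True
        with S' that(2) have "S = {0}" by (metis image_empty)
        then show ?thesis by blast
      next
        case False
        with S'(1) have "S' \<in> P" unfolding P_def by blast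
        with S'(2) show ?thesis by (metis UnCI image_eqI insertCI)
      qed
    qed
    then show "?L \<subseteq> ?R" by blast
    show "?R \<subseteq> ?L" unfolding P_def by auto
  qed
  have inj1: "inj_on ((`) Suc) P"
    by (rule inj_onI) (simp add: inj_image_eq_iff)
  have inj2: "inj_on (\<lambda>S. insert 0 (Suc ` S)) P"
  proof (rule inj_onI)
    fix S T assume "insert 0 (Suc ` S) = insert 0 (Suc ` T)"
    then have "Suc ` S = Suc ` T" by (auto simp: set_eq_iff image_iff)
    then show "S = T" by (simp add: inj_image_eq_iff)
  qed
  have map_eq: "map (\<lambda>i. if i \<in> S then d ((x # xs) ! i) else (x # xs) ! i) [0..<length (x # xs)]
     = (if 0 \<in> S then d x else x) # map (\<lambda>i. if Suc i \<in> S then d (xs ! i) else xs ! i) [0..<n]" for S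
  proof -
    have "[0..<length (x # xs)] = 0 # map Suc [0..<n]"
      unfolding n_def by (simp add: map_Suc_upt upt_conv_Cons del: upt_Suc)
    then show ?thesis by (simp only: list.map map_map o_def nth_Cons_0 nth_Cons_Suc)
  qed
  have t1: "t (x # xs) (Suc ` S) F = t xs S (\<lambda>l. F (x # l))" for S
    unfolding t_def map_eq by (simp add: card_image n_def image_iff)
  have t2: "t (x # xs) (insert 0 (Suc ` S)) F = s lam (t xs S (\<lambda>l. F (d x # l)))" if "S \<in> P" for S
  proof -
    \<comment> \<open>S is nonempty, so the truncated \<open>card S - 1\<close> is genuine and the
      exponent of \<open>lam\<close> rises by exactly one.\<close>
    have "card (insert 0 (Suc ` S)) - 1 = Suc (card S - 1)"
      using Pfin[OF that] by (simp add: card_insert_if card_image image_iff card_gt_0_iff)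
    then show ?thesis unfolding t_def map_eq by (simp add: n_def image_iff)
  qed
  have t0: "t (x # xs) {0} F = F (d x # xs)"
    unfolding t_def map_eq by (simp add: n_def map_nth)
  have "(\<Sum>S | S \<subseteq> {..<Suc n} \<and> S \<noteq> {}. t (x # xs) S F)
      = (\<Sum>S\<in>(`) Suc ` P. t (x # xs) S F) + (\<Sum>S\<in>insert {0} ((\<lambda>S. insert 0 (Suc ` S)) ` P). t (x # xs) S F)"
    unfolding split by (rule sum.union_disjoint) (use finP in auto)
  also have "(\<Sum>S\<in>insert {0} ((\<lambda>S. insert 0 (Suc ` S)) ` P). t (x # xs) S F)
      = t (x # xs) {0} F + (\<Sum>S\<in>(\<lambda>S. insert 0 (Suc ` S)) ` P. t (x # xs) S F)"
  proof (rule sum.insert)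
    show "{0} \<notin> (\<lambda>S. insert 0 (Suc ` S)) ` P" using Pfin by fastforce
  qed (use finP in simp)
  also have "(\<Sum>S\<in>(`) Suc ` P. t (x # xs) S F) = (\<Sum>S\<in>P. t xs S (\<lambda>l. F (x # l)))"
    by (simp add: sum.reindex[OF inj1] t1)
  also have "(\<Sum>S\<in>(\<lambda>S. insert 0 (Suc ` S)) ` P. t (x # xs) S F) = s lam (\<Sum>S\<in>P. t xs S (\<lambda>l. F (d x # l)))"
    by (simp add: sum.reindex[OF inj2] t2 scale_sum_right)
  finally show ?case
    using Cons.IH[of "\<lambda>l. F (x # l)"] Cons.IH[of "\<lambda>l. F (d x # l)"] t0
    unfolding t_def n_def[symmetric] P_def by (simp add: add.assoc n_def)
qed

lemma perturb_cong:
  "(\<And>l. length l = length xs \<Longrightarrow> F l = G l) \<Longrightarrow> perturb s lam d xs F = perturb s lam d xs G"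
proof (induction xs arbitrary: F G)
  case (Cons x xs)
  have "perturb s lam d xs (\<lambda>l. F (y # l)) = perturb s lam d xs (\<lambda>l. G (y # l))" for y
    by (rule Cons.IH) (simp add: Cons.prems)
  then show ?case by (simp add: Cons.prems)
qed simp

lemma perturb_comp:
  "lin s t \<theta> \<Longrightarrow> \<theta> (perturb s lam d xs F) = perturb t lam d xs (\<lambda>l. \<theta> (F l))"
  by (induction xs arbitrary: F) (simp_all add: lin_simps)

lemma perturb_map:
  "(\<And>x. \<theta> (d x) = d' (\<theta> x)) \<Longrightarrow> perturb s lam d xs (\<lambda>l. F (map \<theta> l)) = perturb s lam d' (map \<theta> xs) F"
proof (induction xs arbitrary: F)
  case (Cons x xs)
  then show ?case
    using Cons.IH[of "\<lambda>l. F (\<theta> x # l)"] Cons.IH[of "\<lambda>l. F (d' (\<theta> x) # l)"] by simp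
qed simp

lemma perturb_zero: "vector_space s \<Longrightarrow> perturb s lam d xs (\<lambda>_. 0) = 0"
  by (induction xs) (simp_all add: vs_simps)

lemma perturb_add:
  "vector_space s \<Longrightarrow> perturb s lam d xs (\<lambda>l. F l + G l) = perturb s lam d xs F + perturb s lam d xs G"
  by (induction xs arbitrary: F G) (simp_all add: vs_simps)

lemma perturb_uminus: "vector_space s \<Longrightarrow> perturb s lam d xs (\<lambda>l. - F l) = - perturb s lam d xs F"
  by (induction xs arbitrary: F) (simp_all add: vs_simps)

lemma perturb_diff:
  "vector_space s \<Longrightarrow> perturb s lam d xs (\<lambda>l. F l - G l) = perturb s lam d xs F - perturb s lam d xs G"
  by (induction xs arbitrary: F G) (simp_all add: vs_simps)

lemma perturb_scale: "vector_space s \<Longrightarrow> perturb s lam d xs (\<lambda>l. s c (F l)) = s c (perturb s lam d xs F)"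
  by (induction xs arbitrary: F) (simp_all add: vs_simps mult.commute)

lemmas perturb_linear = perturb_zero perturb_add perturb_uminus perturb_diff perturb_scale

text \<open>Multilinearity without a degree; it is inherited under currying, so inductions over
  argument lists can carry it where \<open>cochains\<close> would impose a length.\<close>

definition multilin :: "('k::field_char_0, 'a::ab_group_add) dalg \<Rightarrow> ('k, 'a, 'm::ab_group_add) dbimod \<Rightarrow> ('a list \<Rightarrow> 'm) \<Rightarrow> bool"
  where "multilin A M F \<longleftrightarrow> (\<forall>as bs. lin (ascale A) (mscale M) (\<lambda>a. F (as @ a # bs)))"

lemma multilin_Cons: "multilin A M F \<Longrightarrow> multilin A M (\<lambda>l. F (x # l))"
  unfolding multilin_def
proof (intro allI)
  fix as bs assume "\<forall>as bs. lin (ascale A) (mscale M) (\<lambda>a. F (as @ a # bs))"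
  then have "lin (ascale A) (mscale M) (\<lambda>a. F ((x # as) @ a # bs))" by blast
  then show "lin (ascale A) (mscale M) (\<lambda>a. F (x # as @ a # bs))" by simp
qed

lemma multilin_head: "multilin A M F \<Longrightarrow> lin (ascale A) (mscale M) (\<lambda>a. F (a # as))"
  unfolding multilin_def by (drule spec[of _ "[]"]) simp

lemma cochains_multilin:
  assumes F: "F \<in> cochains A M n" and M: "vector_space (mscale M)"
  shows "multilin A M F"
  unfolding multilin_def
proof (intro allI)
  fix as bs
  show "lin (ascale A) (mscale M) (\<lambda>a. F (as @ a # bs))"
  proof (cases "length as + Suc (length bs) = n")
    case True
    then have "Vector_Spaces.linear (ascale A) (mscale M) (\<lambda>a. F ((as @ 0 # bs)[length as := a]))"
      using F unfolding cochains_def mem_Collect_eq by (metis add_Suc_right length_Cons length_append less_add_Suc1)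
    then show ?thesis by (simp add: linear_iff_lin)
  next
    case False
    then have "F (as @ a # bs) = 0" for a using F by (simp add: cochains_def)
    then show ?thesis using M by (simp add: lin_const_zero)
  qed
qed

locale diff_bimod = bimod A M for lam :: "'k::field_char_0" and A :: "('k, 'a::ab_group_add) dalg"
    and M :: "('k, 'a, 'm::ab_group_add) dbimod" +
  assumes lin_ader: "lin (ascale A) (ascale A) (ader A)"
    and ader_mult: "ader A (amult A u v) = amult A (ader A u) v + amult A u (ader A v)
        + ascale A lam (amult A (ader A u) (ader A v))"
    and lin_mder: "lin (mscale M) (mscale M) (mder M)"
    and mder_lact: "mder M (lact M a x) = lact M (ader A a) x + lact M a (mder M x)
        + mscale M lam (lact M (ader A a) (mder M x))"
    and mder_ract: "mder M (ract M x a) = ract M x (ader A a) + ract M (mder M x) a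
        + mscale M lam (ract M (mder M x) (ader A a))"

definition Phi_rec :: "'k \<Rightarrow> ('k, 'a) dalg \<Rightarrow> ('k, 'a, 'm::ab_group_add) dbimod \<Rightarrow> ('a list \<Rightarrow> 'm) \<Rightarrow> 'a list \<Rightarrow> 'm"
  where "Phi_rec lam A M F xs = perturb (mscale M) lam (ader A) xs F - mder M (F xs)"

lemma twist_simps [simp]:
  "mscale (twist lam A M) = mscale M" "mder (twist lam A M) = mder M"
  "lact (twist lam A M) a x = lact M (a + ascale A lam (ader A a)) x"
  "ract (twist lam A M) x a = ract M x (a + ascale A lam (ader A a))"
  by (simp_all add: twist_def)

lemma twist_cochains [simp]: "cochains A (twist lam A M) = cochains A M"
  by (rule ext) (rule cochains_cong; simp)

context diff_bimod
begin

lemmas der_simps [simp] = lin_simps[OF lin_ader] lin_simps[OF lin_mder] ader_mult mder_lact mder_ract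
lemmas alg_scale_simps [simp] = vs_simps[OF vs_A]

text \<open>The map \<open>a \<mapsto> a + lam d(a)\<close> is multiplicative, so the twisted actions are again associative.\<close>

lemma twist_mult:
  "amult A a b + ascale A lam (ader A (amult A a b)) = amult A (a + ascale A lam (ader A a)) (b + ascale A lam (ader A b))"
  by (simp add: algebra_simps)

lemma lin_twist: "lin (ascale A) (ascale A) (\<lambda>a. a + ascale A lam (ader A a))"
  by (intro lin_plus lin_scaled lin_ident lin_ader vs_A)

lemma bimod_twist: "bimod A (twist lam A M)"
proof
  show "lin (ascale A) (mscale (twist lam A M)) (\<lambda>a. lact (twist lam A M) a x)" for x
    using lin_comp[OF lin_twist lin_lact_alg] by simp
  show "lin (ascale A) (mscale (twist lam A M)) (\<lambda>a. ract (twist lam A M) x a)" for x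
    using lin_comp[OF lin_twist lin_ract_alg] by simp
  show "lact (twist lam A M) (amult A a b) x = lact (twist lam A M) a (lact (twist lam A M) b x)" for a b x
    unfolding twist_simps twist_mult by (rule lact_mult)
  show "ract (twist lam A M) x (amult A a b) = ract (twist lam A M) (ract (twist lam A M) x a) b" for a b x
    unfolding twist_simps twist_mult by (rule ract_mult)
  show "ract (twist lam A M) (lact (twist lam A M) a x) b = lact (twist lam A M) a (ract (twist lam A M) x b)" for a b x
    unfolding twist_simps by (rule lact_ract)
qed (simp_all add: lin_def mult.commute)

end

sublocale diff_bimod \<subseteq> tw: bimod A "twist lam A M"
  by (rule bimod_twist)

context diff_bimod
begin

text \<open>By the Leibniz rule \<open>m \<mapsto> m + lam d(m)\<close> intertwines the right action
  of a with that of \<open>a + lam d(a)\<close>; this is naturality of \<open>hoch_tail\<close>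
  along that map.\<close>

lemma hoch_tail_twist:
  "mscale M lam (mder M (hoch_tail A M F xs)) + hoch_tail A M F xs
   = hoch_tail A (twist lam A M) (\<lambda>l. mscale M lam (mder M (F l)) + F l) xs"
  by (induction xs arbitrary: F rule: induct_list012) (simp_all add: algebra_simps)

text \<open>Perturbing a merged argument xy uses the weighted Leibniz rule, whose three terms are
  the three nonempty subsets of the two positions. For the last argument z, the perturbation of
  \<open>F z\<close> minus its derivation is \<open>Phi_rec\<close> of F times
  \<open>z + lam d(z)\<close>, which is the twisted action.\<close>

lemma perturb_hoch_tail:
  assumes "multilin A M F"
  shows "perturb (mscale M) lam (ader A) xs (hoch_tail A M F) - mder M (hoch_tail A M F xs) =
    hoch_tail A (twist lam A M) (\<lambda>l. Phi_rec lam A M F l) xs"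
  using assms
proof (induction xs arbitrary: F rule: induct_list012)
  case 1
  then show ?case by simp
next
  case (2 x)
  then show ?case by (simp add: Phi_rec_def algebra_simps)
next
  case (3 x y zs)
  let ?p = "perturb (mscale M) lam (ader A)" and ?T = "twist lam A M"
  note lin1 = lin_simps[OF multilin_head[OF "3.prems"]]
  have p1: "?p (y # zs) (\<lambda>l. hoch_tail A M F (u # l)) =
      - (?p zs (\<lambda>l. F (amult A u y # l)) + F (amult A u (ader A y) # zs)
         + mscale M lam (?p zs (\<lambda>l. F (amult A u (ader A y) # l))))
      - ?p (y # zs) (hoch_tail A M (\<lambda>l. F (u # l)))" for u
  proof -
    have "?p (y # zs) (\<lambda>l. hoch_tail A M F (u # l)) = ?p (y # zs)
      (\<lambda>l. - (case l of [] \<Rightarrow> 0 | y # zs \<Rightarrow> F (amult A u y # zs)) - hoch_tail A M (\<lambda>l. F (u # l)) l)"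
      by (rule perturb_cong) (auto split: list.splits)
    also have "\<dots> = - ?p (y # zs) (\<lambda>l. case l of [] \<Rightarrow> 0 | y # zs \<Rightarrow> F (amult A u y # zs))
        - ?p (y # zs) (hoch_tail A M (\<lambda>l. F (u # l)))"
      by (simp only: perturb_linear[OF vs_M])
    finally show ?thesis by simp
  qed
  have IH: "?p (y # zs) (hoch_tail A M (\<lambda>l. F (u # l))) = mder M (hoch_tail A M (\<lambda>l. F (u # l)) (y # zs))
     + hoch_tail A ?T (\<lambda>l. Phi_rec lam A M (\<lambda>l. F (u # l)) l) (y # zs)" for u
    using "3.IH"(2)[OF multilin_Cons[OF "3.prems"], of u] by (simp only: diff_eq_eq add.commute)
  \<comment> \<open>For the head \<open>ader A x\<close> the induction hypothesis leaves
    \<open>lam\<close> times the derivation of an untwisted differential; together with the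
    untwisted differential itself this becomes a twisted one.\<close>
  have tw: "mscale M lam (mder M (hoch_tail A M (\<lambda>l. F (ader A x # l)) (y # zs)))
      = hoch_tail A ?T (\<lambda>l. mscale M lam (mder M (F (ader A x # l))) + F (ader A x # l)) (y # zs)
      - hoch_tail A M (\<lambda>l. F (ader A x # l)) (y # zs)"
    using hoch_tail_twist[of "\<lambda>l. F (ader A x # l)" "y # zs"] by (simp only: eq_diff_eq)
  have "?p (x # y # zs) (hoch_tail A M F) - mder M (hoch_tail A M F (x # y # zs))
     = ?p (y # zs) (\<lambda>l. hoch_tail A M F (x # l)) + hoch_tail A M F (ader A x # y # zs)
      + mscale M lam (?p (y # zs) (\<lambda>l. hoch_tail A M F (ader A x # l)))
      - mder M (- F (amult A x y # zs) - hoch_tail A M (\<lambda>l. F (x # l)) (y # zs))"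
    by (simp only: perturb.simps hoch_tail.simps)
  also have "\<dots> = hoch_tail A ?T (\<lambda>l. Phi_rec lam A M F l) (x # y # zs)"
    unfolding p1 IH
    unfolding hoch_tail.simps Phi_rec_def perturb.simps
    using tw
    by (simp add: lin1 perturb_linear[OF vs_M] tw.hoch_tail_add tw.hoch_tail_diff tw.hoch_tail_scale[simplified]
        del: hoch_tail.simps)
  finally show ?case .
qed

text \<open>In the left action term \<open>d(x) F\<close> arises once from the perturbation and once
  from the Leibniz rule and cancels; what remains is \<open>x + lam d(x)\<close> acting on
  \<open>Phi_rec\<close> of F.\<close>

lemma Phi_rec_hoch:
  assumes "multilin A M F"
  shows "Phi_rec lam A M (hoch A M F) xs = hoch A (twist lam A M) (Phi_rec lam A M F) xs"
proof (cases xs)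
  case Nil
  then show ?thesis by (simp add: Phi_rec_def)
next
  case (Cons x ys)
  let ?p = "perturb (mscale M) lam (ader A)"
  have "hoch A M F = (\<lambda>l. (case l of [] \<Rightarrow> 0 | x # xs \<Rightarrow> lact M x (F xs)) + hoch_tail A M F l)"
    by (rule ext) (simp add: hoch_def split: list.splits)
  then have "?p xs (hoch A M F) = ?p xs (\<lambda>l. case l of [] \<Rightarrow> 0 | x # xs \<Rightarrow> lact M x (F xs)) + ?p xs (hoch_tail A M F)"
    by (simp only: perturb_linear[OF vs_M])
  moreover have "?p ys (\<lambda>l. lact M a (F l)) = lact M a (?p ys F)" for a
    by (rule perturb_comp[symmetric]) (rule lin_lact_mod)
  then have "?p xs (\<lambda>l. case l of [] \<Rightarrow> 0 | x # xs \<Rightarrow> lact M x (F xs)) =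
      lact M x (?p ys F) + lact M (ader A x) (F ys) + mscale M lam (lact M (ader A x) (?p ys F))"
    by (simp add: Cons)
  ultimately show ?thesis
    using perturb_hoch_tail[OF assms, of xs]
    by (simp add: Phi_rec_def[abs_def] Cons algebra_simps del: perturb.simps(2))
qed

lemma perturb_cochains: "F \<in> cochains A M n \<Longrightarrow> (\<lambda>xs. perturb (mscale M) lam (ader A) xs F) \<in> cochains A M n"
proof (induction n arbitrary: F)
  case 0
  have "perturb (mscale M) lam (ader A) (x # xs) F = 0" for x xs
    using 0 by (simp add: cochains_0 perturb_zero vs_M)
  then show ?case by (simp add: cochains_0 neq_Nil_conv del: perturb.simps) blast
next
  case (Suc n)
  note S = Suc.prems[unfolded cochains_Suc[OF vs_A vs_M]]
  have lin1: "lin (ascale A) (mscale M) (\<lambda>a. F (a # as))" for as using S by blast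
  have c1: "(\<lambda>l. F (x # l)) \<in> cochains A M n" for x using S by blast
  have lp: "lin (ascale A) (mscale M) (\<lambda>a. perturb (mscale M) lam (ader A) as (\<lambda>l. F (a # l)))" for as
    by (rule linI) (simp_all add: lin_simps[OF lin1] perturb_linear[OF vs_M])
  have "(\<lambda>l. perturb (mscale M) lam (ader A) (x # l) F) \<in> cochains A M n" for x
    by (simp) (intro cochains_add cochains_scale Suc.IH c1 vs_M)
  moreover have "lin (ascale A) (mscale M) (\<lambda>a. perturb (mscale M) lam (ader A) (a # as) F)" for as
    by simp (intro lin_plus lin_scaled lp lin1 vs_M lin_comp[OF lin_ader lp] lin_comp[OF lin_ader lin1])
  ultimately show ?case by (simp add: cochains_Suc vs_A vs_M)
qed

lemma Phi_rec_cochains: "F \<in> cochains A M n \<Longrightarrow> Phi_rec lam A M F \<in> cochains A M n"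
  unfolding Phi_rec_def[abs_def]
  by (intro cochains_diff perturb_cochains cochains_comp[OF _ lin_mder] vs_M)

lemma Phi_eq_Phi_rec: "F \<in> cochains A M n \<Longrightarrow> Phi lam A M n F = Phi_rec lam A M F"
proof
  fix xs assume F: "F \<in> cochains A M n"
  show "Phi lam A M n F xs = Phi_rec lam A M F xs"
  proof (cases "length xs = n")
    case True
    then show ?thesis by (simp add: Phi_def Phi_rec_def perturb_sum[OF vs_M])
  next
    case False
    then show ?thesis using cochains_length[OF Phi_rec_cochains[OF F]] by (simp add: Phi_def)
  qed
qed

end


section \<open>Homotopies that insert an element\<close>

text \<open>Restriction along two homomorphisms, one for each side. They differ because insertion
  moves the arguments before and after the inserted element differently; the off-diagonal
  coefficients of \<open>\<psi>!\<close> are of this form too.\<close>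

definition bipull :: "('c \<Rightarrow> 'a) \<Rightarrow> ('c \<Rightarrow> 'a) \<Rightarrow> ('k, 'a, 'm) dbimod \<Rightarrow> ('k, 'c, 'm) dbimod" where
  "bipull \<alpha> \<beta> M = \<lparr>mscale = mscale M, lact = (\<lambda>c x. lact M (\<alpha> c) x), ract = (\<lambda>x c. ract M x (\<beta> c)),
     mder = mder M\<rparr>"

lemma bipull_simps [simp]:
  "mscale (bipull \<alpha> \<beta> M) = mscale M" "mder (bipull \<alpha> \<beta> M) = mder M"
  "lact (bipull \<alpha> \<beta> M) c x = lact M (\<alpha> c) x" "ract (bipull \<alpha> \<beta> M) x c = ract M x (\<beta> c)"
  by (simp_all add: bipull_def)

lemma pullback_bipull: "pullback \<phi> M = bipull \<phi> \<phi> M"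
  by (simp add: pullback_def bipull_def)

lemma bipull_bipull: "bipull \<alpha> \<beta> (bipull \<gamma> \<delta> M) = bipull (\<lambda>x. \<gamma> (\<alpha> x)) (\<lambda>x. \<delta> (\<beta> x)) M"
  by (simp add: bipull_def)

lemma bipull_id [simp]: "bipull (\<lambda>x. x) (\<lambda>x. x) M = M"
  by (simp add: bipull_def)

lemma (in bimod) bimod_bipull:
  assumes "assoc_alg C" "lin (ascale C) (ascale A) \<alpha>" "lin (ascale C) (ascale A) \<beta>"
    and "\<And>x y. \<alpha> (amult C x y) = amult A (\<alpha> x) (\<alpha> y)" "\<And>x y. \<beta> (amult C x y) = amult A (\<beta> x) (\<beta> y)"
  shows "bimod C (bipull \<alpha> \<beta> M)"
proof -
  interpret C: assoc_alg C by fact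
  show ?thesis
    by unfold_locales
      (use assms in \<open>simp_all add: lin_def lact_mult ract_mult lact_ract mult.commute vs_A\<close>)
qed

text \<open>Sums over the position of the inserted element \<open>v\<close>, with alternating signs; the arguments
  before it are moved by \<open>\<alpha>\<close> and those after it by \<open>\<beta>\<close>.\<close>

primrec ins :: "'a \<Rightarrow> ('c \<Rightarrow> 'a) \<Rightarrow> ('c \<Rightarrow> 'a) \<Rightarrow> 'c list \<Rightarrow> ('a list \<Rightarrow> 'm::ab_group_add) \<Rightarrow> 'm" where
  "ins v \<alpha> \<beta> [] F = F [v]"
| "ins v \<alpha> \<beta> (x # xs) F = F (v # map \<beta> (x # xs)) - ins v \<alpha> \<beta> xs (\<lambda>l. F (\<alpha> x # l))"

lemma ins_cong:
  "(\<And>l. length l = Suc (length xs) \<Longrightarrow> F l = G l) \<Longrightarrow> ins v \<alpha> \<beta> xs F = ins v \<alpha> \<beta> xs G"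
proof (induction xs arbitrary: F G)
  case (Cons x xs)
  have "ins v \<alpha> \<beta> xs (\<lambda>l. F (y # l)) = ins v \<alpha> \<beta> xs (\<lambda>l. G (y # l))" for y
    by (rule Cons.IH) (simp add: Cons.prems)
  then show ?case by (simp add: Cons.prems)
qed simp

lemma ins_add: "ins v \<alpha> \<beta> xs (\<lambda>l. F l + G l) = ins v \<alpha> \<beta> xs F + ins v \<alpha> \<beta> xs G"
  by (induction xs arbitrary: F G) simp_all

lemma ins_zero: "ins v \<alpha> \<beta> xs (\<lambda>_. 0) = 0"
  by (induction xs) simp_all

lemma ins_uminus: "ins v \<alpha> \<beta> xs (\<lambda>l. - F l) = - ins v \<alpha> \<beta> xs F"
  by (induction xs arbitrary: F) simp_all

lemma ins_diff: "ins v \<alpha> \<beta> xs (\<lambda>l. F l - G l) = ins v \<alpha> \<beta> xs F - ins v \<alpha> \<beta> xs G"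
  by (induction xs arbitrary: F G) simp_all

lemma ins_comp: "lin s t \<theta> \<Longrightarrow> \<theta> (ins v \<alpha> \<beta> xs F) = ins v \<alpha> \<beta> xs (\<lambda>l. \<theta> (F l))"
  by (induction xs arbitrary: F) (simp_all add: lin_simps)

lemma ins_cochains:
  assumes "vector_space (ascale A)" "vector_space (ascale C)" "vector_space (mscale M)"
    and \<alpha>: "lin (ascale C) (ascale A) \<alpha>" and \<beta>: "lin (ascale C) (ascale A) \<beta>"
    and M': "mscale M' = mscale M"
  shows "F \<in> cochains A M (Suc n) \<Longrightarrow> (\<lambda>xs. ins v \<alpha> \<beta> xs F) \<in> cochains C M' n"
proof (induction n arbitrary: F)
  case 0
  have "ins v \<alpha> \<beta> (x # xs) F = ins v \<alpha> \<beta> (x # xs) (\<lambda>_. 0)" for x xs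
    by (rule ins_cong) (simp add: cochains_length[OF 0])
  then show ?case by (simp only: cochains_0 neq_Nil_conv ins_zero) blast
next
  case (Suc n)
  note S = Suc.prems[unfolded cochains_Suc[OF assms(1,3), of _ "Suc n"]]
  have lin1: "lin (ascale A) (mscale M) (\<lambda>a. F (a # as))" for as using S by blast
  have c1: "(\<lambda>l. F (x # l)) \<in> cochains A M (Suc n)" for x using S by blast
  have c2: "(\<lambda>l. F (v # y # l)) \<in> cochains A M n" for y
    using c1[of v] by (simp add: cochains_Suc[OF assms(1,3)])
  have lin2: "lin (ascale A) (mscale M) (\<lambda>a. F (v # a # as))" for as
    using c1[of v] by (simp add: cochains_Suc[OF assms(1,3)])
  have lp: "lin (ascale A) (mscale M) (\<lambda>a. ins v \<alpha> \<beta> as (\<lambda>l. F (a # l)))" for as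
  proof (rule linI)
    show "ins v \<alpha> \<beta> as (\<lambda>l. F (ascale A c x # l)) = mscale M c (ins v \<alpha> \<beta> as (\<lambda>l. F (x # l)))" for c x
      using ins_comp[OF lin_scaled[OF assms(3) lin_ident], symmetric] by (simp add: lin_simps[OF lin1])
  qed (simp add: lin_simps[OF lin1] ins_add)
  have "ins v \<alpha> \<beta> [] F = 0" by (simp add: cochains_length[OF Suc.prems])
  moreover have "(\<lambda>l. ins v \<alpha> \<beta> (x # l) F) \<in> cochains C M' n" for x
    using cochains_diff[OF cochains_map[OF c2 \<beta> assms(2) M'] Suc.IH[OF c1]] by simp
  moreover have "lin (ascale C) (mscale M) (\<lambda>a. ins v \<alpha> \<beta> (a # as) F)" for as
    using lin_sub[OF assms(3) lin_comp[OF \<beta> lin2] lin_comp[OF \<alpha> lp]] by simp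
  ultimately show ?case using assms(3) by (simp add: cochains_Suc[OF assms(2)] M')
qed

lemma ins_cochains_0:
  assumes "F \<in> cochains A M 0" shows "ins v \<alpha> \<beta> xs F = 0"
proof -
  have "ins v \<alpha> \<beta> xs F = ins v \<alpha> \<beta> xs (\<lambda>_. 0)"
    by (rule ins_cong) (simp add: cochains_length[OF assms])
  then show ?thesis by (simp only: ins_zero)
qed

context bimod
begin

text \<open>Products of v with a neighbour cancel in pairs by
  \<open>\<alpha>(c) v = v \<beta>(c)\<close>, the other products cancel against the differential of
  the insertion. A last argument standing after v acts through \<beta>, as in \<open>bipull\<close>;
  only v in last place leaves a term.\<close>

lemma ins_hoch_tail:
  assumes "\<And>c. amult A (\<alpha> c) v = amult A v (\<beta> c)"
    and "\<And>c d. \<alpha> (amult C c d) = amult A (\<alpha> c) (\<alpha> d)" "\<And>c d. \<beta> (amult C c d) = amult A (\<beta> c) (\<beta> d)"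
  shows "ins v \<alpha> \<beta> xs (hoch_tail A M F) + hoch_tail C (bipull \<alpha> \<beta> M) (\<lambda>l. ins v \<alpha> \<beta> l F) xs
    = - ract M (F (map \<alpha> xs)) v"
proof (induction xs arbitrary: F rule: induct_list012)
  case (3 x y zs)
  let ?N = "bipull \<alpha> \<beta> M"
  have 1: "ins v \<alpha> \<beta> (y # zs) (\<lambda>l. hoch_tail A M F (u # l)) =
      - ins v \<alpha> \<beta> (y # zs) (\<lambda>l. case l of [] \<Rightarrow> 0 | y # zs \<Rightarrow> F (amult A u y # zs))
      - ins v \<alpha> \<beta> (y # zs) (hoch_tail A M (\<lambda>l. F (u # l)))" for u
  proof -
    have "ins v \<alpha> \<beta> (y # zs) (\<lambda>l. hoch_tail A M F (u # l)) = ins v \<alpha> \<beta> (y # zs)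
      (\<lambda>l. - (case l of [] \<Rightarrow> 0 | y # zs \<Rightarrow> F (amult A u y # zs)) - hoch_tail A M (\<lambda>l. F (u # l)) l)"
      by (rule ins_cong) (auto simp: length_Suc_conv)
    then show ?thesis by (simp only: ins_diff ins_uminus)
  qed
  have 2: "hoch_tail C ?N (\<lambda>l. ins v \<alpha> \<beta> (u # l) F) (y # zs) =
      hoch_tail A M (\<lambda>l. F (v # \<beta> u # l)) (map \<beta> (y # zs)) - hoch_tail C ?N (\<lambda>l. ins v \<alpha> \<beta> l (\<lambda>l. F (\<alpha> u # l))) (y # zs)" for u
  proof -
    have "hoch_tail C ?N (\<lambda>l. ins v \<alpha> \<beta> (u # l) F) (y # zs)
       = hoch_tail C ?N (\<lambda>l. F (v # \<beta> u # map \<beta> l) + - ins v \<alpha> \<beta> l (\<lambda>l. F (\<alpha> u # l))) (y # zs)"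
      by simp
    also have "\<dots> = hoch_tail C ?N (\<lambda>l. F (v # \<beta> u # map \<beta> l)) (y # zs)
        - hoch_tail C ?N (\<lambda>l. ins v \<alpha> \<beta> l (\<lambda>l. F (\<alpha> u # l))) (y # zs)"
    proof -
      have "hoch_tail C ?N (\<lambda>l. G l + - H l) xs = hoch_tail C ?N G xs - hoch_tail C ?N H xs" for G H xs
        by (induction xs arbitrary: G H rule: induct_list012) simp_all
      then show ?thesis .
    qed
    finally show ?thesis
      using hoch_tail_map_args[of \<beta> C A ?N M "\<lambda>l. F (v # \<beta> u # l)" "y # zs"] assms(3) by simp
  qed
  have "ins v \<alpha> \<beta> (x # y # zs) (hoch_tail A M F) + hoch_tail C ?N (\<lambda>l. ins v \<alpha> \<beta> l F) (x # y # zs)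
     = hoch_tail A M F (v # map \<beta> (x # y # zs)) - ins v \<alpha> \<beta> (y # zs) (\<lambda>l. hoch_tail A M F (\<alpha> x # l))
       + (- ins v \<alpha> \<beta> (amult C x y # zs) F - hoch_tail C ?N (\<lambda>l. ins v \<alpha> \<beta> (x # l) F) (y # zs))"
    by (simp only: hoch_tail.simps(3) ins.simps(2)[of _ _ _ x "y # zs"])
  also have "\<dots> = - ract M (F (map \<alpha> (x # y # zs))) v"
    unfolding 1 2 using "3.IH"(2)[of "\<lambda>l. F (\<alpha> x # l)"] by (simp add: assms algebra_simps)
  finally show ?case .
qed (simp_all add: assms ract_mult[symmetric])

text \<open>The insertion operator is a homotopy because \<open>v\<close> is a natural transformation between \<open>\<alpha>\<close>
  and \<open>\<beta>\<close>, seen as functors between one-object categories.\<close>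

lemma ins_hoch:
  assumes "\<And>c. amult A (\<alpha> c) v = amult A v (\<beta> c)"
    and "\<And>c d. \<alpha> (amult C c d) = amult A (\<alpha> c) (\<alpha> d)" "\<And>c d. \<beta> (amult C c d) = amult A (\<beta> c) (\<beta> d)"
  shows "ins v \<alpha> \<beta> xs (hoch A M F) + hoch C (bipull \<alpha> \<beta> M) (\<lambda>l. ins v \<alpha> \<beta> l F) xs
    = lact M v (F (map \<beta> xs)) - ract M (F (map \<alpha> xs)) v"
proof (cases xs)
  case Nil
  then show ?thesis by simp
next
  case (Cons x ys)
  let ?L = "\<lambda>l. case l of [] \<Rightarrow> 0 | x # xs \<Rightarrow> lact M x (F xs)"
  have "hoch A M F = (\<lambda>l. ?L l + hoch_tail A M F l)"
    by (rule ext) (simp add: hoch_def split: list.splits)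
  then have "ins v \<alpha> \<beta> xs (hoch A M F) = ins v \<alpha> \<beta> xs ?L + ins v \<alpha> \<beta> xs (hoch_tail A M F)"
    by (simp only: ins_add)
  moreover have "ins v \<alpha> \<beta> xs ?L = lact M v (F (map \<beta> xs)) - lact M (\<alpha> x) (ins v \<alpha> \<beta> ys F)"
    using ins_comp[OF lin_lact_mod, symmetric] by (simp add: Cons)
  ultimately show ?thesis
    using ins_hoch_tail[of \<alpha> v \<beta> C xs F, OF assms] by (simp add: Cons del: ins.simps)
qed

text \<open>On the part of the coefficients where the unit acts by zero from the left, putting the unit
  in front of the arguments is a contracting homotopy.\<close>

lemma cocycle_left_unit:
  assumes F: "F \<in> cochains A M (Suc n)" and d: "hoch A M F = (\<lambda>_. 0)"
  shows "\<exists>G\<in>cochains A M n. \<forall>xs. F xs - lact M (aone A) (F xs) = hoch A M G xs"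
proof -
  define F' where "F' xs = F xs - lact M (aone A) (F xs)" for xs
  have F': "F' \<in> cochains A M (Suc n)"
    unfolding F'_def[abs_def] by (intro cochains_diff F cochains_comp[OF F lin_lact_mod] vs_M)
  have act0: "lact M a (F' xs) = 0" for a xs
    by (simp add: F'_def lact_mult[symmetric])
  have "hoch A M (\<lambda>l. lact M (aone A) (F l)) xs = lact M (aone A) (hoch A M F xs)" for xs
    by (rule hoch_comp[symmetric]) (simp_all add: lact_ract lact_mult[symmetric])
  then have d': "hoch A M F' xs = 0" for xs
    unfolding F'_def[abs_def] by (simp add: hoch_diff d)
  define G where "G xs = - F' (aone A # xs)" for xs
  have "G \<in> cochains A M n"
    unfolding G_def[abs_def] using F' by (intro cochains_uminus) (simp add: cochains_Suc vs_A vs_M)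
  moreover have "F' xs = hoch A M G xs" for xs
  proof (cases xs)
    case Nil
    then show ?thesis using F' by (simp add: cochains_length)
  next
    case (Cons x ys)
    have "hoch_tail A M (\<lambda>l. F' (aone A # l)) xs = - F' xs"
      using d'[of "aone A # xs"] by (simp add: act0 Cons)
    then show ?thesis
      unfolding G_def[abs_def] by (simp add: hoch_tail_uminus Cons act0)
  qed
  ultimately show ?thesis unfolding F'_def by blast
qed

text \<open>\<open>F - 1 F 1\<close> splits as
  \<open>(F - 1 F) + (1 F - F 1) + (F 1 - 1 F 1)\<close>. The outer two are covered by
  \<open>cocycle_left_unit\<close>, the middle one by inserting the unit with both maps the
  identity.\<close>

lemma cocycle_unital:
  assumes F: "F \<in> cochains A M (Suc n)" and d: "hoch A M F = (\<lambda>_. 0)"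
  shows "\<exists>G\<in>cochains A M n. \<forall>xs. F xs - lact M (aone A) (ract M (F xs) (aone A)) = hoch A M G xs"
proof -
  let ?u = "aone A"
  obtain G1 where G1: "G1 \<in> cochains A M n" "\<And>xs. F xs - lact M ?u (F xs) = hoch A M G1 xs"
    using cocycle_left_unit[OF F d] by blast
  define G2 where "G2 xs = ins ?u (\<lambda>x. x) (\<lambda>x. x) xs F" for xs
  have G2: "G2 \<in> cochains A M n"
    unfolding G2_def[abs_def] by (rule ins_cochains[OF vs_A vs_A vs_M lin_ident lin_ident refl F])
  have dG2: "lact M ?u (F xs) - ract M (F xs) ?u = hoch A M G2 xs" for xs
    using ins_hoch[of "\<lambda>x. x" ?u "\<lambda>x. x" A xs F] by (simp add: d ins_zero G2_def[abs_def])
  let ?F = "\<lambda>l. ract M (F l) ?u"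
  have "hoch A M ?F xs = ract M (hoch A M F xs) ?u" for xs
    by (rule hoch_comp[symmetric]) (simp_all add: lact_ract ract_mult[symmetric])
  then have "hoch A M ?F = (\<lambda>_. 0)" by (simp add: d fun_eq_iff)
  then obtain G3 where G3: "G3 \<in> cochains A M n" "\<And>xs. ?F xs - lact M ?u (?F xs) = hoch A M G3 xs"
    using cocycle_left_unit[OF cochains_comp[OF F lin_ract_mod vs_M]] by blast
  have "F xs - lact M ?u (?F xs) = hoch A M (\<lambda>l. G1 l + G2 l + G3 l) xs" for xs
    unfolding hoch_add G1(2)[symmetric] dG2[symmetric] G3(2)[symmetric] by simp
  moreover have "(\<lambda>l. G1 l + G2 l + G3 l) \<in> cochains A M n" by (intro cochains_add G1 G2 G3)
  ultimately show ?thesis by blast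
qed

end


section \<open>Cochains of the mapping ring\<close>

abbreviation mid :: "'x \<times> 'y \<times> 'z \<Rightarrow> 'y" where "mid x \<equiv> fst (snd x)"
abbreviation thd :: "'x \<times> 'y \<times> 'z \<Rightarrow> 'z" where "thd x \<equiv> snd (snd x)"

text \<open>A \<open>B\<close>-cochain is spread over the arguments \<open>a + b\<^sub>1 + b\<^sub>2\<phi>\<close> by choosing the position at which
  \<open>b\<^sub>2\<close> is used; before it stand the \<open>b\<^sub>1\<close> and after it the \<open>\<phi>(a)\<close>.\<close>

primrec spread :: "('a \<Rightarrow> 'b) \<Rightarrow> ('a \<times> 'b \<times> 'b) list \<Rightarrow> ('b list \<Rightarrow> 'n::ab_group_add) \<Rightarrow> 'n" where
  "spread \<phi> [] g = 0"
| "spread \<phi> (x # xs) g = g (thd x # map (\<lambda>x. \<phi> (fst x)) xs) + spread \<phi> xs (\<lambda>l. g (mid x # l))"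

text \<open>The cup product of h with the 1-cochain \<open>x \<mapsto> b\<^sub>2\<close> on its
  left.\<close>

definition cup :: "('k, 'b, 'n::zero) dbimod \<Rightarrow> (('a \<times> 'b \<times> 'b) list \<Rightarrow> 'n) \<Rightarrow> ('a \<times> 'b \<times> 'b) list \<Rightarrow> 'n" where
  "cup N h xs = (case xs of [] \<Rightarrow> 0 | x # ys \<Rightarrow> lact N (thd x) (h ys))"

text \<open>The cup product with \<open>x \<mapsto> b\<^sub>2\<close> on the right, with the sign of
  the last Hochschild term; it records the summand \<open>n\<^sub>1 b\<^sub>2\<close> of the right
  action on \<open>\<psi>!\<close>.\<close>

fun rcup :: "('k, 'b, 'n::ab_group_add) dbimod \<Rightarrow> ('a \<times> 'b \<times> 'b) list \<Rightarrow> (('a \<times> 'b \<times> 'b) list \<Rightarrow> 'n) \<Rightarrow> 'n" where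
  "rcup N [] F = 0"
| "rcup N [z] F = - ract N (F []) (thd z)"
| "rcup N (x # y # zs) F = - rcup N (y # zs) (\<lambda>l. F (x # l))"

definition tau :: "('a \<Rightarrow> 'b) \<Rightarrow> ('k, 'b, 'n::ab_group_add) dbimod \<Rightarrow> ('a, 'b, 'm, 'n) phi_cochain \<Rightarrow>
    ('a \<times> 'b \<times> 'b) list \<Rightarrow> 'm \<times> 'n \<times> 'n" where
  "tau \<phi> N = (\<lambda>(f, g, h) xs. (f (map fst xs), g (map mid xs), spread \<phi> xs g + cup N (\<lambda>l. h (map fst l)) xs))"

lemma cup_simps [simp]: "cup N h [] = 0" "cup N h (x # xs) = lact N (thd x) (h xs)"
  by (simp_all add: cup_def)

lemma tau_simps [simp]:
  "fst (tau \<phi> N x xs) = fst x (map fst xs)"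
  "mid (tau \<phi> N x xs) = mid x (map mid xs)"
  "thd (tau \<phi> N x xs) = spread \<phi> xs (mid x) + cup N (\<lambda>l. thd x (map fst l)) xs"
  by (simp_all add: tau_def split_def)

lemma mapping_ring_simps [simp]:
  "fst (amult (mapping_ring A B \<phi>) x y) = amult A (fst x) (fst y)"
  "mid (amult (mapping_ring A B \<phi>) x y) = amult B (mid x) (mid y)"
  "thd (amult (mapping_ring A B \<phi>) x y) = amult B (thd x) (\<phi> (fst y)) + amult B (mid x) (thd y)"
  "fst (ader (mapping_ring A B \<phi>) x) = ader A (fst x)"
  "mid (ader (mapping_ring A B \<phi>) x) = ader B (mid x)"
  "thd (ader (mapping_ring A B \<phi>) x) = ader B (thd x)"
  "fst (ascale (mapping_ring A B \<phi>) c x) = ascale A c (fst x)"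
  "mid (ascale (mapping_ring A B \<phi>) c x) = ascale B c (mid x)"
  "thd (ascale (mapping_ring A B \<phi>) c x) = ascale B c (thd x)"
  "aone (mapping_ring A B \<phi>) = (aone A, aone B, 0)"
  by (simp_all add: mapping_ring_def prod_scale_def split_def)

lemma mapping_bimodule_simps [simp]:
  "fst (lact (mapping_bimodule \<phi> M N \<psi>) x w) = lact M (fst x) (fst w)"
  "mid (lact (mapping_bimodule \<phi> M N \<psi>) x w) = lact N (mid x) (mid w)"
  "thd (lact (mapping_bimodule \<phi> M N \<psi>) x w) = lact N (thd x) (\<psi> (fst w)) + lact N (mid x) (thd w)"
  "fst (ract (mapping_bimodule \<phi> M N \<psi>) w x) = ract M (fst w) (fst x)"
  "mid (ract (mapping_bimodule \<phi> M N \<psi>) w x) = ract N (mid w) (mid x)"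
  "thd (ract (mapping_bimodule \<phi> M N \<psi>) w x) = ract N (thd w) (\<phi> (fst x)) + ract N (mid w) (thd x)"
  "fst (mder (mapping_bimodule \<phi> M N \<psi>) w) = mder M (fst w)"
  "mid (mder (mapping_bimodule \<phi> M N \<psi>) w) = mder N (mid w)"
  "thd (mder (mapping_bimodule \<phi> M N \<psi>) w) = mder N (thd w)"
  "fst (mscale (mapping_bimodule \<phi> M N \<psi>) c w) = mscale M c (fst w)"
  "mid (mscale (mapping_bimodule \<phi> M N \<psi>) c w) = mscale N c (mid w)"
  "thd (mscale (mapping_bimodule \<phi> M N \<psi>) c w) = mscale N c (thd w)"
  by (simp_all add: mapping_bimodule_def prod_scale_def split_def)

lemma mapping_scales:
  "ascale (mapping_ring A B \<phi>) = prod_scale (ascale A) (prod_scale (ascale B) (ascale B))"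
  "mscale (mapping_bimodule \<phi> M N \<psi>) = prod_scale (mscale M) (prod_scale (mscale N) (mscale N))"
  by (simp_all add: mapping_ring_def mapping_bimodule_def)

locale phi_bimod = M: bimod A M + N: bimod B N
  for A :: "('k::field_char_0, 'a::ab_group_add) dalg" and M :: "('k, 'a, 'm::ab_group_add) dbimod"
    and B :: "('k, 'b::ab_group_add) dalg" and N :: "('k, 'b, 'n::ab_group_add) dbimod" +
  fixes \<phi> :: "'a \<Rightarrow> 'b" and \<psi> :: "'m \<Rightarrow> 'n"
  assumes lin_phi: "lin (ascale A) (ascale B) \<phi>"
    and phi_mult [simp]: "\<phi> (amult A x y) = amult B (\<phi> x) (\<phi> y)"
    and phi_one [simp]: "\<phi> (aone A) = aone B"
    and lin_psi: "lin (mscale M) (mscale N) \<psi>"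
    and psi_lact [simp]: "\<psi> (lact M a m) = lact N (\<phi> a) (\<psi> m)"
    and psi_ract [simp]: "\<psi> (ract M m a) = ract N (\<psi> m) (\<phi> a)"
begin

lemmas hom_simps [simp] = lin_simps[OF lin_phi] lin_simps[OF lin_psi]

abbreviation R where "R \<equiv> mapping_ring A B \<phi>"
abbreviation W where "W \<equiv> mapping_bimodule \<phi> M N \<psi>"

lemma vs_R: "vector_space (ascale R)" and vs_W: "vector_space (mscale W)"
  unfolding mapping_scales by (intro vector_space_prod_scale M.vs_A N.vs_A M.vs_M N.vs_M)+

end

sublocale phi_bimod \<subseteq> R: assoc_alg R
  by (unfold_locales)
    (simp_all add: lin_def prod_eq_iff M.mult_assoc N.mult_assoc vs_simps[OF vs_R] vs_simps[OF M.vs_A] vs_simps[OF N.vs_A])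

sublocale phi_bimod \<subseteq> W: bimod R W
  by (unfold_locales)
    (simp_all add: lin_def prod_eq_iff M.lact_mult N.lact_mult M.ract_mult N.ract_mult M.lact_ract N.lact_ract
      vs_simps[OF vs_W])

context phi_bimod
begin

lemma bimod_Na: "bimod A (bipull \<phi> \<phi> N)"
  by (rule N.bimod_bipull) (simp_all add: M.assoc_alg_axioms lin_phi)

lemma lin_R:
  "lin (ascale R) (ascale A) fst" "lin (ascale R) (ascale B) (\<lambda>x. mid x)" "lin (ascale R) (ascale B) (\<lambda>x. thd x)"
  "lin (ascale R) (ascale B) (\<lambda>x. \<phi> (fst x))"
  "lin (ascale A) (ascale R) (\<lambda>a. (a, 0, 0))" "lin (ascale B) (ascale R) (\<lambda>b. (0, b, 0))"
  "lin (ascale A) (ascale R) (\<lambda>a. (0, \<phi> a, 0))" "lin (ascale R) (ascale R) (\<lambda>x. (fst x, 0, 0))"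
  "lin (ascale R) (ascale R) (\<lambda>x. (0, mid x, 0))" "lin (ascale R) (ascale R) (\<lambda>x. (0, thd x, 0))"
  "lin (ascale R) (ascale R) (\<lambda>x. (0, \<phi> (fst x), 0))"
  by (simp_all add: lin_def prod_eq_iff vs_simps[OF M.vs_A] vs_simps[OF N.vs_A])

lemma lin_W:
  "lin (mscale W) (mscale M) fst" "lin (mscale W) (mscale N) (\<lambda>x. mid x)" "lin (mscale W) (mscale N) (\<lambda>x. thd x)"
  "lin (mscale N) (mscale W) (\<lambda>n. (0, 0, n))"
  by (simp_all add: lin_def prod_eq_iff)

end

sublocale phi_bimod \<subseteq> MR: bimod R "bipull fst fst M"
  by (rule M.bimod_bipull) (simp_all add: R.assoc_alg_axioms lin_R)

sublocale phi_bimod \<subseteq> NR: bimod R "bipull (\<lambda>x. mid x) (\<lambda>x. mid x) N"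
  by (rule N.bimod_bipull) (simp_all add: R.assoc_alg_axioms lin_R)

sublocale phi_bimod \<subseteq> NRA: bimod R "bipull (\<lambda>x. mid x) (\<lambda>x. \<phi> (fst x)) N"
  by (rule N.bimod_bipull) (simp_all add: R.assoc_alg_axioms lin_R)

sublocale phi_bimod \<subseteq> NAR: bimod R "bipull (\<lambda>x. \<phi> (fst x)) (\<lambda>x. \<phi> (fst x)) N"
  by (rule N.bimod_bipull) (simp_all add: R.assoc_alg_axioms lin_R)

sublocale phi_bimod \<subseteq> NA: bimod A "bipull \<phi> \<phi> N"
  by (rule bimod_Na)

context phi_bimod
begin

text \<open>Coefficients for the third component: \<open>b\<^sub>1\<close> acts on the left and
  \<open>\<phi>(a)\<close> on the right, as on the corner of a triangular matrix.\<close>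

abbreviation NRA where "NRA \<equiv> bipull (\<lambda>x::'a \<times> 'b \<times> 'b. mid x) (\<lambda>x. \<phi> (fst x)) N"

lemma spread_add: "spread \<phi> xs (\<lambda>l. F l + G l) = spread \<phi> xs F + spread \<phi> xs G"
  and spread_zero: "spread \<phi> xs (\<lambda>_. 0 :: 'n) = 0"
  and spread_uminus: "spread \<phi> xs (\<lambda>l. - F l) = - spread \<phi> xs F"
  and spread_diff: "spread \<phi> xs (\<lambda>l. F l - G l) = spread \<phi> xs F - spread \<phi> xs G"
  by (induction xs arbitrary: F G) simp_all

lemma spread_comp: "lin s t \<theta> \<Longrightarrow> \<theta> (spread \<phi> xs F) = spread \<phi> xs (\<lambda>l. \<theta> (F l))"
  by (induction xs arbitrary: F) (simp_all add: lin_simps)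

lemma spread_cong:
  "(\<And>l. length l = length xs \<Longrightarrow> F l = G l) \<Longrightarrow> spread \<phi> xs F = spread \<phi> xs G"
proof (induction xs arbitrary: F G)
  case (Cons x xs)
  have "spread \<phi> xs (\<lambda>l. F (y # l)) = spread \<phi> xs (\<lambda>l. G (y # l))" for y
    by (rule Cons.IH) (simp add: Cons.prems)
  then show ?case by (simp add: Cons.prems)
qed simp

lemma spread_cochains: "g \<in> cochains B N n \<Longrightarrow> (\<lambda>xs. spread \<phi> xs g) \<in> cochains R (bipull \<alpha> \<beta> N) n"
proof (induction n arbitrary: g)
  case 0
  have "spread \<phi> (x # xs) g = spread \<phi> (x # xs) (\<lambda>_. 0)" for x xs
    by (rule spread_cong) (simp add: cochains_length[OF 0])
  then show ?case by (simp only: cochains_0 neq_Nil_conv spread_zero) blast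
next
  case (Suc n)
  note S = Suc.prems[unfolded cochains_Suc[OF N.vs_A N.vs_M]]
  have lin1: "lin (ascale B) (mscale N) (\<lambda>a. g (a # as))" for as using S by blast
  have c1: "(\<lambda>l. g (x # l)) \<in> cochains B N n" for x using S by blast
  have lp: "lin (ascale B) (mscale N) (\<lambda>a. spread \<phi> as (\<lambda>l. g (a # l)))" for as
    by (rule linI) (simp_all add: lin_simps[OF lin1] spread_add spread_comp[OF lin_scaled[OF N.vs_M lin_ident], symmetric])
  show ?case
    unfolding cochains_Suc[OF vs_R N.vs_M[folded bipull_simps(1)[of \<alpha> \<beta>]]]
  proof (intro conjI allI)
    show "(\<lambda>l. spread \<phi> (x # l) g) \<in> cochains R (bipull \<alpha> \<beta> N) n" for x
      using cochains_add[OF cochains_map[OF c1 lin_R(4) vs_R bipull_simps(1)] Suc.IH[OF c1]] by simp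
    show "lin (ascale R) (mscale (bipull \<alpha> \<beta> N)) (\<lambda>a. spread \<phi> (a # as) g)" for as
      using lin_plus[OF N.vs_M lin_comp[OF lin_R(3) lin1] lin_comp[OF lin_R(2) lp]] by simp
  qed simp
qed

lemma cup_cochains:
  assumes "h \<in> cochains R (bipull \<alpha> \<beta> N) n" shows "cup N h \<in> cochains R (bipull \<gamma> \<delta> N) (Suc n)"
  unfolding cochains_Suc[OF vs_R N.vs_M[folded bipull_simps(1)[of \<gamma> \<delta>]]]
  using cochains_comp[OF assms, of "bipull \<gamma> \<delta> N"] lin_comp[OF lin_R(3) N.lin_lact_alg]
  by (simp add: N.lin_lact_mod N.vs_M)

text \<open>The actions on \<open>\<psi>!\<close> are triangular: the first argument feeds
  \<open>\<psi>(m)\<close> into the third component and the last one feeds \<open>n\<^sub>1\<close>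
  into it, which accounts for the two additional terms.\<close>

lemma hoch_thd:
  "thd (hoch R W F xs) = hoch R NRA (\<lambda>l. thd (F l)) xs + cup N (\<lambda>l. \<psi> (fst (F l))) xs + rcup N xs (\<lambda>l. mid (F l))"
proof -
  have "thd (hoch_tail R W F xs) = hoch_tail R NRA (\<lambda>l. thd (F l)) xs + rcup N xs (\<lambda>l. mid (F l))"
    by (induction xs arbitrary: F rule: induct_list012) simp_all
  then show ?thesis by (cases xs) simp_all
qed

lemma hoch_fst: "fst (hoch R W F xs) = hoch R (bipull fst fst M) (\<lambda>l. fst (F l)) xs"
  by (rule hoch_comp) simp_all

lemma hoch_mid: "mid (hoch R W F xs) = hoch R (bipull (\<lambda>x. mid x) (\<lambda>x. mid x) N) (\<lambda>l. mid (F l)) xs"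
  using hoch_comp[of "\<lambda>x. mid x" W "bipull (\<lambda>x. mid x) (\<lambda>x. mid x) N" R F xs] by simp

text \<open>The map \<open>x \<mapsto> b\<^sub>2\<close> is a derivation with left factor
  \<open>b\<^sub>1\<close> and right factor \<open>\<phi>(a)\<close>, hence a 1-cocycle; the
  differential passes it with a minus sign.\<close>

lemma hoch_cup:
  "hoch R NRA (cup N h) xs = - cup N (hoch R (bipull (\<lambda>x. \<phi> (fst x)) (\<lambda>x. \<phi> (fst x)) N) h) xs"
proof -
  consider "xs = []" | x where "xs = [x]" | x y zs where "xs = x # y # zs"
    by (metis neq_Nil_conv)
  then show ?thesis
  proof cases
    case (3 x y zs)
    have "hoch_tail R NRA (\<lambda>l. lact N (thd x) (h l)) (y # zs) = lact N (thd x) (hoch_tail R NRA h (y # zs))"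
      by (rule hoch_tail_comp[symmetric]) (simp_all add: N.lact_ract)
    moreover have "hoch_tail R NRA h (y # zs) = hoch_tail R (bipull (\<lambda>x. \<phi> (fst x)) (\<lambda>x. \<phi> (fst x)) N) h (y # zs)"
      using hoch_tail_comp[of "\<lambda>x. x" NRA "bipull (\<lambda>x. \<phi> (fst x)) (\<lambda>x. \<phi> (fst x)) N" R h "y # zs"] by simp
    ultimately show ?thesis using 3 by (simp add: N.lact_mult)
  qed simp_all
qed

text \<open>The corner \<open>b\<^sub>2 \<phi>(a') + b\<^sub>1 b\<^sub>2'\<close> of a product lists
  the two ways to choose the corner factor, so merging arguments commutes with choosing the
  position. A corner factor in last place, acting from the right, is what \<open>rcup\<close>
  supplies.\<close>

lemma hoch_spread_tail:
  assumes "multilin B N g"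
  shows "hoch_tail R NRA (\<lambda>l. spread \<phi> l g) xs + rcup N xs (\<lambda>l. g (map (\<lambda>x. mid x) l)) = spread \<phi> xs (hoch_tail B N g)"
  using assms
proof (induction xs arbitrary: g rule: induct_list012)
  case (3 x y zs)
  note lin1 = lin_simps[OF multilin_head[OF "3.prems"]]
  have 1: "spread \<phi> (y # zs) (\<lambda>l. hoch_tail B N g (u # l)) =
      - spread \<phi> (y # zs) (\<lambda>l. case l of [] \<Rightarrow> 0 | y # zs \<Rightarrow> g (amult B u y # zs))
      - spread \<phi> (y # zs) (hoch_tail B N (\<lambda>l. g (u # l)))" for u
  proof -
    have "spread \<phi> (y # zs) (\<lambda>l. hoch_tail B N g (u # l)) = spread \<phi> (y # zs)
      (\<lambda>l. - (case l of [] \<Rightarrow> 0 | y # zs \<Rightarrow> g (amult B u y # zs)) - hoch_tail B N (\<lambda>l. g (u # l)) l)"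
      by (rule spread_cong) (auto simp: length_Suc_conv)
    then show ?thesis by (simp only: spread_diff spread_uminus)
  qed
  have 2: "hoch_tail R NRA (\<lambda>l. spread \<phi> (x # l) g) (y # zs) =
      hoch_tail B N (\<lambda>l. g (thd x # l)) (map (\<lambda>x. \<phi> (fst x)) (y # zs))
      + hoch_tail R NRA (\<lambda>l. spread \<phi> l (\<lambda>l. g (mid x # l))) (y # zs)"
  proof -
    have "hoch_tail R NRA (\<lambda>l. spread \<phi> (x # l) g) (y # zs) =
       hoch_tail R NRA (\<lambda>l. g (thd x # map (\<lambda>x. \<phi> (fst x)) l)) (y # zs) +
       hoch_tail R NRA (\<lambda>l. spread \<phi> l (\<lambda>l. g (mid x # l))) (y # zs)"
      by (simp only: spread.simps NRA.hoch_tail_add)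
    then show ?thesis
      using hoch_tail_map_args[of "\<lambda>x. \<phi> (fst x)" R B NRA N "\<lambda>l. g (thd x # l)" "y # zs"] by simp
  qed
  have "hoch_tail R NRA (\<lambda>l. spread \<phi> l g) (x # y # zs) + rcup N (x # y # zs) (\<lambda>l. g (map (\<lambda>x. mid x) l))
     = - spread \<phi> (amult R x y # zs) g - hoch_tail R NRA (\<lambda>l. spread \<phi> (x # l) g) (y # zs)
       - rcup N (y # zs) (\<lambda>l. g (mid x # map (\<lambda>x. mid x) l))"
    by simp
  also have "\<dots> = hoch_tail B N g (thd x # map (\<lambda>x. \<phi> (fst x)) (y # zs)) + spread \<phi> (y # zs) (\<lambda>l. hoch_tail B N g (mid x # l))"
    unfolding 1 2 using "3.IH"(2)[OF multilin_Cons[OF "3.prems"], of "mid x"]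
    by (simp add: lin1 algebra_simps)
  also have "\<dots> = spread \<phi> (x # y # zs) (hoch_tail B N g)"
    by (simp only: spread.simps(2)[of _ x])
  finally show ?case .
qed simp_all

text \<open>Choosing \<open>b\<^sub>2\<close> in first place also gives
  \<open>b\<^sub>2 g(\<phi>(a), ..., \<phi>(a))\<close>, which the left action of \<open>NRA\<close>
  does not produce; this is the subtracted \<open>cup\<close>.\<close>

lemma hoch_spread:
  assumes "multilin B N g"
  shows "hoch R NRA (\<lambda>l. spread \<phi> l g) xs + rcup N xs (\<lambda>l. g (map (\<lambda>x. mid x) l))
    = spread \<phi> xs (hoch B N g) - cup N (\<lambda>l. g (map (\<lambda>x. \<phi> (fst x)) l)) xs"
proof (cases xs)
  case (Cons x ys)
  have "hoch B N g = (\<lambda>l. (case l of [] \<Rightarrow> 0 | x # xs \<Rightarrow> lact N x (g xs)) + hoch_tail B N g l)"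
    by (rule ext) (simp add: hoch_def split: list.splits)
  then have "spread \<phi> xs (hoch B N g) = spread \<phi> xs (\<lambda>l. case l of [] \<Rightarrow> 0 | x # xs \<Rightarrow> lact N x (g xs))
      + spread \<phi> xs (hoch_tail B N g)"
    by (simp only: spread_add)
  moreover have "spread \<phi> ys (\<lambda>l. lact N a (g l)) = lact N a (spread \<phi> ys g)" for a
    by (rule spread_comp[symmetric]) (rule N.lin_lact_mod)
  ultimately show ?thesis
    using hoch_spread_tail[OF assms, of xs] by (simp add: Cons del: spread.simps(2)) (simp add: algebra_simps)
qed simp


section \<open>The comparison map\<close>

text \<open>Degree 0 needs no separate formula: the third component is zero there, and so is its
  \<open>hoch\<close>.\<close>

definition delta :: "('a, 'b, 'm, 'n) phi_cochain \<Rightarrow> ('a, 'b, 'm, 'n) phi_cochain" where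
  "delta = (\<lambda>(f, g, h). (hoch A M f, hoch B N g, \<lambda>as. \<psi> (f as) - g (map \<phi> as) - hoch A (bipull \<phi> \<phi> N) h as))"

lemma delta_simps [simp]: "fst (delta x) = hoch A M (fst x)" "mid (delta x) = hoch B N (mid x)"
  "thd (delta x) as = \<psi> (fst x as) - mid x (map \<phi> as) - hoch A (bipull \<phi> \<phi> N) (thd x) as"
  by (simp_all add: delta_def split_def)

text \<open>\<open>hoch_spread\<close> absorbs the \<open>rcup\<close> term from
  \<open>\<psi>!\<close>, and the terms with \<open>b\<^sub>2\<close> in front collect to
  \<open>\<psi> f - g \<phi> - dh\<close>, the third component of \<open>delta\<close>.\<close>

lemma hoch_tau:
  assumes "multilin B N (mid x)"
  shows "hoch R W (tau \<phi> N x) = tau \<phi> N (delta x)"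
proof
  fix xs
  have 1: "fst (hoch R W (tau \<phi> N x) xs) = fst (tau \<phi> N (delta x) xs)"
    unfolding hoch_fst using hoch_map_args[of fst R A "bipull fst fst M" M "fst x" xs] by simp
  have 2: "mid (hoch R W (tau \<phi> N x) xs) = mid (tau \<phi> N (delta x) xs)"
    unfolding hoch_mid
    using hoch_map_args[of "\<lambda>x. mid x" R B "bipull (\<lambda>x. mid x) (\<lambda>x. mid x) N" N "mid x" xs] by simp
  have m: "hoch R (bipull (\<lambda>x. \<phi> (fst x)) (\<lambda>x. \<phi> (fst x)) N) (\<lambda>l. thd x (map fst l))
     = (\<lambda>ys. hoch A (bipull \<phi> \<phi> N) (thd x) (map fst ys))"
    by (rule ext, rule hoch_map_args) simp_all
  have "thd (hoch R W (tau \<phi> N x) xs) = hoch R NRA (\<lambda>l. spread \<phi> l (mid x)) xs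
      + hoch R NRA (cup N (\<lambda>l. thd x (map fst l))) xs
      + cup N (\<lambda>l. \<psi> (fst x (map fst l))) xs + rcup N xs (\<lambda>l. mid x (map (\<lambda>x. mid x) l))"
    by (simp add: hoch_thd NRA.hoch_add)
  also have "\<dots> = spread \<phi> xs (hoch B N (mid x)) - cup N (\<lambda>l. mid x (map (\<lambda>x. \<phi> (fst x)) l)) xs
      - cup N (\<lambda>l. hoch A (bipull \<phi> \<phi> N) (thd x) (map fst l)) xs + cup N (\<lambda>l. \<psi> (fst x (map fst l))) xs"
    using hoch_spread[OF assms, of xs] by (simp add: hoch_cup m algebra_simps)
  also have "\<dots> = thd (tau \<phi> N (delta x) xs)"
    by (cases xs) (simp_all add: o_def)
  finally show "hoch R W (tau \<phi> N x) xs = tau \<phi> N (delta x) xs"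
    using 1 2 by (simp add: prod_eq_iff)
qed

lemma lin_W_iff:
  "lin s (mscale W) F \<longleftrightarrow> lin s (mscale M) (\<lambda>x. fst (F x)) \<and> lin s (mscale N) (\<lambda>x. mid (F x))
     \<and> lin s (mscale N) (\<lambda>x. thd (F x))"
  by (auto simp: lin_def prod_eq_iff)

lemma cochains_W:
  "F \<in> cochains R W n \<longleftrightarrow> (\<lambda>l. fst (F l)) \<in> cochains R (bipull fst fst M) n \<and>
     (\<lambda>l. mid (F l)) \<in> cochains R NRA n \<and> (\<lambda>l. thd (F l)) \<in> cochains R NRA n"
  unfolding cochains_def linear_iff_lin mem_Collect_eq lin_W_iff bipull_simps
  by (auto simp: prod_eq_iff vs_R vs_W M.vs_M N.vs_M)

abbreviation C where "C \<equiv> phi_cochains A B \<phi> M N"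

lemma mem_C: "x \<in> C n \<longleftrightarrow> fst x \<in> cochains A M n \<and> mid x \<in> cochains B N n \<and>
    (if n = 0 then thd x = 0 else thd x \<in> cochains A (bipull \<phi> \<phi> N) (n - 1))"
  by (cases x) (auto simp: phi_cochains_def pullback_bipull)

lemma tau_cochains:
  assumes "x \<in> C n" shows "tau \<phi> N x \<in> cochains R W n"
proof -
  have x: "fst x \<in> cochains A M n" "mid x \<in> cochains B N n" using assms by (simp_all add: mem_C)
  have "cup N (\<lambda>l. thd x (map fst l)) \<in> cochains R NRA n"
  proof (cases n)
    case 0
    then have "cup N (\<lambda>l. thd x (map fst l)) = (\<lambda>_. 0)"
      using assms by (auto simp: mem_C cup_def fun_eq_iff split: list.splits)
    then show ?thesis using cochains_zero'[OF vs_R NRA.vs_M] by simp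
  next
    case (Suc m)
    then have "thd x \<in> cochains A (bipull \<phi> \<phi> N) m" using assms by (simp add: mem_C)
    then have "(\<lambda>l. thd x (map fst l)) \<in> cochains R NRA m"
      by (rule cochains_map[OF _ lin_R(1) vs_R]) simp
    then show ?thesis unfolding Suc by (rule cup_cochains)
  qed
  then show ?thesis
    unfolding cochains_W tau_simps
    by (intro conjI cochains_add spread_cochains cochains_map[OF x(1) lin_R(1) vs_R]
        cochains_map[OF x(2) lin_R(2) vs_R] x) simp_all
qed

lemma cochains_hom:
  assumes "f \<in> cochains A M n" shows "(\<lambda>as. \<psi> (f as)) \<in> cochains A (bipull \<phi> \<phi> N) n"
  using cochains_comp[OF assms, of "bipull \<phi> \<phi> N" \<psi>] by (simp add: lin_psi N.vs_M)

lemma cochains_phi: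
  assumes "g \<in> cochains B N n" shows "(\<lambda>as. g (map \<phi> as)) \<in> cochains A (bipull \<phi> \<phi> N) n"
  by (rule cochains_map[OF assms lin_phi M.vs_A]) simp

lemma delta_cochains:
  assumes "x \<in> C n" shows "delta x \<in> C (Suc n)"
proof -
  have x: "fst x \<in> cochains A M n" "mid x \<in> cochains B N n" using assms by (simp_all add: mem_C)
  have "hoch A (bipull \<phi> \<phi> N) (thd x) \<in> cochains A (bipull \<phi> \<phi> N) n"
  proof (cases n)
    case 0
    then have "thd x = (\<lambda>_. 0)" using assms by (auto simp: mem_C)
    then show ?thesis by (simp add: NA.hoch_zero cochains_zero' M.vs_A N.vs_M)
  next
    case (Suc m)
    then show ?thesis using assms by (simp add: mem_C NA.hoch_cochains)
  qed
  then have "(\<lambda>as. \<psi> (fst x as) - mid x (map \<phi> as) - hoch A (bipull \<phi> \<phi> N) (thd x) as) \<in> cochains A (bipull \<phi> \<phi> N) n"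
    by (intro cochains_diff cochains_hom cochains_phi x)
  then show ?thesis
    using x by (simp add: mem_C M.hoch_cochains N.hoch_cochains delta_def split_def)
qed

lemma C_multilin: "x \<in> C n \<Longrightarrow> multilin B N (mid x)"
  by (auto simp: mem_C N.vs_M intro: cochains_multilin)

lemma hoch_tau_C: "x \<in> C n \<Longrightarrow> hoch R W (tau \<phi> N x) = tau \<phi> N (delta x)"
  by (rule hoch_tau) (rule C_multilin)

lemma C_add: "x \<in> C n \<Longrightarrow> y \<in> C n \<Longrightarrow> x + y \<in> C n"
  and C_diff: "x \<in> C n \<Longrightarrow> y \<in> C n \<Longrightarrow> x - y \<in> C n"
  and C_zero: "0 \<in> C n"
  by (auto simp: mem_C plus_fun_def fun_diff_def cochains_zero M.vs_A N.vs_A M.vs_M N.vs_M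
      intro!: cochains_add cochains_diff)

lemma delta_add: "delta (x + y) = delta x + delta y"
  and delta_diff: "delta (x - y) = delta x - delta y"
  by (simp_all add: prod_eq_iff fun_eq_iff plus_fun_def fun_diff_def M.hoch_add N.hoch_add NA.hoch_add
      M.hoch_diff N.hoch_diff NA.hoch_diff)

lemma cup_add: "cup N (\<lambda>l. F l + G l) xs = cup N F xs + cup N G xs"
  and cup_diff: "cup N (\<lambda>l. F l - G l) xs = cup N F xs - cup N G xs"
  and cup_zero: "cup N (\<lambda>_. 0) xs = 0"
  by (cases xs; simp)+

lemma tau_add: "tau \<phi> N (x + y) = tau \<phi> N x + (tau \<phi> N y :: _ \<Rightarrow> 'm \<times> 'n \<times> 'n)"
  and tau_diff: "tau \<phi> N (x - y) = tau \<phi> N x - (tau \<phi> N y :: _ \<Rightarrow> 'm \<times> 'n \<times> 'n)"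
  by (simp_all add: prod_eq_iff fun_eq_iff plus_fun_def fun_diff_def spread_add spread_diff cup_add cup_diff)


section \<open>A retraction of the comparison map\<close>

definition unital_values :: "('z \<Rightarrow> 'm \<times> 'n \<times> 'n) \<Rightarrow> bool" where
  "unital_values F \<longleftrightarrow> (\<forall>z. lact M (aone A) (fst (F z)) = fst (F z) \<and> ract M (fst (F z)) (aone A) = fst (F z) \<and>
     lact N (aone B) (mid (F z)) = mid (F z) \<and> ract N (mid (F z)) (aone B) = mid (F z))"

lemma unital_valuesD:
  assumes "unital_values F"
  shows "lact M (aone A) (fst (F z)) = fst (F z)" "ract M (fst (F z)) (aone A) = fst (F z)"
     "lact N (aone B) (mid (F z)) = mid (F z)" "ract N (mid (F z)) (aone B) = mid (F z)"
  using assms by (simp_all add: unital_values_def)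

text \<open>The first insertion is the homotopy given by \<open>1\<phi>\<close> between the
  restrictions to A and to B. On the image of \<open>tau\<close> it returns h, up to the left unit,
  plus an insertion of \<open>1\<^sub>B\<close> into g; the second insertion removes that term. It
  is a homotopy from a map to itself and so does not disturb compatibility with the
  differentials.\<close>

definition rho :: "(('a \<times> 'b \<times> 'b) list \<Rightarrow> 'm \<times> 'n \<times> 'n) \<Rightarrow> ('a, 'b, 'm, 'n) phi_cochain" where
  "rho F = (\<lambda>as. fst (F (map (\<lambda>a. (a, 0, 0)) as)), \<lambda>bs. mid (F (map (\<lambda>b. (0, b, 0)) bs)),
     \<lambda>as. thd (ins (0, 0, aone B) (\<lambda>a. (0, \<phi> a, 0)) (\<lambda>a. (a, 0, 0)) as F)
        - mid (ins (0, aone B, 0) (\<lambda>a. (0, \<phi> a, 0)) (\<lambda>a. (0, \<phi> a, 0)) as F))"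

lemma rho_simps:
  "fst (rho F) as = fst (F (map (\<lambda>a. (a, 0, 0)) as))" "mid (rho F) bs = mid (F (map (\<lambda>b. (0, b, 0)) bs))"
  "thd (rho F) as = thd (ins (0, 0, aone B) (\<lambda>a. (0, \<phi> a, 0)) (\<lambda>a. (a, 0, 0)) as F)
        - mid (ins (0, aone B, 0) (\<lambda>a. (0, \<phi> a, 0)) (\<lambda>a. (0, \<phi> a, 0)) as F)"
  by (simp_all add: rho_def)

lemma ins_W_cochains:
  assumes F: "F \<in> cochains R W (Suc n)" and "lin (ascale A) (ascale R) \<alpha>" "lin (ascale A) (ascale R) \<beta>"
  shows "(\<lambda>as. mid (ins v \<alpha> \<beta> as F)) \<in> cochains A (bipull \<phi> \<phi> N) n"
    "(\<lambda>as. thd (ins v \<alpha> \<beta> as F)) \<in> cochains A (bipull \<phi> \<phi> N) n"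
proof -
  note i = ins_cochains[OF vs_R M.vs_A, of NRA, OF NRA.vs_M assms(2,3), of "bipull \<phi> \<phi> N" _ n v]
  show "(\<lambda>as. mid (ins v \<alpha> \<beta> as F)) \<in> cochains A (bipull \<phi> \<phi> N) n"
    unfolding ins_comp[OF lin_W(2)] using F by (intro i) (simp_all add: cochains_W)
  show "(\<lambda>as. thd (ins v \<alpha> \<beta> as F)) \<in> cochains A (bipull \<phi> \<phi> N) n"
    unfolding ins_comp[OF lin_W(3)] using F by (intro i) (simp_all add: cochains_W)
qed

lemma rho_cochains:
  assumes F: "F \<in> cochains R W n" shows "rho F \<in> C n"
proof -
  have "fst (rho F) \<in> cochains A M n"
    unfolding rho_def prod.case fst_conv snd_conv
    by (rule cochains_map[of _ R "bipull fst fst M"]) (use F in \<open>simp_all add: cochains_W lin_R M.vs_A\<close>)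
  moreover have "mid (rho F) \<in> cochains B N n"
    unfolding rho_def prod.case fst_conv snd_conv
    by (rule cochains_map[of _ R NRA]) (use F in \<open>simp_all add: cochains_W lin_R N.vs_A\<close>)
  moreover have "if n = 0 then thd (rho F) = 0 else thd (rho F) \<in> cochains A (bipull \<phi> \<phi> N) (n - 1)"
  proof (cases n)
    case 0
    then show ?thesis using F by (simp add: rho_def ins_cochains_0 fun_eq_iff)
  next
    case (Suc m)
    then show ?thesis using F unfolding rho_def
      by (simp) (intro cochains_diff ins_W_cochains lin_R; simp)
  qed
  ultimately show ?thesis by (simp add: mem_C)
qed

text \<open>\<open>(\<phi> a)(1\<phi>) = (1\<phi>) a\<close>, so inserting \<open>1\<phi>\<close> is
  a homotopy whose ends are \<open>\<psi>\<close> of the first component and the second component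
  along \<open>\<phi>\<close>. The two ends of the insertion of \<open>1\<^sub>B\<close> coincide,
  since the units act as the identity on the values.\<close>

lemma rho_hoch:
  assumes u: "unital_values F"
  shows "rho (hoch R W F) = delta (rho F)"
proof -
  let ?a = "\<lambda>a. (a, 0, 0) :: 'a \<times> 'b \<times> 'b" and ?b = "\<lambda>b. (0, b, 0) :: 'a \<times> 'b \<times> 'b"
  let ?pa = "\<lambda>a. (0, \<phi> a, 0) :: 'a \<times> 'b \<times> 'b"
  have 1: "fst (rho (hoch R W F)) as = fst (delta (rho F)) as" for as
  proof -
    have "hoch R W F (map ?a as) = hoch A (bipull ?a ?a W) (\<lambda>l. F (map ?a l)) as"
      by (rule hoch_map_args[symmetric]) (simp_all add: prod_eq_iff)
    also have "fst \<dots> = hoch A M (\<lambda>l. fst (F (map ?a l))) as"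
      by (rule hoch_comp) simp_all
    finally show ?thesis by (simp add: rho_def)
  qed
  have 2: "mid (rho (hoch R W F)) bs = mid (delta (rho F)) bs" for bs
  proof -
    have "hoch R W F (map ?b bs) = hoch B (bipull ?b ?b W) (\<lambda>l. F (map ?b l)) bs"
      by (rule hoch_map_args[symmetric]) (simp_all add: prod_eq_iff)
    also have "mid \<dots> = hoch B N (\<lambda>l. mid (F (map ?b l))) bs"
      using hoch_comp[of "\<lambda>x. mid x" "bipull ?b ?b W" N B] by simp
    finally show ?thesis by (simp add: rho_def)
  qed
  have 3: "thd (rho (hoch R W F)) as = thd (delta (rho F)) as" for as
  proof -
    have "ins (0, 0, aone B) ?pa ?a as (hoch R W F) + hoch A (bipull ?pa ?a W) (\<lambda>l. ins (0, 0, aone B) ?pa ?a l F) as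
      = lact W (0, 0, aone B) (F (map ?a as)) - ract W (F (map ?pa as)) (0, 0, aone B)"
      by (rule W.ins_hoch) (simp_all add: prod_eq_iff)
    moreover have "thd (hoch A (bipull ?pa ?a W) G as) = hoch A (bipull \<phi> \<phi> N) (\<lambda>l. thd (G l)) as" for G
      using hoch_comp[of "\<lambda>x. thd x" "bipull ?pa ?a W" "bipull \<phi> \<phi> N" A] by simp
    moreover have "lact N (aone B) (\<psi> (fst (F z))) = \<psi> (fst (F z))" for z
      using unital_valuesD(1)[OF u, of z] by (metis phi_one psi_lact)
    ultimately have t: "thd (ins (0, 0, aone B) ?pa ?a as (hoch R W F))
        + hoch A (bipull \<phi> \<phi> N) (\<lambda>l. thd (ins (0, 0, aone B) ?pa ?a l F)) as
        = \<psi> (fst (F (map ?a as))) - mid (F (map ?pa as))"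
      by (simp add: prod_eq_iff unital_valuesD[OF u])
    have "ins (0, aone B, 0) ?pa ?pa as (hoch R W F) + hoch A (bipull ?pa ?pa W) (\<lambda>l. ins (0, aone B, 0) ?pa ?pa l F) as
      = lact W (0, aone B, 0) (F (map ?pa as)) - ract W (F (map ?pa as)) (0, aone B, 0)"
      by (rule W.ins_hoch) (simp_all add: prod_eq_iff)
    moreover have "mid (hoch A (bipull ?pa ?pa W) G as) = hoch A (bipull \<phi> \<phi> N) (\<lambda>l. mid (G l)) as" for G
      using hoch_comp[of "\<lambda>x. mid x" "bipull ?pa ?pa W" "bipull \<phi> \<phi> N" A] by simp
    ultimately have m: "mid (ins (0, aone B, 0) ?pa ?pa as (hoch R W F))
        + hoch A (bipull \<phi> \<phi> N) (\<lambda>l. mid (ins (0, aone B, 0) ?pa ?pa l F)) as = 0"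
      by (simp add: prod_eq_iff unital_valuesD[OF u])
    show ?thesis
      using t m by (simp add: rho_def delta_def NA.hoch_diff o_def algebra_simps)
  qed
  show ?thesis using 1 2 3 by (simp add: prod_eq_iff fun_eq_iff)
qed

text \<open>Among the arguments only the inserted \<open>1\<phi>\<close> has a nonzero
  \<open>b\<^sub>2\<close>, so \<open>spread\<close> keeps one term: \<open>1\<^sub>B\<close> at
  that place and \<open>\<phi>(a)\<close> at all others.\<close>

lemma ins_spread:
  "multilin B N g \<Longrightarrow> ins (0, 0, aone B) (\<lambda>a. (0, \<phi> a, 0)) (\<lambda>a. (a, 0, 0)) as (\<lambda>l. spread \<phi> l g)
    = ins (0 :: 'a, aone B, 0 :: 'b) (\<lambda>a. (0, \<phi> a, 0)) (\<lambda>a. (0, \<phi> a, 0)) as (\<lambda>l. g (map (\<lambda>x. mid x) l))"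
proof (induction as arbitrary: g)
  case (Cons a as)
  have "g (0 # l) = 0" for l using lin_zero[OF multilin_head[OF Cons.prems]] .
  then show ?case using Cons.IH[OF multilin_Cons[OF Cons.prems], of "\<phi> a"] by (simp add: spread_zero o_def)
qed simp

text \<open>\<open>cup\<close> reads \<open>b\<^sub>2\<close> off the first argument, and this is
  zero unless \<open>1\<phi>\<close> is inserted in front.\<close>

lemma ins_cup:
  "ins (0, 0, aone B) (\<lambda>a. (0, \<phi> a, 0)) (\<lambda>a. (a, 0, 0)) as (cup N h) = lact N (aone B) (h (map (\<lambda>a. (a, 0, 0)) as))"
  by (cases as) (simp_all add: ins_zero)

lemma rho_tau:
  assumes "x \<in> C n" and "\<And>as. lact N (aone B) (thd x as) = thd x as"
  shows "rho (tau \<phi> N x) = x"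
proof -
  have "thd (rho (tau \<phi> N x)) as = thd x as" for as
    unfolding rho_simps ins_comp[OF lin_W(2)] ins_comp[OF lin_W(3)]
    by (simp add: ins_add ins_spread[OF C_multilin[OF assms(1)]] ins_cup assms(2) o_def)
  then show ?thesis by (simp add: prod_eq_iff fun_eq_iff rho_simps o_def)
qed


section \<open>Bijectivity on cohomology\<close>

lemma hoch_corner: "hoch R W (\<lambda>l. (0, 0, G l)) xs = (0, 0, hoch R NRA G xs)"
  using hoch_comp[of "\<lambda>n. (0, 0, n)" NRA W R G xs] by (simp add: prod_eq_iff)

lemma cochains_corner: "G \<in> cochains R NRA n \<Longrightarrow> (\<lambda>l. (0, 0, G l)) \<in> cochains R W n"
  by (simp add: cochains_W cochains_zero' vs_R M.vs_M N.vs_M)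

text \<open>For \<open>x = a + b\<^sub>1 + b\<^sub>2\<phi>\<close> one has
  \<open>1\<^sub>A x = a 1\<^sub>A\<close> and \<open>x 1\<^sub>B = 1\<^sub>B b\<^sub>1\<close>.
  Inserting these idempotents makes the first two components cohomologous to their restrictions to A
  and to B, which vanish by hypothesis.\<close>

lemma kill_diagonal:
  assumes F: "F \<in> cochains R W (Suc n)" and d: "hoch R W F = (\<lambda>_. 0)" and u: "unital_values F"
    and 0: "\<And>as. fst (F (map (\<lambda>a. (a, 0, 0)) as)) = 0" "\<And>bs. mid (F (map (\<lambda>b. (0, b, 0)) bs)) = 0"
  shows "\<exists>G\<in>cochains R W n. \<exists>E\<in>cochains R NRA (Suc n). \<forall>xs. F xs - hoch R W G xs = (0, 0, E xs)"
proof -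
  let ?ea = "(aone A, 0, 0) :: 'a \<times> 'b \<times> 'b" and ?eb = "(0, aone B, 0) :: 'a \<times> 'b \<times> 'b"
  let ?pa = "\<lambda>x. (fst x, 0, 0) :: 'a \<times> 'b \<times> 'b" and ?pb = "\<lambda>x. (0, mid x, 0) :: 'a \<times> 'b \<times> 'b"
  define G1 where "G1 xs = fst (ins ?ea ?pa (\<lambda>x. x) xs F)" for xs
  define G2 where "G2 xs = mid (ins ?eb (\<lambda>x. x) ?pb xs F)" for xs
  \<comment> \<open>\<open>G2\<close> has the opposite sign because \<open>1\<^sub>B\<close> absorbs
    x from the other side. The effect of G on the third component is collected in E.\<close>
  define G where "G xs = (G1 xs, - G2 xs, 0 :: 'n)" for xs
  have "G1 \<in> cochains R (bipull fst fst M) n"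
    unfolding G1_def[abs_def] ins_comp[OF lin_W(1)]
    by (rule ins_cochains[OF vs_R vs_R MR.vs_M lin_R(8) lin_ident refl]) (use F in \<open>simp add: cochains_W\<close>)
  moreover have "G2 \<in> cochains R NRA n"
    unfolding G2_def[abs_def] ins_comp[OF lin_W(2)]
    by (rule ins_cochains[OF vs_R vs_R NRA.vs_M lin_ident lin_R(9) refl]) (use F in \<open>simp add: cochains_W\<close>)
  ultimately have G: "G \<in> cochains R W n"
    by (simp add: cochains_W G_def[abs_def] cochains_uminus cochains_zero' vs_R N.vs_M)
  have "ins ?ea ?pa (\<lambda>x. x) xs (hoch R W F) + hoch R (bipull ?pa (\<lambda>x. x) W) (\<lambda>l. ins ?ea ?pa (\<lambda>x. x) l F) xs
      = lact W ?ea (F (map (\<lambda>x. x) xs)) - ract W (F (map ?pa xs)) ?ea" for xs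
    by (rule W.ins_hoch) (simp_all add: prod_eq_iff)
  moreover have "fst (hoch R (bipull ?pa (\<lambda>x. x) W) H xs) = hoch R (bipull fst fst M) (\<lambda>l. fst (H l)) xs" for H xs
    by (rule hoch_comp) simp_all
  ultimately have "hoch R (bipull fst fst M) G1 xs = fst (F xs)" for xs
    using 0(1)[of "map fst xs"]
    by (simp add: prod_eq_iff unital_valuesD[OF u] d ins_zero G1_def[abs_def] o_def)
  then have 1: "fst (hoch R W G xs) = fst (F xs)" for xs
    by (simp add: hoch_fst G_def)
  have "ins ?eb (\<lambda>x. x) ?pb xs (hoch R W F) + hoch R (bipull (\<lambda>x. x) ?pb W) (\<lambda>l. ins ?eb (\<lambda>x. x) ?pb l F) xs
      = lact W ?eb (F (map ?pb xs)) - ract W (F (map (\<lambda>x. x) xs)) ?eb" for xs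
    by (rule W.ins_hoch) (simp_all add: prod_eq_iff)
  moreover have "mid (hoch R (bipull (\<lambda>x. x) ?pb W) H xs) = hoch R (bipull (\<lambda>x. mid x) (\<lambda>x. mid x) N) (\<lambda>l. mid (H l)) xs" for H xs
    using hoch_comp[of "\<lambda>x. mid x" "bipull (\<lambda>x. x) ?pb W" "bipull (\<lambda>x. mid x) (\<lambda>x. mid x) N" R H xs] by simp
  ultimately have "hoch R (bipull (\<lambda>x. mid x) (\<lambda>x. mid x) N) G2 xs = - mid (F xs)" for xs
    using 0(2)[of "map (\<lambda>x. mid x) xs"]
    by (simp add: prod_eq_iff unital_valuesD[OF u] d ins_zero G2_def[abs_def] o_def)
  then have 2: "mid (hoch R W G xs) = mid (F xs)" for xs
    by (simp add: hoch_mid G_def NR.hoch_uminus)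
  define E where "E xs = thd (F xs - hoch R W G xs)" for xs
  have "(\<lambda>xs. F xs - hoch R W G xs) \<in> cochains R W (Suc n)"
    by (intro cochains_diff F W.hoch_cochains G)
  then have "E \<in> cochains R NRA (Suc n)" unfolding cochains_W E_def[abs_def] by blast
  moreover have "F xs - hoch R W G xs = (0, 0, E xs)" for xs
    using 1[of xs] 2[of xs] by (simp add: prod_eq_iff E_def)
  ultimately show ?thesis using G by blast
qed

text \<open>The elements \<open>1\<^sub>B\<close> and \<open>1\<^sub>B\<phi>\<close> form a column vector \<open>v\<close> with \<open>\<rho>(x) v = v x\<close>, where \<open>\<rho>\<close> sends
  \<open>x = a + b\<^sub>1 + b\<^sub>2\<phi>\<close> to the upper triangular matrix with diagonal \<open>b\<^sub>1, \<phi>(a)\<close> and corner \<open>b\<^sub>2\<close>. So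
  inserting \<open>v\<close> is again a homotopy; this is its first component, the second one being
  \<open>ins (0, 0, aone B) (\<lambda>x. (0, \<phi> (fst x), 0)) (\<lambda>x. x)\<close>.\<close>

primrec ins_column :: "('a \<times> 'b \<times> 'b) list \<Rightarrow> (('a \<times> 'b \<times> 'b) list \<Rightarrow> 'n) \<Rightarrow> 'n" where
  "ins_column [] F = F [(0, aone B, 0)]"
| "ins_column (x # xs) F = F ((0, aone B, 0) # x # xs) - ins_column xs (\<lambda>l. F ((0, mid x, 0) # l))
     - ins (0, 0, aone B) (\<lambda>x. (0, \<phi> (fst x), 0)) (\<lambda>x. x) xs (\<lambda>l. F ((0, thd x, 0) # l))"

abbreviation ins_phi where "ins_phi \<equiv> ins (0, 0, aone B) (\<lambda>x. (0, \<phi> (fst x), 0)) (\<lambda>x :: 'a \<times> 'b \<times> 'b. x)"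

section \<open>Additivity of the column insertion, and its effect on the degree\<close>

lemma ins_column_cong:
  "(\<And>l. length l = Suc (length xs) \<Longrightarrow> F l = G l) \<Longrightarrow> ins_column xs F = ins_column xs G"
proof (induction xs arbitrary: F G)
  case (Cons x xs)
  have "ins_column xs (\<lambda>l. F (y # l)) = ins_column xs (\<lambda>l. G (y # l))" for y
    by (rule Cons.IH) (simp add: Cons.prems)
  moreover have "ins_phi xs (\<lambda>l. F (y # l)) = ins_phi xs (\<lambda>l. G (y # l))" for y
    by (rule ins_cong) (simp add: Cons.prems)
  ultimately show ?case by (simp add: Cons.prems)
qed simp

lemma ins_column_add: "ins_column xs (\<lambda>l. F l + G l) = ins_column xs F + ins_column xs G"
  by (induction xs arbitrary: F G) (simp_all add: ins_add)

lemma ins_column_zero: "ins_column xs (\<lambda>_. 0) = 0"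
  by (induction xs) (simp_all add: ins_zero)

lemma ins_column_uminus: "ins_column xs (\<lambda>l. - F l) = - ins_column xs F"
  by (induction xs arbitrary: F) (simp_all add: ins_uminus)

lemma ins_column_diff: "ins_column xs (\<lambda>l. F l - G l) = ins_column xs F - ins_column xs G"
  by (induction xs arbitrary: F G) (simp_all add: ins_diff)

lemma ins_column_comp:
  "lin (mscale N) (mscale N) \<theta> \<Longrightarrow> \<theta> (ins_column xs F) = ins_column xs (\<lambda>l. \<theta> (F l))"
  by (induction xs arbitrary: F) (simp_all add: ins_comp lin_simps)

lemma ins_phi_cochains: "F \<in> cochains R NRA (Suc n) \<Longrightarrow> (\<lambda>xs. ins_phi xs F) \<in> cochains R NRA n"
  by (rule ins_cochains[OF vs_R vs_R NRA.vs_M lin_R(11) lin_ident refl])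

lemma ins_column_cochains: "F \<in> cochains R NRA (Suc n) \<Longrightarrow> (\<lambda>xs. ins_column xs F) \<in> cochains R NRA n"
proof (induction n arbitrary: F)
  case 0
  have "ins_column (x # xs) F = ins_column (x # xs) (\<lambda>_. 0)" for x xs
    by (rule ins_column_cong) (simp add: cochains_length[OF 0])
  then show ?case by (simp only: cochains_0 neq_Nil_conv ins_column_zero) blast
next
  case (Suc n)
  note S = Suc.prems[unfolded cochains_Suc[OF vs_R NRA.vs_M, of _ "Suc n"]]
  have lin1: "lin (ascale R) (mscale NRA) (\<lambda>a. F (a # as))" for as using S by blast
  have c1: "(\<lambda>l. F (x # l)) \<in> cochains R NRA (Suc n)" for x using S by blast
  have c2: "(\<lambda>l. F (v # y # l)) \<in> cochains R NRA n" for v y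
    using c1[of v] unfolding cochains_Suc[OF vs_R NRA.vs_M] by blast
  have lin2: "lin (ascale R) (mscale NRA) (\<lambda>a. F (v # a # as))" for v as
    using c1[of v] unfolding cochains_Suc[OF vs_R NRA.vs_M] by blast
  have add: "F ((x + y) # l) = F (x # l) + F (y # l)" and scale: "F (ascale R c x # l) = mscale N c (F (x # l))" for x y c l
    using lin_simps[OF lin1] by simp_all
  have lp1: "lin (ascale R) (mscale NRA) (\<lambda>a. ins_column as (\<lambda>l. F (a # l)))" for as
    by (rule linI) (simp_all only: add scale ins_column_add bipull_simps
        ins_column_comp[OF lin_scaled[OF N.vs_M lin_ident]])
  have lp2: "lin (ascale R) (mscale NRA) (\<lambda>a. ins_phi as (\<lambda>l. F (a # l)))" for as
    by (rule linI) (simp_all only: add scale ins_add bipull_simps ins_comp[OF lin_scaled[OF N.vs_M lin_ident]])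
  have "ins_column [] F = 0" by (simp add: cochains_length[OF Suc.prems])
  moreover have "(\<lambda>l. ins_column (x # l) F) \<in> cochains R NRA n" for x
    unfolding ins_column.simps by (intro cochains_diff c2 Suc.IH ins_phi_cochains c1)
  moreover have "lin (ascale R) (mscale NRA) (\<lambda>a. ins_column (a # as) F)" for as
    unfolding ins_column.simps
    by (intro lin_sub NRA.vs_M lin2 lin_comp[OF lin_R(9) lp1] lin_comp[OF lin_R(10) lp2])
  ultimately show ?case by (simp add: cochains_Suc[OF vs_R NRA.vs_M])
qed

lemma ins_phi_hoch_tail: "ins_phi xs (hoch_tail R NRA F) + hoch_tail R NRA (\<lambda>l. ins_phi l F) xs = 0"
proof -
  have "ins_phi xs (hoch_tail R NRA F) + hoch_tail R (bipull (\<lambda>x. (0, \<phi> (fst x), 0)) (\<lambda>x. x) NRA) (\<lambda>l. ins_phi l F) xs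
    = - ract NRA (F (map (\<lambda>x. (0, \<phi> (fst x), 0)) xs)) (0, 0, aone B)"
    by (rule NRA.ins_hoch_tail) (simp_all add: prod_eq_iff)
  moreover have "hoch_tail R (bipull (\<lambda>x. (0, \<phi> (fst x), 0)) (\<lambda>x. x) NRA) (\<lambda>l. ins_phi l F) xs
     = hoch_tail R NRA (\<lambda>l. ins_phi l F) xs"
    by (rule hoch_tail_comp) simp_all
  ultimately show ?thesis by simp
qed

text \<open>The telescoping is that of a single inserted element, but the arguments before the
  column are matrices, so products split into a diagonal and a corner part. No right action term
  survives: both entries of the column have A-component zero, and \<open>NRA\<close> acts on the
  right through \<open>\<phi>(a)\<close>.\<close>

lemma ins_column_hoch_tail:
  assumes "multilin R NRA F"
  shows "ins_column xs (hoch_tail R NRA F) + hoch_tail R NRA (\<lambda>l. ins_column l F) xs = 0"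
  using assms
proof (induction xs arbitrary: F rule: induct_list012)
  case 1
  then show ?case by simp
next
  case (2 x)
  note lin1 = lin_add[OF multilin_head[OF "2.prems"]]
  have "amult R (0, aone B, 0) x = amult R (0, mid x, 0) (0, aone B, 0) + amult R (0, thd x, 0) (0, 0, aone B)"
    by (simp add: prod_eq_iff)
  then show ?case by (simp add: lin1)
next
  case (3 x y zs)
  let ?eb = "(0, aone B, 0) :: 'a \<times> 'b \<times> 'b" and ?eta = "(0, 0, aone B) :: 'a \<times> 'b \<times> 'b"
  let ?b = "\<lambda>x :: 'a \<times> 'b \<times> 'b. (0, mid x, 0) :: 'a \<times> 'b \<times> 'b" and ?c = "\<lambda>x :: 'a \<times> 'b \<times> 'b. (0, thd x, 0) :: 'a \<times> 'b \<times> 'b"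
  note lin1 = lin_add[OF multilin_head[OF "3.prems"]]
  \<comment> \<open>The first row of the intertwining relation:
    \<open>1\<^sub>B x = b\<^sub>1 1\<^sub>B + b\<^sub>2 (1\<phi>)\<close>.\<close>
  have e: "amult R ?eb x = amult R (?b x) ?eb + amult R (?c x) ?eta"
    by (simp add: prod_eq_iff)
  have b: "?b (amult R x y) = amult R (?b x) (?b y)"
    and c: "?c (amult R x y) = amult R (?b x) (?c y) + amult R (?c x) (0, \<phi> (fst y), 0)"
    by (simp_all add: prod_eq_iff)
  have cur: "hoch_tail R NRA F (u # l) = - (case l of [] \<Rightarrow> 0 | y # zs \<Rightarrow> F (amult R u y # zs)) - hoch_tail R NRA (\<lambda>l. F (u # l)) l"
    if "length l = Suc (length (y # zs))" for u l
    using that by (auto simp: length_Suc_conv)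
  have 1: "ins_column (y # zs) (\<lambda>l. hoch_tail R NRA F (u # l)) =
      - ins_column (y # zs) (\<lambda>l. case l of [] \<Rightarrow> 0 | y # zs \<Rightarrow> F (amult R u y # zs))
      - ins_column (y # zs) (hoch_tail R NRA (\<lambda>l. F (u # l)))" for u
    using ins_column_cong[OF cur] by (simp only: ins_column_diff ins_column_uminus)
  have 2: "ins_phi (y # zs) (\<lambda>l. hoch_tail R NRA F (u # l)) =
      - ins_phi (y # zs) (\<lambda>l. case l of [] \<Rightarrow> 0 | y # zs \<Rightarrow> F (amult R u y # zs))
      - ins_phi (y # zs) (hoch_tail R NRA (\<lambda>l. F (u # l)))" for u
    using ins_cong[OF cur] by (simp only: ins_diff ins_uminus)
  have 3: "hoch_tail R NRA (\<lambda>l. ins_column (x # l) F) (y # zs) =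
      hoch_tail R NRA (\<lambda>l. F (?eb # x # l)) (y # zs) - hoch_tail R NRA (\<lambda>l. ins_column l (\<lambda>l. F (?b x # l))) (y # zs)
      - hoch_tail R NRA (\<lambda>l. ins_phi l (\<lambda>l. F (?c x # l))) (y # zs)"
    by (simp only: ins_column.simps NRA.hoch_tail_diff)
  have "ins_column (x # y # zs) (hoch_tail R NRA F) + hoch_tail R NRA (\<lambda>l. ins_column l F) (x # y # zs)
     = hoch_tail R NRA F (?eb # x # y # zs) - ins_column (y # zs) (\<lambda>l. hoch_tail R NRA F (?b x # l))
        - ins_phi (y # zs) (\<lambda>l. hoch_tail R NRA F (?c x # l))
       + (- ins_column (amult R x y # zs) F - hoch_tail R NRA (\<lambda>l. ins_column (x # l) F) (y # zs))"
    by (simp only: hoch_tail.simps(3) ins_column.simps(2)[of x "y # zs"])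
  also have "\<dots> = 0"
    unfolding 1 2 3
    using "3.IH"(2)[OF multilin_Cons[OF "3.prems"], of "?b x"] ins_phi_hoch_tail[of "y # zs" "\<lambda>l. F (?c x # l)"]
    unfolding ins_column.simps(2)[of "amult R x y"] b c
    by (simp add: lin1 e ins_add ins_column_add algebra_simps del: mapping_ring_simps)
  finally show ?case .
qed

text \<open>The first argument acts on the column by its matrix: the diagonal entry
  \<open>b\<^sub>1\<close> is the left action of \<open>NRA\<close>, the corner entry
  \<open>b\<^sub>2\<close> meets the second entry \<open>ins_phi\<close> and leaves the
  \<open>cup\<close>.\<close>

lemma ins_column_hoch:
  assumes "multilin R NRA F"
  shows "ins_column xs (hoch R NRA F) + hoch R NRA (\<lambda>l. ins_column l F) xs
    = lact N (aone B) (F xs) - cup N (\<lambda>l. ins_phi l F) xs"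
proof (cases xs)
  case Nil
  then show ?thesis by simp
next
  case (Cons x ys)
  let ?L = "\<lambda>l. case l of [] \<Rightarrow> 0 | x # xs \<Rightarrow> lact NRA x (F xs)"
  have "hoch R NRA F = (\<lambda>l. ?L l + hoch_tail R NRA F l)"
    by (rule ext) (simp add: hoch_def split: list.splits)
  then have "ins_column xs (hoch R NRA F) = ins_column xs ?L + ins_column xs (hoch_tail R NRA F)"
    by (simp only: ins_column_add)
  moreover have "ins_column xs ?L = lact N (aone B) (F xs) - lact N (mid x) (ins_column ys F) - lact N (thd x) (ins_phi ys F)"
    using ins_comp[OF N.lin_lact_mod, symmetric] ins_column_comp[OF N.lin_lact_mod, symmetric] by (simp add: Cons)
  ultimately show ?thesis
    using ins_column_hoch_tail[OF assms, of xs] by (simp add: Cons algebra_simps del: ins_column.simps ins.simps)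
qed

text \<open>The column homotopy replaces E by the \<open>cup\<close> with its second entry k. This k
  is a cocycle when R acts through \<open>\<phi>(a)\<close> on both sides, and inserting
  \<open>1\<^sub>A\<close> makes it depend on a alone; the error is a coboundary because
  \<open>cup\<close> anticommutes with the differentials.\<close>

lemma corner_cocycle:
  assumes E: "E \<in> cochains R NRA (Suc n)" and d: "hoch R NRA E = (\<lambda>_. 0)"
    and u: "\<And>xs. lact N (aone B) (E xs) = E xs" "\<And>xs. ract N (E xs) (aone B) = E xs"
  shows "\<exists>h\<in>cochains A (bipull \<phi> \<phi> N) n. hoch A (bipull \<phi> \<phi> N) h = (\<lambda>_. 0) \<and>
    (\<exists>G\<in>cochains R NRA n. \<forall>xs. E xs - cup N (\<lambda>l. h (map fst l)) xs = hoch R NRA G xs)"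
proof -
  let ?NA = "bipull (\<lambda>x :: 'a \<times> 'b \<times> 'b. \<phi> (fst x)) (\<lambda>x. \<phi> (fst x)) N"
  let ?ea = "(aone A, 0, 0) :: 'a \<times> 'b \<times> 'b" and ?pa = "\<lambda>x. (fst x, 0, 0) :: 'a \<times> 'b \<times> 'b"
  define k where "k xs = ins_phi xs E" for xs
  define L where "L xs = ins ?ea ?pa (\<lambda>x. x) xs k" for xs
  define h where "h as = k (map (\<lambda>a. (a, 0, 0)) as)" for as
  have kC: "k \<in> cochains R NRA n" unfolding k_def[abs_def] by (rule ins_phi_cochains[OF E])
  have ku: "lact N (aone B) (k xs) = k xs" "ract N (k xs) (aone B) = k xs" for xs
    unfolding k_def ins_comp[OF N.lin_lact_mod] ins_comp[OF N.lin_ract_mod] u by (rule refl)+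
  \<comment> \<open>\<open>1\<phi>\<close> acts by zero on both sides of \<open>NRA\<close>, having
    zero a and \<open>b\<^sub>1\<close>; both ends of the homotopy vanish and k is a
    cocycle.\<close>
  have "ins_phi xs (hoch R NRA E) + hoch R (bipull (\<lambda>x. (0, \<phi> (fst x), 0)) (\<lambda>x. x) NRA) (\<lambda>l. ins_phi l E) xs
    = lact NRA (0, 0, aone B) (E (map (\<lambda>x. x) xs)) - ract NRA (E (map (\<lambda>x. (0, \<phi> (fst x), 0)) xs)) (0, 0, aone B)" for xs
    by (rule NRA.ins_hoch) (simp_all add: prod_eq_iff)
  then have kd: "hoch R ?NA k xs = 0" for xs
    by (simp add: d ins_zero bipull_bipull k_def[abs_def])
  then have kd': "hoch R ?NA k = (\<lambda>_. 0)" by (rule ext)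
  have "ins ?ea ?pa (\<lambda>x. x) xs (hoch R ?NA k) + hoch R (bipull ?pa (\<lambda>x. x) ?NA) (\<lambda>l. ins ?ea ?pa (\<lambda>x. x) l k) xs
     = lact ?NA ?ea (k (map (\<lambda>x. x) xs)) - ract ?NA (k (map ?pa xs)) ?ea" for xs
    by (rule NAR.ins_hoch) (simp_all add: prod_eq_iff)
  then have kL: "k xs = h (map fst xs) + hoch R ?NA L xs" for xs
    by (simp add: kd' ins_zero bipull_bipull L_def[abs_def] ku h_def o_def)
  have hC: "h \<in> cochains A (bipull \<phi> \<phi> N) n"
    unfolding h_def[abs_def] by (rule cochains_map[OF kC lin_R(5) M.vs_A]) simp
  have "hoch A (bipull \<phi> \<phi> N) h as = hoch R ?NA k (map (\<lambda>a. (a, 0, 0)) as)" for as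
    unfolding h_def[abs_def] by (rule hoch_map_args) (simp_all add: prod_eq_iff)
  then have hd: "hoch A (bipull \<phi> \<phi> N) h = (\<lambda>_. 0)" by (simp add: kd fun_eq_iff)
  have LC: "cup N L \<in> cochains R NRA n"
  proof (cases n)
    case 0
    then have "L = (\<lambda>_. 0)" using kC by (simp add: L_def[abs_def] ins_cochains_0)
    then have "cup N L = (\<lambda>_. 0)" by (auto simp: cup_def fun_eq_iff split: list.splits)
    then show ?thesis by (simp add: cochains_zero' vs_R N.vs_M)
  next
    case (Suc m)
    then have "L \<in> cochains R NRA m" using kC unfolding L_def[abs_def]
      by (simp add: ins_cochains[OF vs_R vs_R NRA.vs_M lin_R(8) lin_ident refl])
    then show ?thesis unfolding Suc by (rule cup_cochains)
  qed
  \<comment> \<open>\<open>E - cup k\<close> is the differential of the column insertion, and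
    \<open>cup k - cup h = cup (dL) = - d (cup L)\<close>.\<close>
  define G where "G xs = ins_column xs E - cup N L xs" for xs
  have "G \<in> cochains R NRA n"
    unfolding G_def[abs_def] by (intro cochains_diff ins_column_cochains E LC)
  moreover have "E xs - cup N (\<lambda>l. h (map fst l)) xs = hoch R NRA G xs" for xs
  proof -
    have "cup N k xs = cup N (\<lambda>l. h (map fst l)) xs + cup N (hoch R ?NA L) xs"
      unfolding cup_add[symmetric] kL[symmetric] ..
    then show ?thesis
      using ins_column_hoch[OF cochains_multilin[OF E NRA.vs_M], of xs] hoch_cup[of L xs]
      unfolding k_def[abs_def] G_def[abs_def]
      by (simp add: d ins_column_zero u NRA.hoch_diff)
  qed
  ultimately show ?thesis using hC hd by blast
qed

section \<open>Surjectivity on cohomology in positive degrees\<close>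

lemma unital_values_sandwich:
  "unital_values (\<lambda>l. lact W (aone R) (ract W (F l) (aone R)))"
  by (simp add: unital_values_def M.lact_mult[symmetric] N.lact_mult[symmetric] M.ract_mult[symmetric]
      N.ract_mult[symmetric] M.lact_ract N.lact_ract)

lemma sandwich_cochains:
  "F \<in> cochains R W n \<Longrightarrow> (\<lambda>l. lact W (aone R) (ract W (F l) (aone R))) \<in> cochains R W n"
  by (intro cochains_comp[OF _ W.lin_lact_mod] cochains_comp[OF _ W.lin_ract_mod] vs_W)

text \<open>\<open>w \<mapsto> 1 w 1\<close> is a bimodule endomorphism even when it is not the
  identity, since the acting element absorbs the unit next to it.\<close>

lemma hoch_sandwich:
  "hoch R W (\<lambda>l. lact W (aone R) (ract W (F l) (aone R))) xs = lact W (aone R) (ract W (hoch R W F xs) (aone R))"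
proof (rule hoch_comp[of "\<lambda>w. lact W (aone R) (ract W w (aone R))", symmetric])
  show "lact W (aone R) (ract W (x + y) (aone R)) = lact W (aone R) (ract W x (aone R)) + lact W (aone R) (ract W y (aone R))" for x y
    by (simp only: W.act_simps)
  show "lact W (aone R) (ract W (ract W m x) (aone R)) = ract W (lact W (aone R) (ract W m (aone R))) x" for m x
    by (simp only: W.lact_ract W.ract_mult[symmetric] R.mult_one_left R.mult_one_right)
  show "lact W (aone R) (ract W (lact W x m) (aone R)) = lact W x (lact W (aone R) (ract W m (aone R)))" for m x
    by (simp only: W.lact_ract W.lact_mult[symmetric] R.mult_one_left R.mult_one_right)
qed

text \<open>Once the values are unital, \<open>rho\<close> yields a cocycle x whose image has the
  same restrictions to A and to B, so the difference is a corner cocycle up to a coboundary. A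
  corner cocycle comes from a cocycle y with only a third component, and \<open>x + y\<close>
  represents the preimage.\<close>

lemma tau_surj:
  assumes F: "F \<in> cochains R W (Suc n)" and d: "hoch R W F = 0"
  shows "\<exists>x\<in>C (Suc n). delta x = 0 \<and> (\<exists>G\<in>cochains R W n. F - tau \<phi> N x = hoch R W G)"
proof -
  let ?u = "\<lambda>F l. lact W (aone R) (ract W (F l) (aone R))"
  have d': "hoch R W F = (\<lambda>_. 0)" using d by (simp add: fun_eq_iff)
  obtain G0 where G0: "G0 \<in> cochains R W n" "\<And>xs. F xs - ?u F xs = hoch R W G0 xs"
    using W.cocycle_unital[OF F d'] by blast
  define F1 where "F1 = ?u F"
  have F1: "F1 \<in> cochains R W (Suc n)" "unital_values F1"
    unfolding F1_def by (rule sandwich_cochains[OF F], rule unital_values_sandwich)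
  have dF1: "hoch R W F1 xs = 0" for xs
    unfolding F1_def hoch_sandwich d' by (simp only: W.act_simps)
  define x where "x = rho F1"
  have x: "x \<in> C (Suc n)" unfolding x_def by (rule rho_cochains[OF F1(1)])
  have "delta x = rho (hoch R W F1)" unfolding x_def by (rule rho_hoch[OF F1(2), symmetric])
  also have "hoch R W F1 = (\<lambda>_. 0)" using dF1 by (rule ext)
  also have "rho (\<lambda>_. 0) = 0" by (simp add: rho_def ins_zero prod_eq_iff fun_eq_iff)
  finally have dx: "delta x = 0" .
  define F2 where "F2 xs = F1 xs - tau \<phi> N x xs" for xs
  have F2: "F2 \<in> cochains R W (Suc n)" unfolding F2_def[abs_def] by (intro cochains_diff F1 tau_cochains x)
  have tau0: "tau \<phi> N (0 :: ('a, 'b, 'm, 'n) phi_cochain) xs = 0" for xs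
    using cup_zero[of xs] spread_zero[of xs] by (simp add: prod_eq_iff zero_fun_def)
  have dF2: "hoch R W F2 = (\<lambda>_. 0)"
    unfolding F2_def[abs_def] by (simp add: fun_eq_iff W.hoch_diff dF1 hoch_tau_C[OF x] dx tau0)
  have u2: "unital_values F2"
    using F1(2) unfolding unital_values_def F2_def x_def
    by (simp add: rho_simps)
  \<comment> \<open>\<open>rho\<close> and \<open>tau\<close> leave the restrictions to A and to B
    unchanged, so these cancel in F2.\<close>
  have "\<exists>G\<in>cochains R W n. \<exists>E\<in>cochains R NRA (Suc n). \<forall>xs. F2 xs - hoch R W G xs = (0, 0, E xs)"
    by (rule kill_diagonal[OF F2 dF2 u2]) (simp_all add: F2_def x_def rho_simps o_def)
  then obtain G E where G: "G \<in> cochains R W n" and E: "E \<in> cochains R NRA (Suc n)"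
    and GE: "\<And>xs. F2 xs - hoch R W G xs = (0, 0, E xs)" by blast
  have "hoch R W (\<lambda>xs. F2 xs - hoch R W G xs) xs = 0" for xs
    by (simp add: W.hoch_diff dF2 W.hoch_hoch)
  then have dE: "hoch R W (\<lambda>xs. (0, 0, E xs)) = (\<lambda>_. 0)"
    unfolding GE by (rule ext)
  \<comment> \<open>\<open>kill_diagonal\<close> gives no control over the units on the third
    component, so the corner is sandwiched once more.\<close>
  obtain G' where G': "G' \<in> cochains R W n" "\<And>xs. (0, 0, E xs) - ?u (\<lambda>xs. (0, 0, E xs)) xs = hoch R W G' xs"
    using W.cocycle_unital[OF cochains_corner[OF E] dE] by blast
  define E' where "E' xs = lact N (aone B) (ract N (E xs) (aone B))" for xs
  have uE: "?u (\<lambda>xs. (0, 0, E xs)) = (\<lambda>xs. (0, 0, E' xs))"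
    by (rule ext) (simp add: E'_def prod_eq_iff)
  have "(\<lambda>xs. (0, 0, E' xs)) \<in> cochains R W (Suc n)"
    unfolding uE[symmetric] by (rule sandwich_cochains[OF cochains_corner[OF E]])
  then have E': "E' \<in> cochains R NRA (Suc n)" by (simp add: cochains_W)
  have "hoch R W (\<lambda>xs. (0, 0, E' xs)) xs = 0" for xs
    unfolding uE[symmetric] hoch_sandwich dE by (simp only: W.act_simps)
  then have "hoch R NRA E' = (\<lambda>_. 0)" by (simp add: hoch_corner prod_eq_iff fun_eq_iff)
  then obtain h H where h: "h \<in> cochains A (bipull \<phi> \<phi> N) n" "hoch A (bipull \<phi> \<phi> N) h = (\<lambda>_. 0)"
    and H: "H \<in> cochains R NRA n" "\<And>xs. E' xs - cup N (\<lambda>l. h (map fst l)) xs = hoch R NRA H xs"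
    using corner_cocycle[OF E'] by (auto simp: E'_def N.lact_mult[symmetric] N.ract_mult[symmetric] N.lact_ract)
  define y where "y = (0 :: 'a list \<Rightarrow> 'm, 0 :: 'b list \<Rightarrow> 'n, h)"
  have y: "y \<in> C (Suc n)" by (simp add: mem_C y_def h cochains_zero M.vs_A N.vs_A M.vs_M N.vs_M)
  have dy: "delta y = 0"
    using M.hoch_zero N.hoch_zero by (simp add: delta_def y_def h prod_eq_iff fun_eq_iff zero_fun_def)
  have tau_y: "tau \<phi> N y xs = (0, 0, cup N (\<lambda>l. h (map fst l)) xs)" for xs
    using spread_zero[of xs] by (simp add: tau_def y_def zero_fun_def)
  define K where "K l = G0 l + G l + G' l + (0, 0, H l)" for l
  have "K \<in> cochains R W n"
    unfolding K_def[abs_def] by (intro cochains_add G0 G G' cochains_corner H)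
  moreover have "F - tau \<phi> N (x + y) = hoch R W K"
  proof
    fix xs
    have 1: "F xs = F1 xs + hoch R W G0 xs" using G0(2)[of xs] by (simp only: F1_def diff_eq_eq add.commute)
    have 2: "F1 xs = F2 xs + tau \<phi> N x xs" by (simp add: F2_def)
    have 3: "F2 xs = (0, 0, E xs) + hoch R W G xs" using GE[of xs] by (simp only: diff_eq_eq)
    have 4: "(0, 0, E xs) = (0, 0, E' xs) + hoch R W G' xs"
      using G'(2)[of xs] fun_cong[OF uE, of xs] by (simp only: diff_eq_eq add.commute)
    have "(0, 0, E' xs) - tau \<phi> N y xs = hoch R W (\<lambda>l. (0, 0, H l)) xs"
      by (simp add: tau_y hoch_corner H(2) prod_eq_iff)
    then have 5: "(0, 0, E' xs) = hoch R W (\<lambda>l. (0, 0, H l)) xs + tau \<phi> N y xs"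
      by (simp only: diff_eq_eq)
    have "hoch R W K xs = hoch R W G0 xs + hoch R W G xs + hoch R W G' xs + hoch R W (\<lambda>l. (0, 0, H l)) xs"
      unfolding K_def[abs_def] W.hoch_add ..
    also have "\<dots> = F xs - tau \<phi> N x xs - tau \<phi> N y xs"
      unfolding 1 2 3 4 5 by simp
    finally show "(F - tau \<phi> N (x + y)) xs = hoch R W K xs"
      by (simp add: tau_add)
  qed
  ultimately show ?thesis
    using C_add[OF x y] by (intro bexI[of _ "x + y"] conjI bexI[of _ K]) (simp_all add: delta_add dx dy)
qed

text \<open>\<open>rho_tau\<close> asks for a third component that the unit fixes, so a cocycle has
  to be normalised before injectivity can be read off.\<close>

lemma unital_reduction:
  assumes x: "x \<in> C (Suc n)" and d: "delta x = 0"
  shows "\<exists>y\<in>C n. \<exists>h. \<forall>as bs. fst (x - delta y) as = lact M (aone A) (ract M (fst x as) (aone A)) \<and>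
    mid (x - delta y) bs = lact N (aone B) (ract N (mid x bs) (aone B)) \<and>
    thd (x - delta y) as = lact N (aone B) (ract N (h as) (aone B))"
proof -
  let ?NA = "bipull \<phi> \<phi> N" and ?u = "\<lambda>n. lact N (aone B) (ract N n (aone B))"
  have xC: "fst x \<in> cochains A M (Suc n)" "mid x \<in> cochains B N (Suc n)" "thd x \<in> cochains A ?NA n"
    using x by (simp_all add: mem_C)
  have "hoch A M (fst x) = (\<lambda>_. 0)" "hoch B N (mid x) = (\<lambda>_. 0)"
    using arg_cong[OF d, of fst] arg_cong[OF d, of "\<lambda>x. mid x"] by (simp_all add: zero_fun_def)
  then obtain f g where f: "f \<in> cochains A M n" "\<And>as. fst x as - lact M (aone A) (ract M (fst x as) (aone A)) = hoch A M f as"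
    and g: "g \<in> cochains B N n" "\<And>bs. mid x bs - ?u (mid x bs) = hoch B N g bs"
    using M.cocycle_unital[OF xC(1)] N.cocycle_unital[OF xC(2)] by blast
  define h where "h as = thd x as - (\<psi> (f as) - g (map \<phi> as))" for as
  define k where "k as = h as - ?u (h as)" for as
  have hC: "h \<in> cochains A ?NA n"
    unfolding h_def[abs_def] by (intro cochains_diff xC cochains_hom f cochains_phi g)
  have kC: "k \<in> cochains A ?NA n"
    unfolding k_def[abs_def]
    by (intro cochains_diff hC cochains_comp[OF hC] lin_comp[OF N.lin_ract_mod N.lin_lact_mod, folded bipull_simps(1)[of \<phi> \<phi> N]] NA.vs_M)
  \<comment> \<open>The differential of h consists of sandwiched values, so the part k that the
    sandwich removes is closed.\<close>
  have dh: "hoch A ?NA h as = \<psi> (lact M (aone A) (ract M (fst x as) (aone A))) - ?u (mid x (map \<phi> as))" for as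
  proof -
    have "hoch A ?NA (\<lambda>as. \<psi> (f as)) as = \<psi> (hoch A M f as)"
      by (rule hoch_comp[symmetric]) simp_all
    moreover have "hoch A ?NA (\<lambda>as. g (map \<phi> as)) as = hoch B N g (map \<phi> as)"
      by (rule hoch_map_args) simp_all
    moreover have "hoch A ?NA (thd x) as = \<psi> (fst x as) - mid x (map \<phi> as)"
      using delta_simps(3)[of x as] by (simp add: d)
    ultimately show ?thesis
      unfolding h_def[abs_def] by (simp add: NA.hoch_diff f(2)[symmetric] g(2)[symmetric])
  qed
  have "hoch A ?NA (\<lambda>as. ?u (h as)) as = ?u (hoch A ?NA h as)" for as
    by (rule hoch_comp[symmetric])
      (simp_all add: N.lact_ract N.lact_mult[symmetric] N.ract_mult[symmetric])
  then have dk: "hoch A ?NA k = (\<lambda>_. 0)"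
    unfolding k_def[abs_def]
    by (simp add: fun_eq_iff NA.hoch_diff dh N.lact_ract N.lact_mult[symmetric] N.ract_mult[symmetric])
  have ku: "?u (k as) = 0" for as
    by (simp add: k_def N.lact_ract N.lact_mult[symmetric] N.ract_mult[symmetric])
  have "\<exists>p\<in>cochains B N n. \<exists>q. (if n = 0 then q = 0 else q \<in> cochains A ?NA (n - 1)) \<and>
     hoch B N p = 0 \<and> (\<forall>as. k as = hoch A ?NA q as + p (map \<phi> as))"
  proof (cases n)
    case (Suc m)
    then obtain q where "q \<in> cochains A ?NA m" "\<And>as. k as = hoch A ?NA q as"
      using NA.cocycle_unital[of k m] kC dk ku by auto
    then show ?thesis
      using Suc N.hoch_zero cochains_zero'[OF N.vs_A N.vs_M]
      by (intro bexI[of _ "\<lambda>_. 0"] exI[of _ q]) (auto simp: zero_fun_def)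
  next
    case 0
    \<comment> \<open>In degree 0 the third component has no coboundaries from A, but c is killed by
      B on both sides, since \<open>1 c = c 1\<close> and \<open>1 c 1 = 0\<close>. So c is also a
      degree 0 cocycle of B, and correcting g by it removes k.\<close>
    define c where "c = k []"
    have ac: "lact N (\<phi> a) c = ract N c (\<phi> a)" for a
      using fun_cong[OF dk, of "[a]"] by (simp add: c_def)
    have "lact N (aone B) (ract N c (aone B)) = 0" using ku[of "[]"] by (simp add: c_def)
    then have 1: "lact N (aone B) c = 0" "ract N c (aone B) = 0"
      using ac[of "aone A"] by (simp_all add: N.ract_mult[symmetric] N.lact_mult[symmetric] flip: N.lact_ract)
    have c0: "lact N b c = 0" "ract N c b = 0" for b
      using N.lact_mult[of b "aone B" c] N.ract_mult[of c "aone B" b] 1 by simp_all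
    define p where "p bs = (if bs = [] then c else 0)" for bs :: "'b list"
    have p: "p \<in> cochains B N 0" by (simp add: cochains_0 p_def)
    have "hoch B N p bs = 0" for bs
    proof (cases "length bs = 1")
      case True
      then show ?thesis using c0 by (auto simp: p_def length_Suc_conv)
    next
      case False
      then show ?thesis using cochains_length[OF N.hoch_cochains[OF p]] by simp
    qed
    moreover have "k as = p (map \<phi> as)" for as
      using kC 0 by (simp add: p_def c_def cochains_0)
    ultimately show ?thesis
      using p 0 NA.hoch_zero by (intro bexI[of _ p] exI[of _ 0]) (auto simp: zero_fun_def fun_eq_iff)
  qed
  then obtain p q where p: "p \<in> cochains B N n" "hoch B N p = 0"
    and q: "if n = 0 then q = 0 else q \<in> cochains A ?NA (n - 1)"
    and kpq: "\<And>as. k as = hoch A ?NA q as + p (map \<phi> as)" by blast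
  \<comment> \<open>The second and third components enter the third component of
    \<open>delta\<close> with a minus sign, hence the signs of p and q.\<close>
  define y where "y = (f, \<lambda>bs. g bs - p bs, \<lambda>as. - q as)"
  have "y \<in> C n"
    using q by (auto simp: y_def mem_C f cochains_diff g p zero_fun_def intro: cochains_uminus)
  moreover have "thd (x - delta y) as = ?u (h as)" for as
  proof -
    have "thd (x - delta y) as = h as - k as"
      by (simp add: y_def delta_def h_def kpq NA.hoch_uminus algebra_simps)
    then show ?thesis by (simp add: k_def)
  qed
  moreover have "fst (x - delta y) as = lact M (aone A) (ract M (fst x as) (aone A))" for as
    by (simp add: y_def delta_def f(2)[symmetric])
  moreover have "mid (x - delta y) bs = ?u (mid x bs)" for bs
    using p(2) by (simp add: y_def delta_def N.hoch_diff g(2)[symmetric])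
  ultimately show ?thesis by blast
qed

text \<open>For the normalised \<open>z = x - delta y\<close>, \<open>tau z\<close> is the
  differential of a cochain \<open>G'\<close> with unital values, and
  \<open>z = rho (tau z) = rho (d G') = delta (rho G')\<close>.\<close>

lemma tau_inj:
  assumes x: "x \<in> C (Suc n)" and d: "delta x = 0" and G: "G \<in> cochains R W n" "tau \<phi> N x = hoch R W G"
  shows "\<exists>y\<in>C n. x = delta y"
proof -
  let ?u = "\<lambda>F l. lact W (aone R) (ract W (F l) (aone R))"
  obtain y h where y: "y \<in> C n"
    and e: "\<And>as. fst (x - delta y) as = lact M (aone A) (ract M (fst x as) (aone A))"
      "\<And>bs. mid (x - delta y) bs = lact N (aone B) (ract N (mid x bs) (aone B))"
      "\<And>as. thd (x - delta y) as = lact N (aone B) (ract N (h as) (aone B))"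
    using unital_reduction[OF x d] by blast
  define z where "z = x - delta y"
  note e = e[folded z_def]
  have zC: "z \<in> C (Suc n)" unfolding z_def by (intro C_diff x delta_cochains y)
  have u: "lact M (aone A) (fst z as) = fst z as" "ract M (fst z as) (aone A) = fst z as"
    "lact N (aone B) (mid z bs) = mid z bs" "ract N (mid z bs) (aone B) = mid z bs"
    "lact N (aone B) (thd z as) = thd z as" "ract N (thd z as) (aone B) = thd z as" for as bs
    unfolding e by (simp_all add: M.lact_ract M.lact_mult[symmetric] M.ract_mult[symmetric]
        N.lact_ract N.lact_mult[symmetric] N.ract_mult[symmetric])
  define G' where "G' = ?u (\<lambda>l. G l - tau \<phi> N y l)"
  have G': "G' \<in> cochains R W n"
    unfolding G'_def by (intro sandwich_cochains cochains_diff G tau_cochains y)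
  have "lact N (aone B) (spread \<phi> xs (mid z)) = spread \<phi> xs (mid z)"
    "ract N (spread \<phi> xs (mid z)) (aone B) = spread \<phi> xs (mid z)" for xs
    unfolding spread_comp[OF N.lin_lact_mod] spread_comp[OF N.lin_ract_mod] u by (rule refl)+
  moreover have "lact N (aone B) (cup N (\<lambda>l. thd z (map fst l)) xs) = cup N (\<lambda>l. thd z (map fst l)) xs"
    "ract N (cup N (\<lambda>l. thd z (map fst l)) xs) (aone B) = cup N (\<lambda>l. thd z (map fst l)) xs" for xs
    by (cases xs; simp add: N.lact_mult[symmetric] N.lact_ract u)+
  ultimately have "?u (tau \<phi> N z) = tau \<phi> N z"
    by (intro ext) (simp add: prod_eq_iff u)
  moreover have "hoch R W (\<lambda>l. G l - tau \<phi> N y l) = tau \<phi> N z"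
    using G(2) by (simp add: fun_eq_iff W.hoch_diff hoch_tau_C[OF y] z_def tau_diff)
  ultimately have "hoch R W G' = tau \<phi> N z"
    unfolding G'_def by (intro ext) (metis (no_types) hoch_sandwich)
  moreover have "z = rho (tau \<phi> N z)" by (rule rho_tau[OF zC, symmetric]) (rule u)
  moreover have "rho (hoch R W G') = delta (rho G')"
    unfolding G'_def by (rule rho_hoch) (rule unital_values_sandwich)
  ultimately have "x = delta (y + rho G')" by (simp add: z_def delta_add algebra_simps)
  then show ?thesis using C_add[OF y rho_cochains[OF G']] by blast
qed

section \<open>Degree zero\<close>

lemma tau_inj_0:
  assumes x: "x \<in> C 0" and t: "tau \<phi> N x = 0" shows "x = 0"
proof -
  have "fst x as = 0" "mid x bs = 0" for as bs
    using x fun_cong[OF t, of "[]"] by (cases as; simp add: mem_C cochains_0 prod_eq_iff; fail)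
      (use x fun_cong[OF t, of "[]"] in \<open>cases bs; simp add: mem_C cochains_0 prod_eq_iff\<close>)
  then show ?thesis using x by (simp add: mem_C prod_eq_iff fun_eq_iff)
qed

text \<open>The third component n of a cocycle has to vanish, because that of \<open>tau\<close>
  does in degree 0. Evaluating the differential at \<open>1\<^sub>A\<close> gives
  \<open>n 1\<^sub>B = 0\<close>, and here the unit must act as the identity.\<close>

lemma tau_surj_0:
  assumes M: "unital_bimodule A M" and N: "unital_bimodule B N"
    and F: "F \<in> cochains R W 0" and d: "hoch R W F = 0"
  shows "\<exists>x\<in>C 0. delta x = 0 \<and> F = tau \<phi> N x"
proof -
  have u: "lact M (aone A) m = m" "ract M m (aone A) = m" "lact N (aone B) n = n" "ract N n (aone B) = n" for m n
    using M N by (simp_all add: unital_bimodule_def)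
  define x where "x = rho F"
  have x: "x \<in> C 0" unfolding x_def by (rule rho_cochains[OF F])
  have "unital_values F" by (simp add: unital_values_def u)
  then have "delta x = rho (hoch R W F)" unfolding x_def by (rule rho_hoch[symmetric])
  also have "\<dots> = 0" by (simp add: d rho_def ins_zero prod_eq_iff fun_eq_iff zero_fun_def)
  finally have "delta x = 0" .
  moreover have "F xs = tau \<phi> N x xs" for xs
  proof (cases "xs = []")
    case True
    have "hoch R W F [(aone A, 0, 0)] = 0" by (simp add: d)
    then have "thd (F []) = 0" by (simp add: prod_eq_iff u)
    then show ?thesis by (simp add: True prod_eq_iff x_def rho_simps)
  next
    case False
    then show ?thesis using F tau_cochains[OF x] by (simp add: cochains_0)
  qed
  ultimately show ?thesis using x by blast
qed

end


section \<open>Compatibility with \<open>\<Phi>\<close>\<close>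

lemma twist_bipull:
  assumes "\<And>a. \<phi> (a + ascale A lam (ader A a)) = \<phi> a + ascale B lam (ader B (\<phi> a))"
  shows "twist lam A (bipull \<phi> \<phi> N) = bipull \<phi> \<phi> (twist lam B N)"
  by (simp add: twist_def bipull_def assms)

text \<open>Since \<open>\<phi>\<close> commutes with \<open>a \<mapsto> a + lam d(a)\<close>, the
  second summand of the cone over \<open>\<phi>!\<close> has the same shape as the first, and
  \<open>phi_bimod\<close> can be instantiated for it.\<close>

lemma twist_mapping_bimodule:
  assumes "\<And>a. \<phi> (a + ascale A lam (ader A a)) = \<phi> a + ascale B lam (ader B (\<phi> a))"
  shows "twist lam (mapping_ring A B \<phi>) (mapping_bimodule \<phi> M N \<psi>)
    = mapping_bimodule \<phi> (twist lam A M) (twist lam B N) \<psi>"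
  by (simp add: twist_def mapping_bimodule_def mapping_ring_def prod_scale_def split_def assms)

locale diff_phi_bimod = phi_bimod A M B N \<phi> \<psi> + M: diff_bimod lam A M + N: diff_bimod lam B N
  for lam :: "'k::field_char_0" and A :: "('k, 'a::ab_group_add) dalg" and M :: "('k, 'a, 'm::ab_group_add) dbimod"
    and B :: "('k, 'b::ab_group_add) dalg" and N :: "('k, 'b, 'n::ab_group_add) dbimod"
    and \<phi> :: "'a \<Rightarrow> 'b" and \<psi> :: "'m \<Rightarrow> 'n" +
  assumes phi_der [simp]: "\<phi> (ader A a) = ader B (\<phi> a)"
    and psi_der [simp]: "\<psi> (mder M m) = mder N (\<psi> m)"
begin

lemma phi_twist: "\<phi> (a + ascale A lam (ader A a)) = \<phi> a + ascale B lam (ader B (\<phi> a))"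
  by simp

lemma twist_NA: "twist lam A (bipull \<phi> \<phi> N) = bipull \<phi> \<phi> (twist lam B N)"
  by (rule twist_bipull) (rule phi_twist)

lemma phi_bimod_twist: "phi_bimod A (twist lam A M) B (twist lam B N) \<phi> \<psi>"
proof -
  interpret M': bimod A "twist lam A M" by (rule M.bimod_twist)
  interpret N': bimod B "twist lam B N" by (rule N.bimod_twist)
  show ?thesis by unfold_locales (simp_all add: lin_phi lin_psi)
qed

lemma diff_bimod_W: "diff_bimod lam R W"
  by unfold_locales (simp_all add: lin_def prod_eq_iff algebra_simps)

lemma diff_bimod_NA: "diff_bimod lam A (bipull \<phi> \<phi> N)"
  by unfold_locales (simp_all add: lin_def prod_eq_iff)

end

sublocale diff_phi_bimod \<subseteq> tw: phi_bimod A "twist lam A M" B "twist lam B N" \<phi> \<psi>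
  by (rule phi_bimod_twist)

sublocale diff_phi_bimod \<subseteq> W: diff_bimod lam R W
  by (rule diff_bimod_W)

sublocale diff_phi_bimod \<subseteq> NA: diff_bimod lam A "bipull \<phi> \<phi> N"
  by (rule diff_bimod_NA)

context diff_phi_bimod
begin

lemma tw_C: "tw.C n = C n"
  by (auto simp: mem_C tw.mem_C twist_NA[symmetric])

text \<open>In degree 0 this is \<open>- d\<close> on the first two components and 0 on the third,
  so it agrees with \<open>pi_chain_map\<close> in every degree.\<close>

definition pi_rec :: "('a, 'b, 'm, 'n) phi_cochain \<Rightarrow> ('a, 'b, 'm, 'n) phi_cochain" where
  "pi_rec x = (Phi_rec lam A M (fst x), Phi_rec lam B N (mid x), Phi_rec lam A (bipull \<phi> \<phi> N) (thd x))"

lemma pi_rec_simps [simp]: "fst (pi_rec x) = Phi_rec lam A M (fst x)" "mid (pi_rec x) = Phi_rec lam B N (mid x)"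
  "thd (pi_rec x) = Phi_rec lam A (bipull \<phi> \<phi> N) (thd x)"
  by (simp_all add: pi_rec_def)

lemma pi_rec_cochains: "x \<in> C n \<Longrightarrow> pi_rec x \<in> C n"
proof -
  have "Phi_rec lam A (bipull \<phi> \<phi> N) 0 = 0"
    by (simp add: fun_eq_iff Phi_rec_def zero_fun_def perturb_zero[OF N.vs_M])
  then show "x \<in> C n \<Longrightarrow> pi_rec x \<in> C n"
    by (auto simp: mem_C M.Phi_rec_cochains N.Phi_rec_cochains NA.Phi_rec_cochains)
qed

lemma pi_rec_delta:
  assumes "x \<in> C n" shows "pi_rec (delta x) = tw.delta (pi_rec x)"
proof -
  have x: "multilin A M (fst x)" "multilin B N (mid x)" "multilin A (bipull \<phi> \<phi> N) (thd x)"
  proof -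
    show "multilin A M (fst x)" "multilin B N (mid x)"
      using assms by (auto simp: mem_C M.vs_M N.vs_M intro: cochains_multilin)
    have "\<exists>m. thd x \<in> cochains A (bipull \<phi> \<phi> N) m"
      using assms cochains_zero[OF M.vs_A NA.vs_M] by (auto simp: mem_C split: if_splits)
    then show "multilin A (bipull \<phi> \<phi> N) (thd x)"
      by (auto simp: N.vs_M intro: cochains_multilin)
  qed
  have "thd (pi_rec (delta x)) as = thd (tw.delta (pi_rec x)) as" for as
  proof -
    let ?p = "perturb (mscale N) lam (ader A) as"
    have td: "thd (delta x) = (\<lambda>as. \<psi> (fst x as) - mid x (map \<phi> as) - hoch A (bipull \<phi> \<phi> N) (thd x) as)"
      by (rule ext) (rule delta_simps)
    have "?p (thd (delta x)) = ?p (\<lambda>as. \<psi> (fst x as)) - ?p (\<lambda>as. mid x (map \<phi> as)) - ?p (hoch A (bipull \<phi> \<phi> N) (thd x))"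
      unfolding td by (simp only: perturb_linear[OF N.vs_M])
    also have "?p (\<lambda>as. \<psi> (fst x as)) = \<psi> (perturb (mscale M) lam (ader A) as (fst x))"
      by (rule perturb_comp[symmetric]) (rule lin_psi)
    also have "?p (\<lambda>as. mid x (map \<phi> as)) = perturb (mscale N) lam (ader B) (map \<phi> as) (mid x)"
      by (rule perturb_map) simp
    finally show ?thesis
      using NA.Phi_rec_hoch[OF x(3), of as] unfolding twist_NA
      by (simp add: Phi_rec_def[of _ _ _ _ as] Phi_rec_def[of _ _ _ _ "map \<phi> as"] td algebra_simps del: delta_simps(3))
  qed
  then show ?thesis using M.Phi_rec_hoch[OF x(1)] N.Phi_rec_hoch[OF x(2)] by (simp add: prod_eq_iff fun_eq_iff)
qed

text \<open>The derivation of \<open>\<phi>!\<close> works on each coordinate, so perturbing the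
  triples and choosing the position of \<open>b\<^sub>2\<close> are independent; for the entries
  \<open>\<phi>(a)\<close> this uses \<open>\<phi> d = d \<phi>\<close>.\<close>

lemma perturb_spread:
  "multilin B N g \<Longrightarrow> perturb (mscale N) lam (ader R) xs (\<lambda>l. spread \<phi> l g)
    = spread \<phi> xs (\<lambda>l. perturb (mscale N) lam (ader B) l g)"
proof (induction xs arbitrary: g)
  case (Cons x xs)
  have m: "perturb (mscale N) lam (ader R) xs (\<lambda>l. g (b # map (\<lambda>x. \<phi> (fst x)) l))
      = perturb (mscale N) lam (ader B) (map (\<lambda>x. \<phi> (fst x)) xs) (\<lambda>l. g (b # l))" for b
    using perturb_map[of "\<lambda>x. \<phi> (fst x)" "ader R" "ader B" "mscale N" lam xs "\<lambda>l. g (b # l)"] by simp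
  show ?case
    using Cons.IH[OF multilin_Cons[OF Cons.prems]] spread_comp[OF lin_scaled[OF N.vs_M lin_ident]]
    by (simp add: perturb_linear[OF N.vs_M] m spread_add algebra_simps)
qed simp

text \<open>The Leibniz rule turns the factor \<open>b\<^sub>2\<close> of h into
  \<open>b\<^sub>2 + lam d(b\<^sub>2)\<close>, which is the left action on the twisted N; hence the
  twisted \<open>tau\<close> on the right-hand side.\<close>

lemma Phi_rec_tau:
  assumes "x \<in> C n"
  shows "Phi_rec lam R W (tau \<phi> N x) = tau \<phi> (twist lam B N) (pi_rec x)"
proof
  fix xs
  let ?h = "\<lambda>l. thd x (map fst l)"
  have c: "perturb (mscale W) lam (ader R) xs (tau \<phi> N x) = (perturb (mscale M) lam (ader R) xs (\<lambda>l. fst x (map fst l)),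
     perturb (mscale N) lam (ader R) xs (\<lambda>l. mid x (map (\<lambda>x. mid x) l)),
     perturb (mscale N) lam (ader R) xs (\<lambda>l. spread \<phi> l (mid x) + cup N ?h l))"
    by (simp add: prod_eq_iff perturb_comp[OF lin_W(1)] perturb_comp[OF lin_W(2)] perturb_comp[OF lin_W(3)])
  have 1: "perturb (mscale M) lam (ader R) xs (\<lambda>l. fst x (map fst l)) = perturb (mscale M) lam (ader A) (map fst xs) (fst x)"
    by (rule perturb_map) simp
  have 2: "perturb (mscale N) lam (ader R) xs (\<lambda>l. mid x (map (\<lambda>x. mid x) l)) = perturb (mscale N) lam (ader B) (map (\<lambda>x. mid x) xs) (mid x)"
    by (rule perturb_map) simp
  have h: "perturb (mscale N) lam (ader R) ys ?h = perturb (mscale N) lam (ader A) (map fst ys) (thd x)" for ys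
    by (rule perturb_map) simp
  have "perturb (mscale N) lam (ader R) xs (cup N ?h) - mder N (cup N ?h xs)
      = cup (twist lam B N) (\<lambda>l. Phi_rec lam A (bipull \<phi> \<phi> N) (thd x) (map fst l)) xs"
  proof (cases xs)
    case (Cons y ys)
    have "perturb (mscale N) lam (ader R) ys (\<lambda>l. lact N b (?h l)) = lact N b (perturb (mscale N) lam (ader A) (map fst ys) (thd x))" for b
      unfolding h[symmetric] by (rule perturb_comp[symmetric]) (rule N.lin_lact_mod)
    then show ?thesis by (simp add: Cons Phi_rec_def algebra_simps)
  qed simp
  moreover have "spread \<phi> xs (\<lambda>l. mder N (mid x l)) = mder N (spread \<phi> xs (mid x))"
    by (rule spread_comp[symmetric]) (rule N.lin_mder)
  moreover have "Phi_rec lam B N (mid x) = (\<lambda>l. perturb (mscale N) lam (ader B) l (mid x) - mder N (mid x l))"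
    by (rule ext) (rule Phi_rec_def)
  ultimately have "perturb (mscale N) lam (ader R) xs (\<lambda>l. spread \<phi> l (mid x) + cup N ?h l)
      - mder N (spread \<phi> xs (mid x) + cup N ?h xs)
     = spread \<phi> xs (Phi_rec lam B N (mid x)) + cup (twist lam B N) (\<lambda>l. Phi_rec lam A (bipull \<phi> \<phi> N) (thd x) (map fst l)) xs"
    using perturb_spread[OF C_multilin[OF assms], of xs]
    by (simp add: perturb_linear[OF N.vs_M] spread_diff)
  then show "Phi_rec lam R W (tau \<phi> N x) xs = tau \<phi> (twist lam B N) (pi_rec x) xs"
    by (simp add: Phi_rec_def[of _ _ _ _ xs] c prod_eq_iff 1 2 Phi_rec_def[of _ _ _ _ "map fst xs"]
        Phi_rec_def[of _ _ _ _ "map (\<lambda>x. mid x) xs"])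
qed

end


section \<open>Quotients and cones\<close>

definition subsp :: "('k \<Rightarrow> 'v::ab_group_add \<Rightarrow> 'v) \<Rightarrow> 'v set \<Rightarrow> bool" where
  "subsp s S \<longleftrightarrow> 0 \<in> S \<and> (\<forall>x\<in>S. \<forall>y\<in>S. x + y \<in> S) \<and> (\<forall>x\<in>S. \<forall>y\<in>S. x - y \<in> S) \<and> (\<forall>c. \<forall>x\<in>S. s c x \<in> S)"

lemma subspD:
  assumes "subsp s S"
  shows "0 \<in> S" "x \<in> S \<Longrightarrow> y \<in> S \<Longrightarrow> x + y \<in> S" "x \<in> S \<Longrightarrow> y \<in> S \<Longrightarrow> x - y \<in> S" "x \<in> S \<Longrightarrow> s c x \<in> S"
    "x \<in> S \<Longrightarrow> - x \<in> S"
proof -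
  show *: "0 \<in> S" "x \<in> S \<Longrightarrow> y \<in> S \<Longrightarrow> x + y \<in> S" "x \<in> S \<Longrightarrow> y \<in> S \<Longrightarrow> x - y \<in> S" "x \<in> S \<Longrightarrow> s c x \<in> S" for x y c
    using assms by (simp_all add: subsp_def)
  show "x \<in> S \<Longrightarrow> - x \<in> S" using *(3)[OF *(1), of x] by simp
qed

lemma mem_elt_set_plus: "x \<in> z +o B \<longleftrightarrow> x - z \<in> (B :: 'v::ab_group_add set)"
  unfolding elt_set_plus_def by (auto intro: bexI[of _ "x - z"])

lemma elt_set_plus_eq_iff:
  assumes "subsp s B" shows "z +o B = w +o B \<longleftrightarrow> z - w \<in> B"
proof
  assume "z +o B = w +o B"
  moreover have "z \<in> z +o B" using subspD(1)[OF assms] by (simp add: mem_elt_set_plus)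
  ultimately show "z - w \<in> B" by (simp add: mem_elt_set_plus)
next
  assume zw: "z - w \<in> B"
  have "x - z \<in> B \<longleftrightarrow> x - w \<in> B" for x
    using subspD(2)[OF assms _ zw, of "x - z"] subspD(3)[OF assms _ zw, of "x - w"] by auto
  then show "z +o B = w +o B" by (simp add: set_eq_iff mem_elt_set_plus)
qed

lemma coset_add:
  assumes "subsp s B" shows "(z +o B) + (w +o B) = (z + w) +o B"
proof (rule set_eqI)
  fix x
  have "x \<in> (z +o B) + (w +o B) \<longleftrightarrow> x - (z + w) \<in> B"
  proof
    assume "x \<in> (z +o B) + (w +o B)"
    then obtain a b where "x = a + b" "a - z \<in> B" "b - w \<in> B"
      by (auto elim!: set_plus_elim simp: mem_elt_set_plus)
    then show "x - (z + w) \<in> B" using subspD(2)[OF assms, of "a - z" "b - w"] by (simp add: algebra_simps)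
  next
    assume "x - (z + w) \<in> B"
    then have "x - w \<in> z +o B" "w \<in> w +o B"
      using subspD(1)[OF assms] by (simp_all add: mem_elt_set_plus algebra_simps)
    then show "x \<in> (z +o B) + (w +o B)" using set_plus_intro by fastforce
  qed
  then show "x \<in> (z +o B) + (w +o B) \<longleftrightarrow> x \<in> (z + w) +o B" by (simp add: mem_elt_set_plus)
qed

lemma coset_scale:
  assumes B: "subsp s B" and s: "vector_space s"
  shows "(\<Union>x\<in>z +o B. s c x +o B) = s c z +o B"
proof -
  have "s c x +o B = s c z +o B" if "x \<in> z +o B" for x
    using that subspD(4)[OF B, of "x - z" c] vs_simps(2)[OF s]
    by (simp add: elt_set_plus_eq_iff[OF B] mem_elt_set_plus)
  moreover have "z \<in> z +o B" using subspD(1)[OF B] by (simp add: mem_elt_set_plus)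
  ultimately show ?thesis by blast
qed

lemma quotient_lin_isomorphic:
  fixes s :: "'k::field \<Rightarrow> 'v::ab_group_add \<Rightarrow> 'v" and t :: "'k \<Rightarrow> 'w::ab_group_add \<Rightarrow> 'w"
  assumes s: "vector_space s" and t: "vector_space t" and T: "lin s t T"
    and Z: "subsp s Z" and B: "subsp s B" and B': "subsp t B'"
    and TZ: "\<And>z. z \<in> Z \<Longrightarrow> T z \<in> Z'" and TB: "\<And>z. z \<in> B \<Longrightarrow> T z \<in> B'"
    and surj: "\<And>w. w \<in> Z' \<Longrightarrow> \<exists>z\<in>Z. w - T z \<in> B'" and inj: "\<And>z. z \<in> Z \<Longrightarrow> T z \<in> B' \<Longrightarrow> z \<in> B"
  shows "lin_isomorphic (quotient_vspace s Z B) (quotient_vspace t Z' B')"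
proof -
  \<comment> \<open>Acting on whole cosets and thickening by \<open>B'\<close> avoids a choice of
    representatives.\<close>
  define \<Theta> where "\<Theta> X = T ` X + B'" for X
  have \<Theta>: "\<Theta> (z +o B) = T z +o B'" for z
  proof (rule set_eqI)
    fix x
    show "x \<in> \<Theta> (z +o B) \<longleftrightarrow> x \<in> T z +o B'"
    proof
      assume "x \<in> \<Theta> (z +o B)"
      then obtain a b where "x = T a + b" "a - z \<in> B" "b \<in> B'"
        by (auto simp: \<Theta>_def mem_elt_set_plus elim!: set_plus_elim)
      then have "x - T z = T (a - z) + b" by (simp add: lin_diff[OF T])
      also have "\<dots> \<in> B'" using TB \<open>a - z \<in> B\<close> \<open>b \<in> B'\<close> subspD(2)[OF B'] by blast
      finally show "x \<in> T z +o B'" by (simp add: mem_elt_set_plus)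
    next
      assume "x \<in> T z +o B'"
      then have "x - T z \<in> B'" by (simp add: mem_elt_set_plus)
      moreover have "z \<in> z +o B" using subspD(1)[OF B] by (simp add: mem_elt_set_plus)
      ultimately have "T z + (x - T z) \<in> \<Theta> (z +o B)" unfolding \<Theta>_def by (intro set_plus_intro imageI)
      then show "x \<in> \<Theta> (z +o B)" by simp
    qed
  qed
  have "bij_betw \<Theta> ((\<lambda>z. z +o B) ` Z) ((\<lambda>z. z +o B') ` Z')"
  proof (rule bij_betwI')
    fix X Y assume "X \<in> (\<lambda>z. z +o B) ` Z" "Y \<in> (\<lambda>z. z +o B) ` Z"
    then obtain z w where zw: "z \<in> Z" "w \<in> Z" "X = z +o B" "Y = w +o B" by blast
    have "T z - T w \<in> B' \<longleftrightarrow> z - w \<in> B"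
      using inj[OF subspD(3)[OF Z zw(1,2)]] TB[of "z - w"] by (auto simp: lin_diff[OF T])
    then show "\<Theta> X = \<Theta> Y \<longleftrightarrow> X = Y"
      by (simp add: zw \<Theta> elt_set_plus_eq_iff[OF B] elt_set_plus_eq_iff[OF B'])
  next
    fix X assume "X \<in> (\<lambda>z. z +o B) ` Z"
    then show "\<Theta> X \<in> (\<lambda>z. z +o B') ` Z'" using TZ by (auto simp: \<Theta>)
  next
    fix Y assume "Y \<in> (\<lambda>z. z +o B') ` Z'"
    then obtain w where w: "w \<in> Z'" "Y = w +o B'" by blast
    from surj[OF w(1)] obtain z where "z \<in> Z" "w - T z \<in> B'" by blast
    then show "\<exists>X\<in>(\<lambda>z. z +o B) ` Z. Y = \<Theta> X" by (auto simp: \<Theta> w(2) elt_set_plus_eq_iff[OF B'])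
  qed
  then show ?thesis
    unfolding lin_isomorphic_def quotient_vspace_def
    by (intro exI[of _ \<Theta>])
      (auto simp: \<Theta> coset_add[OF B] coset_add[OF B'] coset_scale[OF B s] coset_scale[OF B' t] lin_simps[OF T])
qed

lemma cohomology_cong:
  assumes "\<And>m. C m = C' m" and "\<And>m x. Suc m = n \<or> m = n \<Longrightarrow> x \<in> C m \<Longrightarrow> d m x = d' m x"
  shows "cohomology s C d n = cohomology s C' d' n"
proof -
  have "C = C'" using assms(1) by (rule ext)
  moreover have "cocycles C d n = cocycles C d' n" using assms(2) by (auto simp: cocycles_def)
  moreover have "coboundaries C d n = coboundaries C d' n"
    using assms(2)[of "n - 1"] by (auto simp: coboundaries_def intro!: image_cong)
  ultimately show ?thesis by (simp add: cohomology_def)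
qed

section \<open>Signs, mapping cones and the five lemma\<close>

definition alternate :: "nat \<Rightarrow> 'v::ab_group_add \<Rightarrow> 'v" where
  "alternate n x = (if even n then x else - x)"

lemma alternate_simps [simp]:
  "alternate (Suc n) x = - alternate n x" "alternate 0 x = x" "alternate n 0 = 0"
  "alternate n (alternate n x) = x" "alternate n (- x) = - alternate n x"
  "alternate n (x + y) = alternate n x + alternate n y" "alternate n (x - y) = alternate n x - alternate n y"
  by (simp_all add: alternate_def)

lemma alternate_lin: "lin s t f \<Longrightarrow> f (alternate n x) = alternate n (f x)"
  by (simp add: alternate_def lin_simps)

lemma alternate_subsp: "subsp s S \<Longrightarrow> x \<in> S \<Longrightarrow> alternate n x \<in> S"
  by (simp add: alternate_def subspD)

definition cohom_surj :: "(nat \<Rightarrow> 'v::ab_group_add set) \<Rightarrow> ('v \<Rightarrow> 'v) \<Rightarrow> (nat \<Rightarrow> 'w::ab_group_add set) \<Rightarrow> ('w \<Rightarrow> 'w) \<Rightarrow>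
    ('v \<Rightarrow> 'w) \<Rightarrow> nat \<Rightarrow> bool" where
  "cohom_surj C d C' d' T n \<longleftrightarrow>
     (\<forall>w\<in>C' n. d' w = 0 \<longrightarrow> (\<exists>x\<in>C n. d x = 0 \<and> w - T x \<in> coboundaries C' (\<lambda>_. d') n))"

definition cohom_inj :: "(nat \<Rightarrow> 'v::ab_group_add set) \<Rightarrow> ('v \<Rightarrow> 'v) \<Rightarrow> (nat \<Rightarrow> 'w::ab_group_add set) \<Rightarrow> ('w \<Rightarrow> 'w) \<Rightarrow>
    ('v \<Rightarrow> 'w) \<Rightarrow> nat \<Rightarrow> bool" where
  "cohom_inj C d C' d' T n \<longleftrightarrow>
     (\<forall>x\<in>C n. d x = 0 \<longrightarrow> T x \<in> coboundaries C' (\<lambda>_. d') n \<longrightarrow> x \<in> coboundaries C (\<lambda>_. d) n)"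

definition cone :: "(nat \<Rightarrow> 'v::zero set) \<Rightarrow> (nat \<Rightarrow> 'v set) \<Rightarrow> nat \<Rightarrow> ('v \<times> 'v) set" where
  "cone C D n = C n \<times> (if n = 0 then {0} else D (n - 1))"

text \<open>The maps need no degree index because cochains of all degrees share one type; only the
  signs of the cones depend on the degree.\<close>

locale cone_comparison =
  fixes s :: "'k::field \<Rightarrow> 'v::ab_group_add \<Rightarrow> 'v" and t :: "'k \<Rightarrow> 'w::ab_group_add \<Rightarrow> 'w"
    and C D :: "nat \<Rightarrow> 'v set" and C' D' :: "nat \<Rightarrow> 'w set"
    and d e p :: "'v \<Rightarrow> 'v" and d' e' p' :: "'w \<Rightarrow> 'w" and T Q :: "'v \<Rightarrow> 'w"
  assumes vs: "vector_space s" "vector_space t"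
    and lin_s: "lin s s d" "lin s s e" "lin s s p"
    and lin_t: "lin t t d'" "lin t t e'" "lin t t p'"
    and lin_st: "lin s t T" "lin s t Q"
    and sub: "\<And>n. subsp s (C n)" "\<And>n. subsp s (D n)" "\<And>n. subsp t (C' n)" "\<And>n. subsp t (D' n)"
    and p: "\<And>n x. x \<in> C n \<Longrightarrow> p x \<in> D n" "\<And>n x. x \<in> C n \<Longrightarrow> e (p x) = p (d x)"
    and p': "\<And>n x. x \<in> C' n \<Longrightarrow> p' x \<in> D' n" "\<And>n x. x \<in> C' n \<Longrightarrow> e' (p' x) = p' (d' x)"
    and T: "\<And>n x. x \<in> C n \<Longrightarrow> T x \<in> C' n" "\<And>n x. x \<in> C n \<Longrightarrow> d' (T x) = T (d x)"
    and Q: "\<And>n x. x \<in> D n \<Longrightarrow> Q x \<in> D' n" "\<And>n x. x \<in> D n \<Longrightarrow> e' (Q x) = Q (e x)"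
    and Tp: "\<And>n x. x \<in> C n \<Longrightarrow> p' (T x) = Q (p x)"
begin

lemmas lins [simp] = lin_s[THEN lin_add] lin_s[THEN lin_zero] lin_s[THEN lin_minus] lin_s[THEN lin_diff]
  lin_t[THEN lin_add] lin_t[THEN lin_zero] lin_t[THEN lin_minus] lin_t[THEN lin_diff]
  lin_st[THEN lin_add] lin_st[THEN lin_zero] lin_st[THEN lin_minus] lin_st[THEN lin_diff]
  lin_s[THEN alternate_lin] lin_t[THEN alternate_lin] lin_st[THEN alternate_lin]

definition cd :: "nat \<Rightarrow> 'v \<times> 'v \<Rightarrow> 'v \<times> 'v" where
  "cd n = (\<lambda>(x, y). (d x, e y + alternate n (p x)))"

definition cd' :: "nat \<Rightarrow> 'w \<times> 'w \<Rightarrow> 'w \<times> 'w" where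
  "cd' n = (\<lambda>(x, y). (d' x, - e' y - p' x))"

lemma cone_subsp: "subsp (prod_scale s s) (cone C D n)" "subsp (prod_scale t t) (cone C' D' n)"
  by (auto simp: subsp_def cone_def prod_scale_def zero_prod_def vs_simps[OF vs(1)] vs_simps[OF vs(2)] subspD[OF sub(1)] subspD[OF sub(2)]
      subspD[OF sub(3)] subspD[OF sub(4)])

lemma lin_cd: "lin (prod_scale s s) (prod_scale s s) (cd n)" "lin (prod_scale t t) (prod_scale t t) (cd' n)"
  by (auto simp: lin_def cd_def cd'_def prod_scale_def split_def alternate_def lin_s[THEN lin_scale] lin_t[THEN lin_scale]
      vs_simps[OF vs(1)] vs_simps[OF vs(2)])

lemma cocycle_iff:
  "(x, y) \<in> cocycles (cone C D) cd n \<longleftrightarrow>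
     x \<in> C n \<and> y \<in> (if n = 0 then {0} else D (n - 1)) \<and> d x = 0 \<and> e y + alternate n (p x) = 0"
  "(F, G) \<in> cocycles (cone C' D') cd' n \<longleftrightarrow>
     F \<in> C' n \<and> G \<in> (if n = 0 then {0} else D' (n - 1)) \<and> d' F = 0 \<and> - e' G - p' F = 0"
  unfolding cocycles_def cone_def cd_def cd'_def mem_Collect_eq zero_prod_def by auto

lemma subsp_image:
  assumes "subsp r S" "lin r r f" shows "subsp r (f ` S)"
  unfolding subsp_def
proof (intro conjI allI ballI)
  show "0 \<in> f ` S" using subspD(1)[OF assms(1)] lin_zero[OF assms(2)] by force
next
  fix x y assume "x \<in> f ` S" "y \<in> f ` S"
  then obtain a b where "x = f a" "y = f b" "a \<in> S" "b \<in> S" by blast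
  then show "x + y \<in> f ` S" "x - y \<in> f ` S"
    using subspD(2,3)[OF assms(1), of a b] by (auto simp: lin_add[OF assms(2), symmetric] lin_diff[OF assms(2), symmetric])
next
  fix c x assume "x \<in> f ` S"
  then show "r c x \<in> f ` S" using subspD(4)[OF assms(1)] by (auto simp: lin_scale[OF assms(2), symmetric])
qed

lemma subsp_cocycles:
  assumes "subsp r (X n)" "lin r r (f n)" "vector_space r" shows "subsp r (cocycles X f n)"
  using assms(1) by (auto simp: subsp_def cocycles_def lin_simps[OF assms(2)] vs_simps[OF assms(3)])

lemma subsp_coboundaries:
  assumes "\<And>n. subsp r (X n)" "\<And>n. lin r r (f n)" "vector_space r" shows "subsp r (coboundaries X f n)"
proof (cases n)
  case 0
  then show ?thesis by (simp add: coboundaries_def subsp_def vs_simps[OF assms(3)])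
next
  case (Suc m)
  then show ?thesis using subsp_image[OF assms(1,2)] by (simp add: coboundaries_def)
qed

text \<open>The five lemma for \<open>H(C) \<rightarrow> H(D) \<rightarrow> H(cone) \<rightarrow>
  H(C) \<rightarrow> H(D)\<close>, chased on representatives under its usual hypotheses; the first
  two groups sit in degree n - 1 and are absent for n = 0.\<close>

theorem cone_isomorphic:
  assumes Cn: "cohom_surj C d C' d' T n" "cohom_inj C d C' d' T n" and Dn: "cohom_inj D e D' e' Q n"
    and low: "\<And>m. n = Suc m \<Longrightarrow> cohom_surj C d C' d' T m \<and> cohom_surj D e D' e' Q m \<and> cohom_inj D e D' e' Q m"
  shows "lin_isomorphic (cohomology (prod_scale s s) (cone C D) cd n) (cohomology (prod_scale t t) (cone C' D') cd' n)"
  unfolding cohomology_def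
proof (rule quotient_lin_isomorphic[where T = "\<lambda>(x, y). (T x, alternate n (Q y))"])
  \<comment> \<open>The sign turns the convention \<open>e y + (-1)^n p x\<close> of one cone into
    \<open>- e' y - p' x\<close> of the other.\<close>
  let ?Th = "\<lambda>(x, y). (T x, alternate n (Q y))"
  show "vector_space (prod_scale s s)" "vector_space (prod_scale t t)"
    by (intro vector_space_prod_scale vs)+
  show "lin (prod_scale s s) (prod_scale t t) ?Th"
    by (auto simp: lin_def prod_scale_def lin_st[THEN lin_scale] alternate_def vs_simps[OF vs(2)])
  show "subsp (prod_scale s s) (cocycles (cone C D) cd n)"
    by (intro subsp_cocycles cone_subsp lin_cd vector_space_prod_scale vs)
  show "subsp (prod_scale s s) (coboundaries (cone C D) cd n)" "subsp (prod_scale t t) (coboundaries (cone C' D') cd' n)"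
    by (intro subsp_coboundaries cone_subsp lin_cd vector_space_prod_scale vs)+
  have eQ: "e' (Q y) = Q (e y)" if "y \<in> (if n = 0 then {0} else D (n - 1))" for y n
    using that Q(2) by (auto split: if_splits)
  have memQ: "alternate k (Q y) \<in> (if n = 0 then {0} else D' (n - 1))" if "y \<in> (if n = 0 then {0} else D (n - 1))" for y n k
    using that Q(1) alternate_subsp[OF sub(4)] by (auto split: if_splits)
  show "?Th z \<in> cocycles (cone C' D') cd' n" if "z \<in> cocycles (cone C D) cd n" for z
  proof -
    obtain x y where xy: "z = (x, y)" by (cases z)
    note z = xy that[unfolded xy cocycle_iff, THEN conjunct1] that[unfolded xy cocycle_iff, THEN conjunct2, THEN conjunct1]
    note c = that[unfolded xy cocycle_iff, THEN conjunct2, THEN conjunct2, THEN conjunct1]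
      that[unfolded xy cocycle_iff, THEN conjunct2, THEN conjunct2, THEN conjunct2]
    have "e y = - alternate n (p x)" using c(2) by (simp add: eq_neg_iff_add_eq_0)
    then have "e' (alternate n (Q y)) = - Q (p x)" by (simp add: eQ[OF z(3)])
    then show ?thesis using z c memQ[OF z(3)] T[OF z(2)] Tp[OF z(2)]
      by (simp add: cocycles_def cone_def cd'_def zero_prod_def)
  qed
  show "?Th z \<in> coboundaries (cone C' D') cd' n" if zB: "z \<in> coboundaries (cone C D) cd n" for z
  proof (cases n)
    case 0
    then show ?thesis using zB by (simp add: coboundaries_def zero_prod_def)
  next
    case (Suc m)
    then obtain x y where z: "z = cd m (x, y)" "x \<in> C m" "y \<in> (if m = 0 then {0} else D (m - 1))"
      using zB by (auto simp: coboundaries_def cone_def)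
    have "?Th z = cd' m (T x, alternate m (Q y))"
      by (simp add: z(1) cd_def cd'_def Suc T(2)[OF z(2)] Tp[OF z(2)] eQ[OF z(3)])
    moreover have "(T x, alternate m (Q y)) \<in> cone C' D' m"
      using T(1)[OF z(2)] memQ[OF z(3)] by (simp add: cone_def)
    ultimately show ?thesis using Suc by (simp add: coboundaries_def)
  qed
  show "\<exists>z\<in>cocycles (cone C D) cd n. w - ?Th z \<in> coboundaries (cone C' D') cd' n"
    if "w \<in> cocycles (cone C' D') cd' n" for w
  proof -
    obtain F G where w: "w = (F, G)" by (cases w)
    have F: "F \<in> C' n" "d' F = 0" and G: "G \<in> (if n = 0 then {0} else D' (n - 1))" and c: "- e' G - p' F = 0"
      using that unfolding w cocycle_iff by blast+
    obtain x where x: "x \<in> C n" "d x = 0" "F - T x \<in> coboundaries C' (\<lambda>_. d') n"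
      using Cn(1) F unfolding cohom_surj_def by blast
    have px: "p x \<in> D n" "e (p x) = 0" using p[OF x(1)] x(2) by simp_all
    show ?thesis
    proof (cases n)
      case 0
      then have "F = T x" "G = 0" using x(3) G by (simp_all add: coboundaries_def)
      then have "Q (p x) = 0" using c Tp[OF x(1)] by simp
      then have "p x = 0" using Dn px 0 by (simp add: cohom_inj_def coboundaries_def)
      then have "(x, 0) \<in> cocycles (cone C D) cd n"
        using x 0 by (simp add: cocycles_def cone_def cd_def zero_prod_def)
      moreover have "w - ?Th (x, 0) \<in> coboundaries (cone C' D') cd' n"
        using \<open>F = T x\<close> \<open>G = 0\<close> 0 by (simp add: w coboundaries_def zero_prod_def)
      ultimately show ?thesis by blast
    next
      case (Suc m)
      then obtain F' where F': "F' \<in> C' m" "F - T x = d' F'" using x(3) by (auto simp: coboundaries_def)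
      \<comment> \<open>The second component left after subtracting the coboundary of
        \<open>(F', 0)\<close>; its differential \<open>- Q (p x)\<close> shows that
        \<open>Q (p x)\<close> is a coboundary.\<close>
      define G1 where "G1 = G + p' F'"
      have G1: "G1 \<in> D' m" using G Suc p'(1)[OF F'(1)] subspD(2)[OF sub(4)] by (simp add: G1_def)
      have eG: "e' G = - p' F" using c by (metis eq_iff_diff_eq_0 minus_minus)
      have eG1: "e' G1 = - Q (p x)"
        by (simp add: G1_def eG p'(2)[OF F'(1)] F'(2)[symmetric] Tp[OF x(1)])
      then have "Q (p x) = e' (- G1)" by simp
      then have "Q (p x) \<in> coboundaries D' (\<lambda>_. e') n"
        using subspD(5)[OF sub(4) G1] unfolding coboundaries_def Suc by (metis diff_Suc_1 image_eqI nat.distinct(1))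
      then have "p x \<in> coboundaries D (\<lambda>_. e) n" using Dn px by (simp add: cohom_inj_def)
      then obtain y1 where y1: "y1 \<in> D m" "p x = e y1" by (auto simp: coboundaries_def Suc)
      \<comment> \<open>The equation \<open>p x = e y1\<close> determines y1 only up to a cocycle;
        the defect is lifted to y2, and \<open>y2 - y1\<close> is the second component sought, up to
        sign.\<close>
      have "Q y1 + G1 \<in> D' m" "e' (Q y1 + G1) = 0"
        using subspD(2)[OF sub(4) Q(1)[OF y1(1)] G1] by (simp_all add: eG1 y1(2) Q(2)[OF y1(1)])
      then obtain y2 where y2: "y2 \<in> D m" "e y2 = 0" "Q y1 + G1 - Q y2 \<in> coboundaries D' (\<lambda>_. e') m"
        using low[OF Suc] unfolding cohom_surj_def by blast
      obtain K where K: "K \<in> (if m = 0 then {0} else D' (m - 1))" "Q y1 + G1 - Q y2 = e' K"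
        using y2(3) by (cases m) (auto simp: coboundaries_def)
      define y where "y = alternate n (y2 - y1)"
      have yD: "y \<in> D m" unfolding y_def by (intro alternate_subsp[OF sub(2)] subspD(3)[OF sub(2)] y1 y2)
      have "(x, y) \<in> cocycles (cone C D) cd n"
        using yD x(1,2) by (simp add: cocycles_def cone_def cd_def zero_prod_def Suc y_def y1(2) y2(2))
      moreover have "w - ?Th (x, y) = cd' m (F', - K)"
      proof -
        have "alternate n (Q y) = Q y2 - Q y1" by (simp add: y_def)
        moreover have "G = e' K + (Q y2 - Q y1) - p' F'" using K(2) by (simp add: G1_def algebra_simps)
        ultimately show ?thesis by (simp add: w cd'_def F'(2)[symmetric])
      qed
      moreover have "(F', - K) \<in> cone C' D' m"
        using F'(1) K(1) subspD(5)[OF sub(4)] by (auto simp: cone_def split: if_splits)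
      ultimately show ?thesis by (auto simp: coboundaries_def Suc intro!: bexI[of _ "(x, y)"])
    qed
  qed
  show "z \<in> coboundaries (cone C D) cd n"
    if zc: "z \<in> cocycles (cone C D) cd n" and Tz: "?Th z \<in> coboundaries (cone C' D') cd' n" for z
  proof -
    obtain x y where xy: "z = (x, y)" by (cases z)
    note z = xy zc[unfolded xy cocycle_iff, THEN conjunct1] zc[unfolded xy cocycle_iff, THEN conjunct2, THEN conjunct1]
    note c = zc[unfolded xy cocycle_iff, THEN conjunct2, THEN conjunct2, THEN conjunct1]
      zc[unfolded xy cocycle_iff, THEN conjunct2, THEN conjunct2, THEN conjunct2]
    show ?thesis
    proof (cases n)
      case 0
      then have "T x = 0" using Tz z by (simp add: coboundaries_def zero_prod_def)
      then have "x = 0" using Cn(2) z(2) c(1) 0 by (simp add: cohom_inj_def coboundaries_def)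
      then show ?thesis using z 0 by (simp add: coboundaries_def zero_prod_def)
    next
      case (Suc m)
      obtain F G where F: "F \<in> C' m" and G: "G \<in> (if m = 0 then {0} else D' (m - 1))"
        and b: "T x = d' F" "alternate n (Q y) = - e' G - p' F"
        using Tz by (auto simp: coboundaries_def Suc cone_def cd'_def z(1))
      have "x \<in> coboundaries C (\<lambda>_. d) n"
        using Cn(2) z(2) c(1) b(1) F by (auto simp: cohom_inj_def coboundaries_def Suc)
      then obtain x' where x': "x' \<in> C m" "x = d x'" by (auto simp: coboundaries_def Suc)
      \<comment> \<open>F and \<open>T x'\<close> have the same differential but may differ by a
        cocycle, which is lifted to v; then \<open>x' + v\<close> is the correct first
        component.\<close>
      define F1 where "F1 = F - T x'"
      have "F1 \<in> C' m" "d' F1 = 0"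
        using subspD(3)[OF sub(3) F T(1)[OF x'(1)]] T(2)[OF x'(1)] b(1) x'(2) by (simp_all add: F1_def)
      then obtain v where v: "v \<in> C m" "d v = 0" "F1 - T v \<in> coboundaries C' (\<lambda>_. d') m"
        using low[OF Suc] unfolding cohom_surj_def by blast
      have "p' (F1 - T v) \<in> coboundaries D' (\<lambda>_. e') m"
      proof (cases m)
        case 0
        then show ?thesis using v(3) by (simp add: coboundaries_def)
      next
        case (Suc k)
        then obtain L where "L \<in> C' k" "F1 - T v = d' L" using v(3) by (auto simp: coboundaries_def)
        then have "p' (F1 - T v) = e' (p' L)" "p' L \<in> D' k" using p' by simp_all
        then show ?thesis by (simp add: coboundaries_def Suc del: lins)
      qed
      moreover have "e' G \<in> coboundaries D' (\<lambda>_. e') m"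
        using G by (auto simp: coboundaries_def split: if_splits)
      moreover have sb: "subsp t (coboundaries D' (\<lambda>_. e') m)"
        by (rule subsp_coboundaries[OF sub(4) lin_t(2) vs(2)])
      ultimately have bd: "- e' G - p' (F1 - T v) \<in> coboundaries D' (\<lambda>_. e') m"
        using subspD(3,5)[OF sb] by blast
      define y' where "y' = y - alternate m (p x')"
      have y': "y' \<in> D m" unfolding y'_def
        using z(3) Suc p(1)[OF x'(1)] by (simp add: subspD(3)[OF sub(2)] alternate_subsp[OF sub(2)])
      have ey: "e y = - alternate n (p x)" using c(2) by (simp add: eq_neg_iff_add_eq_0)
      have "e y' = 0" by (simp add: y'_def ey Suc p(2)[OF x'(1)] x'(2))
      \<comment> \<open>Up to sign, what remains of y after subtracting the coboundary of
        \<open>(x' + v, 0)\<close>; it is closed and Q maps it to a coboundary, so it is a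
        coboundary itself.\<close>
      define q where "q = alternate n y' + p v"
      have q: "q \<in> D m" "e q = 0"
        unfolding q_def using p[OF v(1)] \<open>e y' = 0\<close> v(2)
        by (simp_all only: subspD(2)[OF sub(2)] alternate_subsp[OF sub(2) y']) simp
      have "Q q = - e' G - p' (F1 - T v)"
      proof -
        have "alternate n (Q y') = - e' G - p' F + p' (T x')"
          unfolding y'_def using b(2) by (simp add: Suc Tp[OF x'(1)])
        then show ?thesis by (simp add: q_def F1_def Tp[OF v(1)])
      qed
      then have "q \<in> coboundaries D (\<lambda>_. e) m"
        using low[OF Suc] q bd unfolding cohom_inj_def by simp
      then obtain r where r: "r \<in> (if m = 0 then {0} else D (m - 1))" "q = e r"
        by (cases m) (auto simp: coboundaries_def)
      have "y' = alternate n (q - p v)" by (simp add: q_def)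
      then have "y = e (alternate n r) - alternate n (p v) + alternate m (p x')"
        using r(2) by (simp add: y'_def algebra_simps)
      then have "z = cd m (x' + v, alternate n r)"
        by (simp add: z(1) cd_def x'(2) v(2) Suc)
      moreover have "(x' + v, alternate n r) \<in> cone C D m"
        using r(1) x'(1) v(1) by (auto simp: cone_def subspD(2)[OF sub(1)] alternate_subsp[OF sub(2)] split: if_splits)
      ultimately show ?thesis by (auto simp: coboundaries_def Suc)
    qed
  qed
qed

end


section \<open>The comparison theorem\<close>

lemma phi_scale_simps [simp]:
  "fst (phi_scale M N c x) = fun_scale (mscale M) c (fst x)"
  "mid (phi_scale M N c x) = fun_scale (mscale N) c (mid x)"
  "thd (phi_scale M N c x) = fun_scale (mscale N) c (thd x)"
  by (simp_all add: phi_scale_def prod_scale_def split_def)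

context phi_bimod
begin

lemma vs_phi: "vector_space (phi_scale M N)"
  unfolding phi_scale_def
  by (intro vector_space_prod_scale vector_space_fun_scale M.vs_M N.vs_M)

lemma lin_delta: "lin (phi_scale M N) (phi_scale M N) delta"
proof (rule linI)
  fix c x
  show "delta (phi_scale M N c x) = phi_scale M N c (delta x)"
    unfolding prod_eq_iff fun_eq_iff
    by (simp add: fun_scale_def M.hoch_scale N.hoch_scale NA.hoch_scale[simplified])
qed (rule delta_add)

lemma lin_hoch: "lin (fun_scale (mscale W)) (fun_scale (mscale W)) (hoch R W)"
  by (rule linI) (simp_all add: fun_eq_iff fun_scale_def plus_fun_def W.hoch_add W.hoch_scale)

lemma lin_tau: "lin (phi_scale M N) (fun_scale (mscale W)) (tau \<phi> N)"
proof (rule linI)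
  fix c :: 'k and x :: "('a, 'b, 'm, 'n) phi_cochain"
  have "spread \<phi> xs (\<lambda>l. mscale N c (g l)) = mscale N c (spread \<phi> xs g)" for xs g
    by (rule spread_comp[symmetric]) (rule lin_scaled[OF N.vs_M lin_ident])
  moreover have "cup N (\<lambda>l. mscale N c (h l)) xs = mscale N c (cup N h xs)"
    for xs and h :: "('a \<times> 'b \<times> 'b) list \<Rightarrow> 'n"
    by (cases xs) simp_all
  ultimately show "tau \<phi> N (phi_scale M N c x) = fun_scale (mscale W) c (tau \<phi> N x)"
    by (simp add: fun_eq_iff prod_eq_iff fun_scale_def)
qed (rule tau_add)

lemma subsp_cochains_W: "subsp (fun_scale (mscale W)) (cochains R W n)"
  unfolding subsp_def
  using cochains_zero[OF vs_R vs_W] cochains_add[of _ R W n] cochains_diff[of _ R W n] cochains_scale[OF vs_W]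
  by (simp add: plus_fun_def fun_diff_def fun_scale_def)

lemma subsp_C: "subsp (phi_scale M N) (C n)"
proof -
  have "phi_scale M N c x \<in> C n" if "x \<in> C n" for c x
    using that cochains_scale[OF M.vs_M, of "fst x" A n c] cochains_scale[OF N.vs_M, of "mid x" B n c]
      cochains_scale[OF NA.vs_M, of "thd x" A "n - 1" c]
    by (auto simp: mem_C fun_scale_def zero_fun_def)
  then show ?thesis by (simp add: subsp_def C_add C_diff C_zero)
qed

lemma cohom_surj_tau:
  assumes "n = 0 \<Longrightarrow> unital_bimodule A M \<and> unital_bimodule B N"
  shows "cohom_surj C delta (cochains R W) (hoch R W) (tau \<phi> N) n"
proof (cases n)
  case 0
  then show ?thesis
    using tau_surj_0 assms by (force simp: cohom_surj_def coboundaries_def)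
next
  case (Suc m)
  then have b: "coboundaries (cochains R W) (\<lambda>_. hoch R W) n = hoch R W ` cochains R W m"
    by (simp add: coboundaries_def)
  show ?thesis unfolding cohom_surj_def b[unfolded Suc] Suc using tau_surj[of _ m] by blast
qed

lemma cohom_inj_tau: "cohom_inj C delta (cochains R W) (hoch R W) (tau \<phi> N) n"
proof (cases n)
  case 0
  then show ?thesis using tau_inj_0 by (simp add: cohom_inj_def coboundaries_def)
next
  case (Suc m)
  then have b: "coboundaries (cochains R W) (\<lambda>_. hoch R W) n = hoch R W ` cochains R W m"
    "coboundaries C (\<lambda>_. delta) n = delta ` C m"
    by (simp_all add: coboundaries_def)
  show ?thesis unfolding cohom_inj_def b[unfolded Suc] Suc using tau_inj[of _ m] by blast
qed

lemma phi_diff_eq: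
  assumes "x \<in> C n" shows "phi_diff A B \<phi> M N \<psi> n x = delta x"
proof -
  have "(if n = 0 then 0 else hoch A (bipull \<phi> \<phi> N) (thd x)) = hoch A (bipull \<phi> \<phi> N) (thd x)"
    using assms NA.hoch_zero by (auto simp: mem_C zero_fun_def)
  moreover have "n > 0 \<Longrightarrow> hochschild A (bipull \<phi> \<phi> N) (n - 1) (thd x) = hoch A (bipull \<phi> \<phi> N) (thd x)"
    using assms by (auto simp: mem_C NA.hochschild_eq_hoch)
  ultimately show ?thesis
    using assms
    by (auto simp: phi_diff_def delta_def mem_C pullback_bipull M.hochschild_eq_hoch N.hochschild_eq_hoch
        split_def fun_diff_def fun_eq_iff)
qed

end

context diff_phi_bimod
begin

lemma twist_W: "twist lam R W = tw.W"
  by (rule twist_mapping_bimodule) (rule phi_twist)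

lemma tw_scales [simp]: "phi_scale (twist lam A M) (twist lam B N) = phi_scale M N" "mscale tw.W = mscale W"
  by (simp_all add: phi_scale_def mapping_scales)

lemma tw_cochains: "cochains R tw.W n = cochains R W n"
  by (rule cochains_cong) simp_all

lemma lin_Phi_rec_W: "lin (fun_scale (mscale W)) (fun_scale (mscale W)) (Phi_rec lam R W)"
  by (rule linI)
    (simp_all add: fun_eq_iff fun_scale_def Phi_rec_def plus_fun_def perturb_linear[OF vs_W] lin_simps[OF W.lin_mder]
      vs_simps[OF vs_W])

lemma lin_pi_rec: "lin (phi_scale M N) (phi_scale M N) pi_rec"
  by (rule linI)
    (simp_all add: prod_eq_iff fun_eq_iff fun_scale_def Phi_rec_def plus_fun_def perturb_linear[OF M.vs_M] perturb_linear[OF N.vs_M])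

sublocale cone_comparison "phi_scale M N" "fun_scale (mscale W)" C tw.C "cochains R W" "cochains R tw.W"
  delta tw.delta pi_rec "hoch R W" "hoch R tw.W" "Phi_rec lam R W" "tau \<phi> N" "tau \<phi> (twist lam B N)"
proof (rule cone_comparison.intro)
  show "vector_space (phi_scale M N)" "vector_space (fun_scale (mscale W))"
    by (intro vs_phi vector_space_fun_scale vs_W)+
  show "lin (phi_scale M N) (phi_scale M N) delta" "lin (phi_scale M N) (phi_scale M N) tw.delta"
    "lin (phi_scale M N) (phi_scale M N) pi_rec"
    using lin_delta tw.lin_delta lin_pi_rec by simp_all
  show "lin (fun_scale (mscale W)) (fun_scale (mscale W)) (hoch R W)"
    "lin (fun_scale (mscale W)) (fun_scale (mscale W)) (hoch R tw.W)"
    "lin (fun_scale (mscale W)) (fun_scale (mscale W)) (Phi_rec lam R W)"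
    using lin_hoch tw.lin_hoch lin_Phi_rec_W by simp_all
  show "lin (phi_scale M N) (fun_scale (mscale W)) (tau \<phi> N)"
    "lin (phi_scale M N) (fun_scale (mscale W)) (tau \<phi> (twist lam B N))"
    using lin_tau tw.lin_tau by simp_all
  show "subsp (phi_scale M N) (C n)" "subsp (phi_scale M N) (tw.C n)"
    "subsp (fun_scale (mscale W)) (cochains R W n)" "subsp (fun_scale (mscale W)) (cochains R tw.W n)" for n
    using subsp_C tw.subsp_C subsp_cochains_W tw.subsp_cochains_W by simp_all
  show "pi_rec x \<in> tw.C n" if "x \<in> C n" for n x
    unfolding tw_C using that by (rule pi_rec_cochains)
  show "tw.delta (pi_rec x) = pi_rec (delta x)" if "x \<in> C n" for n x
    using that by (rule pi_rec_delta[symmetric])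
  show "Phi_rec lam R W F \<in> cochains R tw.W n" if "F \<in> cochains R W n" for n F
    unfolding tw_cochains using that by (rule W.Phi_rec_cochains)
  show "hoch R tw.W (Phi_rec lam R W F) = Phi_rec lam R W (hoch R W F)" if "F \<in> cochains R W n" for n F
    by (rule ext) (rule W.Phi_rec_hoch[OF cochains_multilin[OF that vs_W], unfolded twist_W, symmetric])
  show "tau \<phi> N x \<in> cochains R W n" if "x \<in> C n" for n x using that by (rule tau_cochains)
  show "hoch R W (tau \<phi> N x) = tau \<phi> N (delta x)" if "x \<in> C n" for n x using that by (rule hoch_tau_C)
  show "Phi_rec lam R W (tau \<phi> N x) = tau \<phi> (twist lam B N) (pi_rec x)" if "x \<in> C n" for n x
    using that by (rule Phi_rec_tau)
  show "tau \<phi> (twist lam B N) x \<in> cochains R tw.W n" if "x \<in> tw.C n" for n x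
    using that by (rule tw.tau_cochains)
  show "hoch R tw.W (tau \<phi> (twist lam B N) x) = tau \<phi> (twist lam B N) (tw.delta x)" if "x \<in> tw.C n" for n x
    using that by (rule tw.hoch_tau_C)
qed

section \<open>Both complexes as instances of the abstract cones\<close>

lemma pi_chain_map_eq:
  assumes "x \<in> C n" shows "pi_chain_map lam A B \<phi> M N n x = pi_rec x"
proof -
  have "Phi_rec lam A (bipull \<phi> \<phi> N) 0 = 0"
    by (simp add: fun_eq_iff Phi_rec_def zero_fun_def perturb_zero[OF N.vs_M])
  then show ?thesis
    using assms
    by (cases n) (auto simp: pi_chain_map_def pi_map_def pi_rec_def mem_C pullback_bipull split_def
        M.Phi_eq_Phi_rec N.Phi_eq_Phi_rec NA.Phi_eq_Phi_rec)
qed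

lemma H_mor_chain_cone:
  "H_mor_chain lam A B \<phi> M N \<psi> n = cohomology (prod_scale (phi_scale M N) (phi_scale M N)) (cone C tw.C) cd n"
  unfolding H_mor_chain_def
proof (rule cohomology_cong)
  show eq: "mor_cochains lam A B \<phi> M N m = cone C tw.C m" for m
    by (simp add: mor_cochains_def cone_def)
  fix m z assume "z \<in> mor_cochains lam A B \<phi> M N m"
  then obtain x y where z: "z = (x, y)" "x \<in> C m" "y \<in> (if m = 0 then {0} else tw.C (m - 1))"
    unfolding eq cone_def by blast
  have "(if m = 0 then 0 else phi_diff A B \<phi> (twist lam A M) (twist lam B N) \<psi> (m - 1) y) = tw.delta y"
    using z(3) tw.phi_diff_eq lin_zero[OF tw.lin_delta] by (auto split: if_splits)
  then show "mor_diff (pi_chain_map lam A B \<phi> M N) lam A B \<phi> M N \<psi> m z = cd m z"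
    by (simp add: mor_diff_def cd_def z(1) phi_diff_eq[OF z(2)] pi_chain_map_eq[OF z(2)] alternate_def)
qed

lemma H_DA_cone:
  "H_DA lam R W n = cohomology (prod_scale (fun_scale (mscale W)) (fun_scale (mscale W)))
     (cone (cochains R W) (cochains R tw.W)) cd' n"
  unfolding H_DA_def
proof (rule cohomology_cong)
  show eq: "DA_cochains lam R W m = cone (cochains R W) (cochains R tw.W) m" for m
    by (simp add: DA_cochains_def cone_def twist_W del: twist_cochains)
  fix m z assume "z \<in> DA_cochains lam R W m"
  then obtain F G where z: "z = (F, G)" "F \<in> cochains R W m" "G \<in> (if m = 0 then {0} else cochains R tw.W (m - 1))"
    unfolding eq cone_def by blast
  have "m = 0 \<Longrightarrow> hoch R tw.W G = 0" "0 < m \<Longrightarrow> hochschild R tw.W (m - Suc 0) G = hoch R tw.W G"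
    using z(3) tw.W.hochschild_eq_hoch lin_zero[OF tw.lin_hoch] by simp_all
  then show "DA_diff lam R W m z = cd' m z"
    by (simp add: DA_diff_def cd'_def z(1) twist_W W.hochschild_eq_hoch[OF z(2)] W.Phi_eq_Phi_rec[OF z(2)])
qed

text \<open>If \<open>u = 1 + lam d(1)\<close> acts as the identity, so does 1, because
  \<open>1 x = 1 (u x) = (1 u) x = u x = x\<close>.\<close>

lemma unital_untwist:
  assumes "unital_bimodule A (twist lam A M)" "unital_bimodule B (twist lam B N)"
  shows "unital_bimodule A M" "unital_bimodule B N"
proof -
  have "lact M (aone A) x = x \<and> ract M x (aone A) = x" for x
  proof -
    let ?u = "aone A + ascale A lam (ader A (aone A))"
    have "lact M ?u x = x" "ract M x ?u = x" using assms(1) by (simp_all add: unital_bimodule_def)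
    then show ?thesis using M.lact_mult[of "aone A" ?u x] M.ract_mult[of x ?u "aone A"]
      by (metis M.mult_one_left M.mult_one_right)
  qed
  then show "unital_bimodule A M" by (simp add: unital_bimodule_def)
  have "lact N (aone B) x = x \<and> ract N x (aone B) = x" for x
  proof -
    let ?u = "aone B + ascale B lam (ader B (aone B))"
    have "lact N ?u x = x" "ract N x ?u = x" using assms(2) by (simp_all add: unital_bimodule_def)
    then show ?thesis using N.lact_mult[of "aone B" ?u x] N.ract_mult[of x ?u "aone B"]
      by (metis N.mult_one_left N.mult_one_right)
  qed
  then show "unital_bimodule B N" by (simp add: unital_bimodule_def)
qed

text \<open>Units enter through surjectivity in degree 0: the five lemma asks for it on the
  untwisted side when n = 0, and on both sides when n = 1, where the twisted hypothesis implies the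
  untwisted one.\<close>

lemma H_mor_chain_isomorphic:
  assumes "n = 0 \<Longrightarrow> unital_bimodule A M \<and> unital_bimodule B N"
    and "n = 1 \<Longrightarrow> unital_bimodule A (twist lam A M) \<and> unital_bimodule B (twist lam B N)"
  shows "lin_isomorphic (H_mor_chain lam A B \<phi> M N \<psi> n) (H_DA lam R W n)"
  unfolding H_mor_chain_cone H_DA_cone
proof (rule cone_isomorphic)
  show "cohom_surj C delta (cochains R W) (hoch R W) (tau \<phi> N) n" using assms(1) by (rule cohom_surj_tau)
  show "cohom_surj C delta (cochains R W) (hoch R W) (tau \<phi> N) m \<and>
      cohom_surj tw.C tw.delta (cochains R tw.W) (hoch R tw.W) (tau \<phi> (twist lam B N)) m \<and>
      cohom_inj tw.C tw.delta (cochains R tw.W) (hoch R tw.W) (tau \<phi> (twist lam B N)) m" if "n = Suc m" for m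
  proof (intro conjI cohom_surj_tau tw.cohom_surj_tau tw.cohom_inj_tau)
    assume "m = 0"
    with that assms(2) have u: "unital_bimodule A (twist lam A M)" "unital_bimodule B (twist lam B N)" by simp_all
    then show "unital_bimodule A (twist lam A M)" "unital_bimodule B (twist lam B N)" .
    show "unital_bimodule A M" "unital_bimodule B N" using unital_untwist[OF u] .
  qed
qed (rule cohom_inj_tau tw.cohom_inj_tau)+

end

text \<open>Degree n involves only the differentials out of degrees n - 1 and n, and the two cone
  maps differ only in degree 0.\<close>

lemma H_mor_eq_H_mor_chain:
  assumes "n \<ge> 2" shows "H_mor lam A B \<phi> M N \<psi> n = H_mor_chain lam A B \<phi> M N \<psi> n"
  unfolding H_mor_def H_mor_chain_def
  by (rule cohomology_cong) (use assms in \<open>auto simp: mor_diff_def pi_chain_map_def\<close>)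

lemma diff_bimod_intro:
  assumes "diff_algebra lam A" "diff_bimodule lam A M" shows "diff_bimod lam A M"
  using assms
  by (simp add: diff_algebra_def diff_bimodule_def linear_iff_lin diff_bimod_def bimod_def assoc_alg_def
      bimod_axioms_def diff_bimod_axioms_def)

lemma diff_phi_bimod_intro:
  assumes A: "diff_algebra lam A" and B: "diff_algebra lam B"
    and \<phi>: "diff_alg_morphism A B \<phi>" and \<psi>: "diff_phi_bimodule lam A B \<phi> M N \<psi>"
  shows "diff_phi_bimod lam A M B N \<phi> \<psi>"
proof -
  interpret M: diff_bimod lam A M
    using A \<psi> by (intro diff_bimod_intro) (simp_all add: diff_phi_bimodule_def)
  interpret N: diff_bimod lam B N
    using B \<psi> by (intro diff_bimod_intro) (simp_all add: diff_phi_bimodule_def)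
  show ?thesis
    using \<phi> \<psi> by unfold_locales
      (simp_all add: diff_alg_morphism_def diff_phi_bimodule_def linear_iff_lin pullback_def)
qed

theorem theorem4p1:
  fixes lam :: "'k::field_char_0"
    and A :: "('k, 'a::ab_group_add) dalg"
    and B :: "('k, 'b::ab_group_add) dalg"
    and \<phi> :: "'a \<Rightarrow> 'b"
    and M :: "('k, 'a, 'm::ab_group_add) dbimod"
    and N :: "('k, 'b, 'n::ab_group_add) dbimod"
    and \<psi> :: "'m \<Rightarrow> 'n"
  assumes "diff_algebra lam A"
    and "diff_algebra lam B"
    and "diff_alg_morphism A B \<phi>"
    and "diff_phi_bimodule lam A B \<phi> M N \<psi>"
  shows "(\<forall>n\<ge>2. lin_isomorphic (H_mor lam A B \<phi> M N \<psi> n)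
            (H_DA lam (mapping_ring A B \<phi>) (mapping_bimodule \<phi> M N \<psi>) n))
       \<and> (\<forall>n. (n = 0 \<longrightarrow> unital_bimodule A M \<and> unital_bimodule B N) \<and>
              (n = 1 \<longrightarrow> unital_bimodule A (twist lam A M) \<and> unital_bimodule B (twist lam B N)) \<longrightarrow>
            lin_isomorphic (H_mor_chain lam A B \<phi> M N \<psi> n)
              (H_DA lam (mapping_ring A B \<phi>) (mapping_bimodule \<phi> M N \<psi>) n))"
proof -
  interpret diff_phi_bimod lam A M B N \<phi> \<psi>
    using assms by (rule diff_phi_bimod_intro)
  show ?thesis
    using H_mor_chain_isomorphic by (simp add: H_mor_eq_H_mor_chain)
qed

end
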